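(* Let $(\xi_i)_{i\in\mathbb{Z}}$ be i.i.d. centered random variables with finite second moment. Let $(a_i)_{i\in\mathbb{Z}}$ be real numbers with $\sum_{i\in\mathbb{Z}}a_i^2<\infty$, let $X_k=\sum_{j=-\infty}^{\infty}a_{k-j}\xi_j$, $S_n=\sum_{k=1}^nX_k=\sum_{i\in\mathbb{Z}}b_{ni}\xi_i$ with $b_{ni}=a_{1-i}+\cdots+a_{n-i}$, and $\sigma_n^2=\mathbb{E}\xi_0^2\sum_{i\in\mathbb{Z}}b_{ni}^2$. Assume $\sigma_n^2\to\infty$ as $n\to\infty$. For $s>2$ put $U_{ns}=\big(\sum_{i\in\mathbb{Z}}b_{ni}^2\big)^{-s/2}\sum_{i\in\mathbb{Z}}|b_{ni}|^s$. (i) Assume that for a certain $t>2$ and a slowly varying function $h$, $\mathbb{P}(\xi_0\ge x)=h(x)/x^t$ as $x\to\infty$ (i.e. for all sufficiently large $x$), that $\mathbb{E}|\xi_0|^p<\infty$ for a certain $p>2$, and that $b_{ni}>0$ for all $n,i$. Then for every sequence $(x_n)$ with $x_n\ge c$ for all $n$, for some $c>0$, as $n\to\infty$, $$\mathbb{P}(S_n\ge x_n\sigma_n)=(1+o(1))\sum_{i\in\mathbb{Z}}\mathbb{P}(b_{ni}\xi_0\ge x_n\sigma_n)+(1-\Phi(x_n))(1+o(1)).$$ Moreover, if $x_n\ge a(\ln U_{nt}^{-1})^{1/2}$ with a constant $a>2^{1/2}$, then $$\mathbb{P}(S_n\ge x_n\sigma_n)=(1+o(1))\sum_{i\in\mathbb{Z}}\mathbb{P}(b_{ni}\xi_0\ge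 x_n\sigma_n)\quad\text{as } n\to\infty,\qquad(\ast)$$ and if $0<x_n\le b(\ln U_{nt}^{-1})^{1/2}$ with a constant $b<2^{1/2}$, then $$\mathbb{P}(S_n\ge x_n\sigma_n)=(1-\Phi(x_n))(1+o(1))\quad\text{as } n\to\infty.\qquad(\ast\ast)$$ (ii) Assume that for a certain $t>2$ and a slowly varying function $h$, $\mathbb{P}(\xi_0\ge x)=h(x)/x^t$ as $x\to\infty$, and that $b_{ni}>0$ for all $n,i$. Then $(\ast)$ holds for every sequence $x_n\ge C_t(\ln U_{nt}^{-1})^{1/2}$ with a constant $C_t>e^{t/2}(t+2)/\sqrt2$. (iii) Assume that $\mathbb{E}|\xi_0|^p<\infty$ for a certain $p>2$. Then $(\ast\ast)$ holds for every sequence with $x_n^2\le2\ln(U_{np}^{-1})$.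
   Context: $\Phi$ is the standard normal distribution function. A (measurable, eventually positive) function $h$ is slowly varying if $\lim_{x\to\infty}h(\lambda x)/h(x)=1$ for all $\lambda>0$. Each $o(1)$ denotes a (possibly different) sequence, which may depend on $(x_n)$ and on the underlying distribution, converging to $0$ as $n\to\infty$. *)

theory Defs
  imports "HOL-Probability.Probability"
begin

definition slowly_varying :: "(real \<Rightarrow> real) \<Rightarrow> bool" where
  "slowly_varying h \<longleftrightarrow>
     h \<in> borel_measurable borel \<and> (\<forall>\<^sub>F x in at_top. 0 < h x) \<and>
     (\<forall>l>0. ((\<lambda>x. h (l * x) / h x) \<longlongrightarrow> 1) at_top)"

definition regular_right_tail ::
    "'a measure \<Rightarrow> ('a \<Rightarrow> real) \<Rightarrow> real \<Rightarrow> (real \<Rightarrow> real) \<Rightarrow> bool" where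
  "regular_right_tail M Y t h \<longleftrightarrow>
     slowly_varying h \<and> (\<forall>\<^sub>F x in at_top. \<P>(w in M. Y w \<ge> x) = h x / x powr t)"

definition iid_family :: "'a measure \<Rightarrow> ('i \<Rightarrow> 'a \<Rightarrow> real) \<Rightarrow> bool" where
  "iid_family M \<xi> \<longleftrightarrow>
     prob_space.indep_vars M (\<lambda>_. borel) \<xi> UNIV \<and>
     (\<forall>i j. distr M borel (\<xi> i) = distr M borel (\<xi> j))"

text \<open>The random series \<open>\<Sum>j. Y j\<close> converges to \<open>Z\<close> in mean square. For independent centered
  summands with summable variances this determines \<open>Z\<close> up to a null set, and \<open>Z\<close> is then also the
  almost sure limit of the two-sided series. The Lebesgue integral for nonnegative functions is
  used because the Bochner integral of a non-integrable function is 0.\<close>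

definition has_mean_square_sum ::
    "'a measure \<Rightarrow> ('i \<Rightarrow> 'a \<Rightarrow> real) \<Rightarrow> ('a \<Rightarrow> real) \<Rightarrow> bool" where
  "has_mean_square_sum M Y Z \<longleftrightarrow>
     Z \<in> borel_measurable M \<and>
     ((\<lambda>F. \<integral>\<^sup>+ w. ennreal (((\<Sum>j\<in>F. Y j w) - Z w)\<^sup>2) \<partial>M) \<longlongrightarrow> 0)
       (finite_subsets_at_top UNIV)"

definition linear_process ::
    "'a measure \<Rightarrow> (int \<Rightarrow> real) \<Rightarrow> (int \<Rightarrow> 'a \<Rightarrow> real) \<Rightarrow> (int \<Rightarrow> 'a \<Rightarrow> real) \<Rightarrow> bool" where
  "linear_process M a \<xi> X \<longleftrightarrow>
     (\<forall>k. has_mean_square_sum M (\<lambda>j w. a (k - j) * \<xi> j w) (X k))"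

definition psum :: "(int \<Rightarrow> 'a \<Rightarrow> real) \<Rightarrow> nat \<Rightarrow> 'a \<Rightarrow> real" where
  "psum X n w = (\<Sum>k = 1..int n. X k w)"

definition bcoef :: "(int \<Rightarrow> real) \<Rightarrow> nat \<Rightarrow> int \<Rightarrow> real" where
  "bcoef a n i = (\<Sum>k = 1..int n. a (k - i))"

definition psum_var :: "'a measure \<Rightarrow> (int \<Rightarrow> real) \<Rightarrow> (int \<Rightarrow> 'a \<Rightarrow> real) \<Rightarrow> nat \<Rightarrow> real" where
  "psum_var M a \<xi> n =
     integral\<^sup>L M (\<lambda>w. (\<xi> 0 w)\<^sup>2) * (\<Sum>\<^sub>\<infinity>i. (bcoef a n i)\<^sup>2)"

definition psum_sd :: "'a measure \<Rightarrow> (int \<Rightarrow> real) \<Rightarrow> (int \<Rightarrow> 'a \<Rightarrow> real) \<Rightarrow> nat \<Rightarrow> real" where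
  "psum_sd M a \<xi> n = sqrt (psum_var M a \<xi> n)"

text \<open>If all \<open>bcoef a n i\<close> vanish for some \<open>n\<close>, the ratio below is \<open>0 / 0\<close> on paper and 0 here.\<close>

definition lyap_ratio :: "(int \<Rightarrow> real) \<Rightarrow> nat \<Rightarrow> real \<Rightarrow> real" where
  "lyap_ratio a n s =
     (\<Sum>\<^sub>\<infinity>i. (bcoef a n i)\<^sup>2) powr (- s / 2) * (\<Sum>\<^sub>\<infinity>i. \<bar>bcoef a n i\<bar> powr s)"

definition jump_tail ::
    "'a measure \<Rightarrow> (int \<Rightarrow> real) \<Rightarrow> (int \<Rightarrow> 'a \<Rightarrow> real) \<Rightarrow> nat \<Rightarrow> real \<Rightarrow> real" where
  "jump_tail M a \<xi> n y = (\<Sum>\<^sub>\<infinity>i. \<P>(w in M. bcoef a n i * \<xi> 0 w \<ge> y))"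

abbreviation std_normal_cdf :: "real \<Rightarrow> real" where
  "std_normal_cdf \<equiv> cdf std_normal_distribution"

text \<open>\<open>f = (1 + o(1)) g\<close>, written out; only the behaviour for large \<open>n\<close> matters.\<close>

definition eq_up_to_o1 :: "(nat \<Rightarrow> real) \<Rightarrow> (nat \<Rightarrow> real) \<Rightarrow> bool" where
  "eq_up_to_o1 f g \<longleftrightarrow>
     (\<exists>e. e \<longlonglongrightarrow> 0 \<and> (\<forall>\<^sub>F n in sequentially. f n = (1 + e n) * g n))"

end

theory Submission
  imports Defs "HOL-Real_Asymp.Real_Asymp"
begin

text \<open>
  Normalise so that the innovations have variance 1 and the squared weights sum to 1. Truncate every
  summand from above at a level of order \<open>1 / x\<close>. Either no summand exceeds the level, or exactly one
  does and it accounts for almost all of \<open>x\<close>, or two do, which is negligible. The one-jump event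
  produces the sum of the individual tails, because these vary regularly. Without a jump, the
  truncated sum has exponential moments \<open>exp (l\<^sup>2 / 2 + O(1))\<close> up to \<open>l = x\<close>, so Lindeberg's replacement
  method with a smooth step function supported to the right of \<open>x\<close> has an error that is small
  relative to \<open>exp (- x\<^sup>2 / 2)\<close>, as long as \<open>x\<^sup>2\<close> is at most a multiple of \<open>ln (1 / U)\<close>. For larger \<open>x\<close>
  Chernoff bounds show that the truncated sum contributes less than the jumps. All estimates are
  uniform in the weights and depend only on their Lyapunov quotient, which tends to 0 for a linear
  process because consecutive coefficients differ by a bounded amount.
\<close>

section \<open>Lindeberg replacement with exponential weights\<close>

text \<open>The obstacle is that errors must be small relative to a probability of order
  exp(-x^2/2)/x. Weighting Taylor remainders by \<open>exp (l * z)\<close> with l = x (at least 1)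
  carries the Gaussian factor through the replacement and leaves a fixed power of x, to be beaten by
  a power of the Lyapunov quotient U. Truncation acts on one side only: a summand above the level
  becomes 0, and in the crude Chernoff bounds the left tail enters through the second moment alone,
  because exp v \<le> 1 + v + v^2/2 for v \<le> 0. The threshold x^2 = 2 ln (1/U) comes from
  comparing exp(-x^2/2) with the jump sum, which is U up to powers of x and arbitrarily small
  changes of the exponent; the strict inequalities with sqrt 2 absorb these. Close above the
  threshold the Chernoff exponent has to be nearly -x^2/2, hence a truncation level e1/x with small
  e1. All thresholds depend on the tolerance and on the law alone, so they are fixed before
  n.\<close>

definition ramp :: "real \<Rightarrow> real" where "ramp s = max s 0"

text \<open>On either side of the kink the remainder is exactly u ^ 3 or 0. If s + u falls below 0,
  the discarded cube is subtracted from \<bar>u\<bar> ^ 3 and is no larger than it; if s starts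
  below 0, only (s + u) ^ 3 with 0 \<le> s + u \<le> u is left.\<close>

lemma ramp_cube_taylor:
  "\<bar>ramp (s + u) ^ 3 - ramp s ^ 3 - 3 * u * ramp s ^ 2 - 3 * u\<^sup>2 * ramp s\<bar> \<le> \<bar>u\<bar> ^ 3"
proof -
  consider "s \<ge> 0" "s + u \<ge> 0" | "s \<ge> 0" "s + u < 0" | "s < 0" "s + u \<ge> 0" | "s < 0" "s + u < 0"
    by linarith
  then show ?thesis
  proof cases
    case 1
    have "(s + u) ^ 3 - s ^ 3 - 3 * u * s ^ 2 - 3 * u\<^sup>2 * s = u ^ 3"
      by (simp add: power2_eq_square power3_eq_cube algebra_simps)
    with 1 show ?thesis by (simp add: ramp_def power_abs)
  next
    case 2
    have eq: "0 - s ^ 3 - 3 * u * s ^ 2 - 3 * u\<^sup>2 * s = (- (s + u)) ^ 3 + u ^ 3"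
      by (simp add: power2_eq_square power3_eq_cube algebra_simps)
    have "(- (s + u)) ^ 3 \<le> (- u) ^ 3"
      using 2 by (intro power_mono) auto
    moreover have "0 \<le> (- (s + u)) ^ 3" using 2 by (intro zero_le_power) simp
    moreover have "(- u) ^ 3 = - (u ^ 3)" "\<bar>u\<bar> ^ 3 = - (u ^ 3)"
      using 2 by (simp_all add: power3_eq_cube abs_if)
    ultimately show ?thesis using 2 eq by (simp add: ramp_def)
  next
    case 3
    then have "(s + u) ^ 3 \<le> u ^ 3" by (intro power_mono) auto
    with 3 show ?thesis by (simp add: ramp_def)
  qed (simp add: ramp_def)
qed

text \<open>The cubic B-spline step: \<open>step2\<close> is Lipschitz, which is all the smoothness needed below,
  and the Taylor estimate is exact algebra on each term.\<close>

definition step :: "real \<Rightarrow> real" where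
  "step s = (ramp s ^ 3 - 3 * ramp (s - 1) ^ 3 + 3 * ramp (s - 2) ^ 3 - ramp (s - 3) ^ 3) / 6"

text \<open>The derivative of \<open>step\<close>: the quadratic B-spline on [0, 3], which is the
  density of a sum of three independent uniform variables. \<open>step2\<close> is the next
  derivative.\<close>

definition step1 :: "real \<Rightarrow> real" where
  "step1 s = (ramp s ^ 2 - 3 * ramp (s - 1) ^ 2 + 3 * ramp (s - 2) ^ 2 - ramp (s - 3) ^ 2) / 2"

definition step2 :: "real \<Rightarrow> real" where
  "step2 s = ramp s - 3 * ramp (s - 1) + 3 * ramp (s - 2) - ramp (s - 3)"

lemma step_borel [measurable]:
  "step \<in> borel_measurable borel" "step1 \<in> borel_measurable borel" "step2 \<in> borel_measurable borel"
  unfolding step_def[abs_def] step1_def[abs_def] step2_def[abs_def] ramp_def[abs_def] by measurable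

lemma step_eq_0: "s \<le> 0 \<Longrightarrow> step s = 0" "s \<le> 0 \<Longrightarrow> step1 s = 0" "s \<le> 0 \<Longrightarrow> step2 s = 0"
  by (simp_all add: step_def step1_def step2_def ramp_def)

lemma step_eq_1: "s \<ge> 3 \<Longrightarrow> step s = 1" "s \<ge> 3 \<Longrightarrow> step1 s = 0" "s \<ge> 3 \<Longrightarrow> step2 s = 0"
  by (simp_all add: step_def step1_def step2_def ramp_def power2_eq_square power3_eq_cube algebra_simps)

lemma step_cases:
  fixes s :: real
  obtains "s \<le> 0" | "0 \<le> s" "s \<le> 1" | "1 \<le> s" "s \<le> 2" | "2 \<le> s" "s \<le> 3" | "3 \<le> s"
  by linarith

text \<open>Each unit interval gets its local coordinate r. The middle piece is written with r * (1
  + r * (1 - r)) because the bound of \<open>step\<close> by 1 then reduces to (1 - r)^2 \<ge>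
  0.\<close>

lemma step_mid:
  "0 \<le> r \<Longrightarrow> r \<le> 1 \<Longrightarrow> step r = r ^ 3 / 6"
  "0 \<le> r \<Longrightarrow> r \<le> 1 \<Longrightarrow> step (1 + r) = (1 + 3 * (r * (1 + r * (1 - r))) + r ^ 3) / 6"
  "0 \<le> r \<Longrightarrow> r \<le> 1 \<Longrightarrow> step (2 + r) = 1 - (1 - r) ^ 3 / 6"
  by (simp_all add: step_def ramp_def power2_eq_square power3_eq_cube field_simps)

lemma step1_mid:
  "0 \<le> r \<Longrightarrow> r \<le> 1 \<Longrightarrow> step1 r = r ^ 2 / 2"
  "0 \<le> r \<Longrightarrow> r \<le> 1 \<Longrightarrow> step1 (1 + r) = 1 / 2 + r * (1 - r)"
  "0 \<le> r \<Longrightarrow> r \<le> 1 \<Longrightarrow> step1 (2 + r) = (1 - r) ^ 2 / 2"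
  by (simp_all add: step1_def ramp_def power2_eq_square field_simps)

lemma step_bounds: "0 \<le> step s" "step s \<le> 1"
proof -
  have "0 \<le> step s \<and> step s \<le> 1"
  proof (cases s rule: step_cases)
    case 2
    then have "s ^ 3 \<le> 1" "0 \<le> s ^ 3" by (auto intro: power_le_one)
    with 2 show ?thesis by (simp add: step_mid)
  next
    case 3
    define r where "r = s - 1"
    have r: "0 \<le> r" "r \<le> 1" "s = 1 + r" using 3 by (auto simp: r_def)
    have "r * (1 + r * (1 - r)) \<le> r * (1 + 1 * (1 - r))"
      using r by (intro mult_left_mono add_mono mult_right_mono) auto
    also have "\<dots> \<le> 1"
      using zero_le_power2[of "1 - r"] by (simp add: power2_eq_square algebra_simps)
    finally have "r * (1 + r * (1 - r)) \<le> 1" .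
    moreover have "0 \<le> r * (1 + r * (1 - r))" "0 \<le> r ^ 3" "r ^ 3 \<le> 1"
      using r by (auto intro!: mult_nonneg_nonneg add_nonneg_nonneg power_le_one)
    ultimately have "0 \<le> (1 + 3 * q + r ^ 3) / 6 \<and> (1 + 3 * q + r ^ 3) / 6 \<le> 1"
      if "q = r * (1 + r * (1 - r))" for q
      using that by auto
    then show ?thesis unfolding r(3) step_mid(2)[OF r(1,2)] by blast
  next
    case 4
    define r where "r = s - 2"
    have r: "0 \<le> r" "r \<le> 1" "s = 2 + r" using 4 by (auto simp: r_def)
    then have "(1 - r) ^ 3 \<le> 1" "0 \<le> (1 - r) ^ 3" by (auto intro: power_le_one)
    then show ?thesis using step_mid(3)[OF r(1,2)] r(3) by simp
  qed (auto simp: step_eq_0 step_eq_1)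
  then show "0 \<le> step s" "step s \<le> 1" by auto
qed

lemma step1_bound: "\<bar>step1 s\<bar> \<le> 1"
proof (cases s rule: step_cases)
  case 2
  then have "s ^ 2 \<le> 1" "0 \<le> s ^ 2" by (auto intro: power_le_one)
  with 2 show ?thesis by (simp add: step1_mid)
next
  case 3
  define r where "r = s - 1"
  have r: "0 \<le> r" "r \<le> 1" "s = 1 + r" using 3 by (auto simp: r_def)
  have "0 \<le> r * (1 - r)" using r by simp
  moreover have "r * (1 - r) \<le> 1 / 2"
    using zero_le_power2[of "r - 1 / 2"] by (simp add: power2_eq_square algebra_simps)
  ultimately show ?thesis using step1_mid(2)[OF r(1,2)] r(3) by simp
next
  case 4
  define r where "r = s - 2"
  have r: "0 \<le> r" "r \<le> 1" "s = 2 + r" using 4 by (auto simp: r_def)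
  then have "(1 - r) ^ 2 \<le> 1" "0 \<le> (1 - r) ^ 2" by (auto intro: power_le_one)
  then show ?thesis unfolding r(3) step1_mid(3)[OF r(1,2)] by linarith
qed (auto simp: step_eq_0 step_eq_1)

lemma step2_bound: "\<bar>step2 s\<bar> \<le> 1"
  by (cases s rule: step_cases) (auto simp: step2_def ramp_def)

text \<open>The third difference of the estimate for one ramp: the coefficients 1 + 3 + 3 + 1 over 6
  give 4/3.\<close>

lemma step_taylor_cube:
  "\<bar>step (z + u) - step z - u * step1 z - u\<^sup>2 / 2 * step2 z\<bar> \<le> 4 / 3 * \<bar>u\<bar> ^ 3"
proof -
  define R where "R s = ramp (s + u) ^ 3 - ramp s ^ 3 - 3 * u * ramp s ^ 2 - 3 * u\<^sup>2 * ramp s" for s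
  have R: "\<bar>R s\<bar> \<le> \<bar>u\<bar> ^ 3" for s
    unfolding R_def by (rule ramp_cube_taylor)
  have "step (z + u) - step z - u * step1 z - u\<^sup>2 / 2 * step2 z =
      (R z - 3 * R (z - 1) + 3 * R (z - 2) - R (z - 3)) / 6"
    by (simp add: step_def step1_def step2_def R_def field_simps)
  moreover have "\<bar>(R0 - 3 * R1 + 3 * R2 - R3) / 6\<bar> \<le> 4 / 3 * c"
    if "\<bar>R0\<bar> \<le> c" "\<bar>R1\<bar> \<le> c" "\<bar>R2\<bar> \<le> c" "\<bar>R3\<bar> \<le> c" for R0 R1 R2 R3 c :: real
    using that by (simp add: abs_le_iff)
  note this[OF R R R R, of z "z - 1" "z - 2" "z - 3"]
  ultimately show ?thesis by (simp only:)
qed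

text \<open>For small u the cubic remainder is at most \<bar>u\<bar> powr r; for large u boundedness
  of the spline and its derivatives leaves 1 + \<bar>u\<bar> + u^2/2, a multiple of u^2. Covering
  all r between 2 and 3 lets moments of any order above 2 enter later.\<close>

lemma step_taylor:
  fixes r :: real
  assumes "2 \<le> r" "r \<le> 3"
  shows "\<bar>step (z + u) - step z - u * step1 z - u\<^sup>2 / 2 * step2 z\<bar> \<le> 4 * \<bar>u\<bar> powr r"
proof (cases "\<bar>u\<bar> \<le> 1")
  case True
  show ?thesis
  proof (cases "u = 0")
    case False
    have "\<bar>u\<bar> powr 3 \<le> \<bar>u\<bar> powr r"
      using True assms by (intro powr_mono') auto
    moreover have "\<bar>u\<bar> powr 3 = \<bar>u\<bar> ^ 3" using False by (simp add: powr_realpow)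
    moreover have "0 \<le> \<bar>u\<bar> ^ 3" by simp
    ultimately show ?thesis using step_taylor_cube[of z u] by linarith
  qed simp
next
  case False
  then have "\<bar>u\<bar> powr 2 \<le> \<bar>u\<bar> powr r" using assms by (intro powr_mono) auto
  moreover have "\<bar>u\<bar> powr 2 = u\<^sup>2" using False by (simp add: powr_realpow)
  moreover have "\<bar>u\<bar> * 1 \<le> \<bar>u\<bar> * \<bar>u\<bar>" using False by (intro mult_left_mono) auto
  then have "\<bar>u\<bar> \<le> u\<^sup>2" by (simp add: power2_eq_square)
  moreover have "\<bar>u * step1 z\<bar> \<le> \<bar>u\<bar>"
    using mult_left_mono[OF step1_bound[of z], of "\<bar>u\<bar>"] by (simp add: abs_mult)
  moreover have "\<bar>u\<^sup>2 / 2 * step2 z\<bar> \<le> u\<^sup>2 / 2"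
    using mult_left_mono[OF step2_bound[of z], of "u\<^sup>2 / 2"] by (simp add: abs_mult)
  moreover have "\<bar>step (z + u) - step z\<bar> \<le> 1"
    using step_bounds[of z] step_bounds[of "z + u"] by linarith
  ultimately show ?thesis using False by linarith
qed

text \<open>The weight \<open>exp (l * z)\<close> makes the replacement errors as small as the Gaussian tail that is
  to be approximated, so that no change of measure and no Berry-Esseen bound are needed.\<close>

definition tilted_taylor ::
    "real \<Rightarrow> real \<Rightarrow> real \<Rightarrow> (real \<Rightarrow> real) \<Rightarrow> (real \<Rightarrow> real) \<Rightarrow> (real \<Rightarrow> real) \<Rightarrow> bool" where
  "tilted_taylor r l D g g1 g2 \<longleftrightarrow>
     g \<in> borel_measurable borel \<and> g1 \<in> borel_measurable borel \<and> g2 \<in> borel_measurable borel \<and>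
     (\<exists>B. \<forall>z. \<bar>g z\<bar> \<le> B \<and> \<bar>g1 z\<bar> \<le> B \<and> \<bar>g2 z\<bar> \<le> B) \<and>
     (\<forall>z. \<bar>g1 z\<bar> \<le> D * exp (l * z)) \<and> (\<forall>z. \<bar>g2 z\<bar> \<le> D * exp (l * z)) \<and>
     (\<forall>z u. \<bar>g (z + u) - g z - u * g1 z - u\<^sup>2 / 2 * g2 z\<bar> \<le>
        D * exp (l * z) * (exp (l * max u 0) * \<bar>u\<bar> powr r))"

text \<open>Everything vanishes to the left of x, so wherever something survives the factor exp of l
  times the distance past x is at least 1 and may be inserted. The chain rule costs at most w^(-3),
  as w \<le> 1 and r \<le> 3.\<close>

lemma tilted_taylor_step:
  assumes r: "2 \<le> r" "r \<le> 3" and w: "0 < w" "w \<le> 1" and l: "0 \<le> l"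
  shows "tilted_taylor r l (4 / w ^ 3 * exp (- l * x)) (\<lambda>s. step ((s - x) / w))
    (\<lambda>s. step1 ((s - x) / w) / w) (\<lambda>s. step2 ((s - x) / w) / w\<^sup>2)"
  unfolding tilted_taylor_def
proof (intro conjI allI)
  have w1: "1 / w \<le> 1 / w ^ 3" and w2: "1 / w\<^sup>2 \<le> 1 / w ^ 3" and w0: "1 \<le> 1 / w ^ 3"
    using w by (auto simp: frac_le power_le_one power_decreasing[of 2 3 w] power_decreasing[of 1 3 w, simplified])
  show "\<exists>B. \<forall>z. \<bar>step ((z - x) / w)\<bar> \<le> B \<and> \<bar>step1 ((z - x) / w) / w\<bar> \<le> B \<and> \<bar>step2 ((z - x) / w) / w\<^sup>2\<bar> \<le> B"
  proof (intro exI[of _ "1 / w ^ 3"] allI conjI)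
    fix z
    show "\<bar>step ((z - x) / w)\<bar> \<le> 1 / w ^ 3"
      using step_bounds[of "(z - x) / w"] w0 by linarith
    show "\<bar>step1 ((z - x) / w) / w\<bar> \<le> 1 / w ^ 3"
      using divide_right_mono[OF step1_bound[of "(z - x) / w"], of w] w w1 by (simp add: abs_divide)
    show "\<bar>step2 ((z - x) / w) / w\<^sup>2\<bar> \<le> 1 / w ^ 3"
      using divide_right_mono[OF step2_bound[of "(z - x) / w"], of "w\<^sup>2"] w w2 by (simp add: abs_divide)
  qed
  have tilt: "c \<le> 4 / w ^ 3 * exp (- l * x) * exp (l * z)" if "c \<le> 1 / w ^ 3" "z \<ge> x" for c z
  proof -
    have "1 / w ^ 3 \<le> 4 / w ^ 3 * 1" using w by (simp add: divide_right_mono)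
    also have "\<dots> \<le> 4 / w ^ 3 * exp (l * (z - x))"
      using that l w by (intro mult_left_mono) auto
    also have "\<dots> = 4 / w ^ 3 * exp (- l * x) * exp (l * z)"
      by (simp add: algebra_simps flip: exp_add)
    finally show ?thesis using that(1) by linarith
  qed
  fix z u
  have sgn: "(z - x) / w \<le> 0" if "\<not> z \<ge> x" for z using that w by (simp add: divide_nonpos_pos)
  show "\<bar>step1 ((z - x) / w) / w\<bar> \<le> 4 / w ^ 3 * exp (- l * x) * exp (l * z)"
  proof (cases "z \<ge> x")
    case True
    have "\<bar>step1 ((z - x) / w) / w\<bar> \<le> 1 / w ^ 3"
      using divide_right_mono[OF step1_bound[of "(z - x) / w"], of w] w w1 by (simp add: abs_divide)
    then show ?thesis using True by (rule tilt)
  qed (use w in \<open>simp add: step_eq_0 sgn\<close>)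
  show "\<bar>step2 ((z - x) / w) / w\<^sup>2\<bar> \<le> 4 / w ^ 3 * exp (- l * x) * exp (l * z)"
  proof (cases "z \<ge> x")
    case True
    have "\<bar>step2 ((z - x) / w) / w\<^sup>2\<bar> \<le> 1 / w ^ 3"
      using divide_right_mono[OF step2_bound[of "(z - x) / w"], of "w\<^sup>2"] w w2 by (simp add: abs_divide)
    then show ?thesis using True by (rule tilt)
  qed (use w in \<open>simp add: step_eq_0 sgn\<close>)
  let ?rem = "step ((z + u - x) / w) - step ((z - x) / w) - u * (step1 ((z - x) / w) / w)
      - u\<^sup>2 / 2 * (step2 ((z - x) / w) / w\<^sup>2)"
  show "\<bar>?rem\<bar> \<le> 4 / w ^ 3 * exp (- l * x) * exp (l * z) * (exp (l * max u 0) * \<bar>u\<bar> powr r)"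
  \<comment> \<open>The remainder can differ from 0 although z < x, namely if z + u reaches x. This
    is why the weight in \<open>tilted_taylor\<close> contains
    \<open>exp (l * max u 0)\<close>.\<close>
  proof (cases "z + max u 0 \<ge> x")
    case True
    have "?rem = step ((z - x) / w + u / w) - step ((z - x) / w) - (u / w) * step1 ((z - x) / w)
      - (u / w)\<^sup>2 / 2 * step2 ((z - x) / w)"
      using w by (simp add: field_simps)
    then have "\<bar>?rem\<bar> \<le> 4 * \<bar>u / w\<bar> powr r" using step_taylor[OF r] by metis
    also have "\<dots> = 4 * \<bar>u\<bar> powr r * (1 / w) powr r"
      using w by (simp add: abs_divide powr_divide)
    also have "\<dots> \<le> 4 * \<bar>u\<bar> powr r * (1 / w) powr 3"
      using w r by (intro mult_left_mono powr_mono) auto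
    also have "(1 / w) powr 3 = 1 / w ^ 3" using w by (simp add: powr_realpow power_one_over)
    also have "4 * \<bar>u\<bar> powr r * (1 / w ^ 3) \<le> 4 * \<bar>u\<bar> powr r * (1 / w ^ 3 * exp (l * (z + max u 0 - x)))"
      using True l w by (intro mult_left_mono mult_right_mono) (auto simp: divide_simps)
    also have "\<dots> = 4 / w ^ 3 * exp (- l * x) * exp (l * z) * (exp (l * max u 0) * \<bar>u\<bar> powr r)"
      by (simp add: algebra_simps flip: exp_add)
    finally show ?thesis .
  next
    case False
    then have "\<not> z \<ge> x" "\<not> z + u \<ge> x" by auto
    then show ?thesis using w by (simp add: step_eq_0 sgn)
  qed
qed (measurable)

section \<open>Gaussian smoothing\<close>

interpretation std_normal: prob_space std_normal_distribution
  by (rule prob_space_normal_density) simp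

lemma std_normal_exp:
  "integrable std_normal_distribution (\<lambda>r. exp (c * r))"
  "(\<integral>r. exp (c * r) \<partial>std_normal_distribution) = exp (c\<^sup>2 / 2)"
proof -
  have eq: "std_normal_density r * exp (c * r) = exp (c\<^sup>2 / 2) * normal_density c 1 r" for r
  proof -
    have "- r\<^sup>2 / 2 + c * r = c\<^sup>2 / 2 + - (r - c)\<^sup>2 / 2"
      by (simp add: power2_eq_square algebra_simps diff_divide_distrib add_divide_distrib)
    then have "exp (- r\<^sup>2 / 2) * exp (c * r) = exp (c\<^sup>2 / 2) * exp (- (r - c)\<^sup>2 / 2)"
      by (metis exp_add)
    then show ?thesis by (simp add: normal_density_def)
  qed
  show "integrable std_normal_distribution (\<lambda>r. exp (c * r))"
    by (subst integrable_density) (auto simp: eq)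
  show "(\<integral>r. exp (c * r) \<partial>std_normal_distribution) = exp (c\<^sup>2 / 2)"
    by (subst integral_density) (auto simp: eq)
qed

lemma std_normal_moments:
  "(\<integral>r. r \<partial>std_normal_distribution) = 0" "integrable std_normal_distribution (\<lambda>r. r)"
  "(\<integral>r. r\<^sup>2 \<partial>std_normal_distribution) = 1" "integrable std_normal_distribution (\<lambda>r. r\<^sup>2)"
  using integral_std_normal_distribution_moment_odd[of 1] std_normal_distribution_even_moments[of 1]
    integrable_std_normal_distribution_moment[of 1] by simp_all

text \<open>For u > 1 the power is at most u ^ 3, and u ^ 3 / 3! is one term of the exponential
  series; the 6 is 3!.\<close>

lemma powr_le_exp:
  fixes u r :: real
  assumes "0 \<le> u" "0 < r" "r \<le> 3"
  shows "u powr r \<le> 6 * exp u"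
proof (cases "u \<le> 1")
  case True
  then have "u powr r \<le> 1" using assms powr_mono2[of r u 1] by simp
  also have "\<dots> \<le> 6 * exp u" using one_le_exp_iff[of u] assms by linarith
  finally show ?thesis .
next
  case False
  then have "u powr r \<le> u powr 3" using assms by (intro powr_mono) auto
  also have "\<dots> = u ^ 3" using False by (simp add: powr_realpow)
  also have "\<dots> \<le> 6 * exp u"
  proof -
    have "u ^ 3 /\<^sub>R fact 3 \<le> (\<Sum>n<4. u ^ n /\<^sub>R fact n)"
      using assms by (intro member_le_sum) auto
    also have "\<dots> \<le> exp u"
      unfolding exp_def using assms summable_exp_generic[of u]
      by (intro sum_le_suminf) (auto simp: scaleR_conv_of_real)
    finally show ?thesis by (simp add: fact_numeral field_simps)
  qed
  finally show ?thesis .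
qed

text \<open>The heat semigroup at time v: g averaged over a centered normal shift of variance v.
  Parametrising by variance makes variances add under composition.\<close>

definition smooth :: "real \<Rightarrow> (real \<Rightarrow> real) \<Rightarrow> real \<Rightarrow> real" where
  "smooth v g z = (\<integral>r. g (z + sqrt v * r) \<partial>std_normal_distribution)"

lemma smooth_0 [simp]: "smooth 0 g z = g z"
  using std_normal.prob_space by (simp add: smooth_def)

lemma smooth_measurable [measurable]:
  assumes [measurable]: "g \<in> borel_measurable borel"
  shows "smooth v g \<in> borel_measurable borel"
  unfolding smooth_def[abs_def] by measurable

lemma std_normal_integrable_bounded:
  fixes g :: "real \<Rightarrow> real"
  assumes [measurable]: "g \<in> borel_measurable borel" and B: "\<And>z. \<bar>g z\<bar> \<le> B"
  shows "integrable std_normal_distribution (\<lambda>r. g (z + c * r))"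
  by (rule std_normal.integrable_const_bound[of _ B]) (auto simp: B)

text \<open>The sum of independent normal variables with variances a and b is normal with variance a
  + b, realised here on the product of two standard normal spaces. Boundedness of g justifies the
  exchange of integrals; the degenerate variances are split off because the addition theorem speaks
  of positive standard deviations.\<close>

lemma smooth_smooth:
  assumes [measurable]: "g \<in> borel_measurable borel" and B: "\<And>z. \<bar>g z\<bar> \<le> B"
    and ab: "0 \<le> a" "0 \<le> b"
  shows "smooth a (smooth b g) z = smooth (a + b) g z"
proof (cases "a = 0 \<or> b = 0")
  case True
  then show ?thesis by (auto simp: smooth_0[abs_def])
next
  case False
  then have pos: "0 < a" "0 < b" using ab by auto
  let ?N = std_normal_distribution
  let ?P = "?N \<Otimes>\<^sub>M ?N"
  interpret P: pair_prob_space ?N ?N ..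
  have setsP: "sets ?P = sets (borel \<Otimes>\<^sub>M borel)"
    by (intro sets_pair_measure_cong) simp_all
  have fst_N: "distr ?P borel fst = ?N"
    using std_normal.distr_pair_fst[of ?N]
    by (metis distr_cong sets_density sets_lborel)
  have snd_N: "distr ?P borel snd = ?N"
  proof -
    have "distr ?P borel snd = distr (distr ?P ?P (\<lambda>(x, y). (y, x))) borel fst"
      by (subst distr_distr) (auto simp: comp_def split_beta')
    also have "\<dots> = ?N"
      by (metis P.distr_pair_swap fst_N)
    finally show ?thesis .
  qed
  have fst_d: "distributed ?P lborel fst (\<lambda>x. ennreal (std_normal_density x))"
    and snd_d: "distributed ?P lborel snd (\<lambda>x. ennreal (std_normal_density x))"
    using fst_N snd_N unfolding distributed_def
    by (auto simp: distr_cong[of ?P ?P lborel borel] measurable_cong_sets[OF setsP refl])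
  have "distr ?P borel fst \<Otimes>\<^sub>M distr ?P borel snd = distr ?P (borel \<Otimes>\<^sub>M borel) (\<lambda>x. (fst x, snd x))"
    unfolding fst_N snd_N using distr_cong[OF refl setsP, of ?P "\<lambda>x. x" "\<lambda>x. (fst x, snd x)"]
    by (simp add: distr_id)
  then have ind: "P.indep_var borel fst borel snd"
    unfolding P.indep_var_distribution_eq by (simp add: measurable_cong_sets[OF setsP refl])
  have ind2: "P.indep_var borel (\<lambda>w. 0 + sqrt a * fst w) borel (\<lambda>w. 0 + sqrt b * snd w)"
    using P.indep_var_compose[OF ind, of "\<lambda>r. 0 + sqrt a * r" borel "\<lambda>r. 0 + sqrt b * r" borel]
    by (simp add: comp_def)
  have "distributed ?P lborel (\<lambda>w. 0 + sqrt a * fst w) (normal_density (0 + sqrt a * 0) (\<bar>sqrt a\<bar> * 1))"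
    and "distributed ?P lborel (\<lambda>w. 0 + sqrt b * snd w) (normal_density (0 + sqrt b * 0) (\<bar>sqrt b\<bar> * 1))"
    using P.normal_density_affine[OF fst_d, of "sqrt a" 0] P.normal_density_affine[OF snd_d, of "sqrt b" 0] pos
    by auto
  then have d1: "distributed ?P lborel (\<lambda>w. (0 + sqrt a * fst w) + (0 + sqrt b * snd w))
      (normal_density (0 + 0) (sqrt ((sqrt a)\<^sup>2 + (sqrt b)\<^sup>2)))"
    using pos by (intro P.add_indep_normal ind2) auto
  have d2: "distributed ?P lborel (\<lambda>w. 0 + sqrt (a + b) * fst w)
      (normal_density (0 + sqrt (a + b) * 0) (\<bar>sqrt (a + b)\<bar> * 1))"
    using pos by (intro P.normal_density_affine[OF fst_d]) auto
  have bd: "integrable ?P (\<lambda>(p, q). g (z + sqrt a * p + sqrt b * q))"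
    by (rule P.integrable_const_bound[of _ B]) (auto simp: B measurable_cong_sets[OF setsP refl] split_beta')
  have "smooth a (smooth b g) z = (\<integral>p. (\<integral>q. g (z + sqrt a * p + sqrt b * q) \<partial>?N) \<partial>?N)"
    by (simp add: smooth_def)
  also have "\<dots> = (\<integral>w. g (z + (0 + sqrt a * fst w + (0 + sqrt b * snd w))) \<partial>?P)"
    using P.integral_fst[OF bd] by (simp add: split_beta' add.assoc)
  also have "\<dots> = (\<integral>s. normal_density 0 (sqrt (a + b)) s * g (z + s) \<partial>lborel)"
    using distributed_integral[OF d1, of "\<lambda>s. g (z + s)"] pos by simp
  also have "\<dots> = (\<integral>w. g (z + sqrt (a + b) * fst w) \<partial>?P)"
    using distributed_integral[OF d2, of "\<lambda>s. g (z + s)"] pos by simp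
  also have "\<dots> = (\<integral>p. g (z + sqrt (a + b) * p) \<partial>?N)"
    by (subst (2) fst_N[symmetric], subst integral_distr) (auto simp: measurable_cong_sets[OF setsP refl])
  finally show ?thesis by (simp add: smooth_def)
qed

lemma tilted_taylorD:
  assumes "tilted_taylor r l D g g1 g2"
  shows "g \<in> borel_measurable borel" "g1 \<in> borel_measurable borel" "g2 \<in> borel_measurable borel"
    "\<bar>g1 z\<bar> \<le> D * exp (l * z)" "\<bar>g2 z\<bar> \<le> D * exp (l * z)"
    "\<bar>g (z + u) - g z - u * g1 z - u\<^sup>2 / 2 * g2 z\<bar> \<le> D * exp (l * z) * (exp (l * max u 0) * \<bar>u\<bar> powr r)"
  using assms unfolding tilted_taylor_def by blast+

lemma tilted_taylor_nonneg: "tilted_taylor r l D g g1 g2 \<Longrightarrow> 0 \<le> D"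
  using tilted_taylorD(4)[of r l D g g1 g2 0] by (simp add: order_trans[OF abs_ge_zero])

text \<open>The weight at the shifted point splits into \<open>exp (l * z)\<close> and
  \<open>exp (l * sqrt v * r)\<close>, whose Gaussian mean is
  \<open>exp (l\<^sup>2 * v / 2)\<close>. The class is thus preserved, and the constants multiply up
  to the Gaussian moment generating function as summands are replaced.\<close>

lemma tilted_taylor_smooth:
  assumes T: "tilted_taylor r l D g g1 g2" and v: "0 \<le> v"
  shows "tilted_taylor r l (D * exp (l\<^sup>2 * v / 2)) (smooth v g) (smooth v g1) (smooth v g2)"
proof -
  let ?N = std_normal_distribution
  note [measurable] = tilted_taylorD(1-3)[OF T]
  obtain B where B: "\<And>z. \<bar>g z\<bar> \<le> B" "\<And>z. \<bar>g1 z\<bar> \<le> B" "\<And>z. \<bar>g2 z\<bar> \<le> B"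
    using T unfolding tilted_taylor_def by blast
  have int: "integrable ?N (\<lambda>x. g (z + sqrt v * x))" "integrable ?N (\<lambda>x. g1 (z + sqrt v * x))"
    "integrable ?N (\<lambda>x. g2 (z + sqrt v * x))" for z
    by (rule std_normal_integrable_bounded, measurable, rule B)+
  have avg: "\<bar>\<integral>x. f x \<partial>?N\<bar> \<le> C" if "integrable ?N f" "\<And>x. \<bar>f x\<bar> \<le> C" for f :: "real \<Rightarrow> real" and C
  proof -
    have "\<bar>\<integral>x. f x \<partial>?N\<bar> \<le> (\<integral>x. \<bar>f x\<bar> \<partial>?N)" by (rule integral_abs_bound)
    also have "\<dots> \<le> (\<integral>x. C \<partial>?N)" using that by (intro integral_mono) auto
    finally show ?thesis using std_normal.prob_space by simp
  qed
  have tilt: "\<bar>\<integral>x. f x \<partial>?N\<bar> \<le> D * exp (l\<^sup>2 * v / 2) * exp (l * z) * c"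
    if f: "integrable ?N f" "\<And>x. \<bar>f x\<bar> \<le> D * exp (l * (z + sqrt v * x)) * c" for f :: "real \<Rightarrow> real" and c z
  proof -
    have eq: "D * exp (l * (z + sqrt v * x)) * c = D * exp (l * z) * c * exp ((l * sqrt v) * x)" for x
      by (simp add: algebra_simps exp_add)
    have "\<bar>\<integral>x. f x \<partial>?N\<bar> \<le> (\<integral>x. \<bar>f x\<bar> \<partial>?N)" by (rule integral_abs_bound)
    also have "\<dots> \<le> (\<integral>x. D * exp (l * z) * c * exp ((l * sqrt v) * x) \<partial>?N)"
      using f by (intro integral_mono integrable_mult_right std_normal_exp integrable_abs) (auto simp: eq)
    also have "\<dots> = D * exp (l * z) * c * exp (l\<^sup>2 * v / 2)"
      using v by (simp add: std_normal_exp power_mult_distrib)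
    finally show ?thesis by (simp add: mult_ac)
  qed
  show ?thesis
    unfolding tilted_taylor_def
  proof (intro conjI allI exI[of _ B])
    fix z u
    show "\<bar>smooth v g z\<bar> \<le> B" "\<bar>smooth v g1 z\<bar> \<le> B" "\<bar>smooth v g2 z\<bar> \<le> B"
      unfolding smooth_def by (intro avg int B)+
    show "\<bar>smooth v g1 z\<bar> \<le> D * exp (l\<^sup>2 * v / 2) * exp (l * z)"
      using tilt[of "\<lambda>x. g1 (z + sqrt v * x)" z 1] int tilted_taylorD(4)[OF T] by (simp add: smooth_def)
    show "\<bar>smooth v g2 z\<bar> \<le> D * exp (l\<^sup>2 * v / 2) * exp (l * z)"
      using tilt[of "\<lambda>x. g2 (z + sqrt v * x)" z 1] int tilted_taylorD(5)[OF T] by (simp add: smooth_def)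
    have "smooth v g (z + u) - smooth v g z - u * smooth v g1 z - u\<^sup>2 / 2 * smooth v g2 z =
        (\<integral>x. g (z + sqrt v * x + u) - g (z + sqrt v * x) - u * g1 (z + sqrt v * x)
           - u\<^sup>2 / 2 * g2 (z + sqrt v * x) \<partial>?N)"
      unfolding smooth_def using int[of "z + u"] int[of z]
      by (simp add: Bochner_Integration.integral_diff add_ac)
    also have "\<bar>\<dots>\<bar> \<le> D * exp (l\<^sup>2 * v / 2) * exp (l * z) * (exp (l * max u 0) * \<bar>u\<bar> powr r)"
      using int[of "z + u"] int[of z] by (intro tilt tilted_taylorD(6)[OF T]) (simp add: add_ac)
    finally show "\<bar>smooth v g (z + u) - smooth v g z - u * smooth v g1 z - u\<^sup>2 / 2 * smooth v g2 z\<bar>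
      \<le> D * exp (l\<^sup>2 * v / 2) * exp (l * z) * (exp (l * max u 0) * \<bar>u\<bar> powr r)" .
  qed measurable
qed

text \<open>The linear Taylor term has mean 0 and the quadratic one has mean v / 2, so only the
  remainder is left. As l * sqrt v \<le> 1, weight and power are at most 6 exp(2 \<bar>r\<bar>) up
  to scaling; the two exponentials exp(2 r) and exp(-2 r) have mean exp 2 each, hence 12 * exp
  2.\<close>

lemma smooth_taylor:
  assumes T: "tilted_taylor r l D g g1 g2" and r: "0 < r" "r \<le> 3"
    and v: "0 \<le> v" and l: "0 \<le> l" "l * sqrt v \<le> 1"
  shows "\<bar>smooth v g z - g z - v / 2 * g2 z\<bar> \<le> D * exp (l * z) * (12 * exp 2 * sqrt v powr r)"
proof -
  let ?N = std_normal_distribution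
  note [measurable] = tilted_taylorD(1-3)[OF T]
  have D: "0 \<le> D" by (rule tilted_taylor_nonneg[OF T])
  obtain B where B: "\<And>z. \<bar>g z\<bar> \<le> B" "\<And>z. \<bar>g1 z\<bar> \<le> B" "\<And>z. \<bar>g2 z\<bar> \<le> B"
    using T unfolding tilted_taylor_def by blast
  have int: "integrable ?N (\<lambda>x. g (z + sqrt v * x))"
    by (rule std_normal_integrable_bounded, measurable, rule B)
  let ?rem = "\<lambda>x. g (z + sqrt v * x) - g z - sqrt v * x * g1 z - (sqrt v * x)\<^sup>2 / 2 * g2 z"
  have intrem: "integrable ?N ?rem"
    using int std_normal_moments by (simp add: power_mult_distrib)
  have "(\<integral>x. ?rem x \<partial>?N) = smooth v g z - g z - v / 2 * g2 z"
    using int std_normal_moments v std_normal.prob_space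
    by (simp add: smooth_def power_mult_distrib Bochner_Integration.integral_diff)
  then have "\<bar>smooth v g z - g z - v / 2 * g2 z\<bar> \<le> (\<integral>x. \<bar>?rem x\<bar> \<partial>?N)"
    using integral_abs_bound[of ?N ?rem] by simp
  also have "\<dots> \<le> (\<integral>x. D * exp (l * z) * (6 * sqrt v powr r * (exp (2 * x) + exp (- 2 * x))) \<partial>?N)"
  proof (intro integral_mono integrable_abs intrem)
    show "integrable ?N (\<lambda>x. D * exp (l * z) * (6 * sqrt v powr r * (exp (2 * x) + exp (- 2 * x))))"
      using std_normal_exp(1)[of 2] std_normal_exp(1)[of "- 2"] by simp
    fix x
    have "exp (l * max (sqrt v * x) 0) * \<bar>sqrt v * x\<bar> powr r \<le> exp \<bar>x\<bar> * (sqrt v powr r * (6 * exp \<bar>x\<bar>))"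
    proof (intro mult_mono)
      have "l * max (sqrt v * x) 0 \<le> (l * sqrt v) * \<bar>x\<bar>"
        using l v by (auto simp: max_def mult_le_0_iff intro!: mult_nonneg_nonneg mult_left_mono)
      also have "\<dots> \<le> 1 * \<bar>x\<bar>" using l by (intro mult_right_mono) auto
      finally show "exp (l * max (sqrt v * x) 0) \<le> exp \<bar>x\<bar>" by simp
      have "\<bar>sqrt v * x\<bar> powr r = sqrt v powr r * \<bar>x\<bar> powr r"
        using v by (simp add: abs_mult powr_mult)
      also have "\<dots> \<le> sqrt v powr r * (6 * exp \<bar>x\<bar>)"
        using r by (intro mult_left_mono powr_le_exp) auto
      finally show "\<bar>sqrt v * x\<bar> powr r \<le> sqrt v powr r * (6 * exp \<bar>x\<bar>)" .
    qed auto
    also have "\<dots> = 6 * sqrt v powr r * exp (2 * \<bar>x\<bar>)"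
      by (simp add: exp_double power2_eq_square)
    also have "\<dots> \<le> 6 * sqrt v powr r * (exp (2 * x) + exp (- 2 * x))"
      by (intro mult_left_mono) (auto simp: abs_if)
    finally show "\<bar>?rem x\<bar> \<le> D * exp (l * z) * (6 * sqrt v powr r * (exp (2 * x) + exp (- 2 * x)))"
      using D by (intro order_trans[OF tilted_taylorD(6)[OF T]] mult_left_mono) auto
  qed
  also have "\<dots> = D * exp (l * z) * (12 * exp 2 * sqrt v powr r)"
    using std_normal_exp[of 2] std_normal_exp[of "- 2"] by simp
  finally show ?thesis .
qed

lemma std_normal_atomless: "measure std_normal_distribution {x} = 0"
proof -
  have "emeasure std_normal_distribution {x} = 0"
    by (subst emeasure_density) (auto simp: nn_integral_indicator_singleton')
  then show ?thesis by (simp add: measure_def)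
qed

lemma std_normal_tail_eq: "measure std_normal_distribution {x..} = 1 - std_normal_cdf x"
proof -
  have "measure std_normal_distribution {x..} =
      measure std_normal_distribution {x} + measure std_normal_distribution {x<..}"
    by (subst std_normal.finite_measure_Union[symmetric]) (auto intro!: arg_cong[where f="measure _"])
  also have "{x<..} = space std_normal_distribution - {..x}" by auto
  also have "measure std_normal_distribution \<dots> = 1 - std_normal_cdf x"
    by (subst std_normal.prob_compl) (auto simp: cdf_def)
  finally show ?thesis by (simp add: std_normal_atomless)
qed

text \<open>The rescaled step lies between the indicators of the half-lines starting at x + 3 * w
  and at x.\<close>

lemma smooth_step_bounds:
  assumes v: "0 < v" and w: "0 < w"
  shows "smooth v (\<lambda>s. step ((s - x) / w)) 0 \<le> 1 - std_normal_cdf (x / sqrt v)"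
    and "1 - std_normal_cdf ((x + 3 * w) / sqrt v) \<le> smooth v (\<lambda>s. step ((s - x) / w)) 0"
proof -
  let ?N = std_normal_distribution
  have int: "integrable ?N (\<lambda>r. step ((0 + sqrt v * r - x) / w))"
    using step_bounds by (intro std_normal.integrable_const_bound[of _ 1]) auto
  have ind: "(\<integral>r. indicator {c..} r \<partial>?N) = 1 - std_normal_cdf c" for c :: real
    by (simp add: std_normal_tail_eq)
  have "smooth v (\<lambda>s. step ((s - x) / w)) 0 \<le> (\<integral>r. indicator {x / sqrt v..} r \<partial>?N)"
    unfolding smooth_def
  proof (intro integral_mono int)
    fix r
    show "step ((0 + sqrt v * r - x) / w) \<le> indicator {x / sqrt v..} r"
    proof (cases "x / sqrt v \<le> r")
      case False
      then have "sqrt v * r \<le> x" using v by (simp add: field_simps)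
      then show ?thesis using w False by (subst step_eq_0(1)) (auto simp: divide_le_0_iff)
    qed (simp add: step_bounds)
  qed (rule std_normal.integrable_const_bound[of _ 1], auto)
  then show "smooth v (\<lambda>s. step ((s - x) / w)) 0 \<le> 1 - std_normal_cdf (x / sqrt v)" using ind by simp
  have "(\<integral>r. indicator {(x + 3 * w) / sqrt v..} r \<partial>?N) \<le> smooth v (\<lambda>s. step ((s - x) / w)) 0"
    unfolding smooth_def
  proof (intro integral_mono int)
    fix r
    show "indicator {(x + 3 * w) / sqrt v..} r \<le> step ((0 + sqrt v * r - x) / w)"
    proof (cases "(x + 3 * w) / sqrt v \<le> r")
      case True
      then have "x + 3 * w \<le> sqrt v * r" using v by (simp add: field_simps)
      then show ?thesis using w by (subst step_eq_1(1)) (auto simp: field_simps)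
    qed (simp add: step_bounds)
  qed (rule std_normal.integrable_const_bound[of _ 1], auto)
  then show "1 - std_normal_cdf ((x + 3 * w) / sqrt v) \<le> smooth v (\<lambda>s. step ((s - x) / w)) 0"
    using ind by simp
qed

section \<open>Exponential inequalities and truncation from above\<close>

lemma exp_le_quadratic:
  fixes v c :: real
  assumes "v \<le> c" "0 \<le> c"
  shows "exp v \<le> 1 + v + v\<^sup>2 / 2 * exp c"
proof (cases "v \<le> 0")
  case True
  define u where "u = - v"
  have u: "0 \<le> u" "v = - u" using True by (auto simp: u_def)
  have pos: "0 < 1 - u + u\<^sup>2 / 2"
  proof -
    have "1 - u + u\<^sup>2 / 2 = ((u - 1)\<^sup>2 + 1) / 2" by (simp add: power2_eq_square field_simps)
    moreover have "0 < ((u - 1)\<^sup>2 + 1) / 2" by (simp add: add_nonneg_pos)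
    ultimately show ?thesis by (simp only:)
  qed
  \<comment> \<open>For a negative argument the quadratic bound on exp(-u) is the reciprocal of the
    lower Taylor bound for exp u: the two quadratics multiply to 1 + u^4/4.\<close>
  have "1 \<le> (1 + u + u\<^sup>2 / 2) * (1 - u + u\<^sup>2 / 2)"
  proof -
    have "(1 + u + u\<^sup>2 / 2) * (1 - u + u\<^sup>2 / 2) = 1 + (u\<^sup>2)\<^sup>2 / 4"
      by (simp add: power2_eq_square field_simps)
    then show ?thesis by simp
  qed
  also have "\<dots> \<le> exp u * (1 - u + u\<^sup>2 / 2)"
    using pos exp_lower_Taylor_quadratic[OF u(1)] by (intro mult_right_mono) auto
  finally have "exp (- u) \<le> 1 - u + u\<^sup>2 / 2" by (simp add: exp_minus field_simps)
  also have "u\<^sup>2 / 2 \<le> u\<^sup>2 / 2 * exp c"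
    using assms mult_left_mono[of 1 "exp c" "u\<^sup>2 / 2"] by simp
  finally show ?thesis by (simp add: u)
next
  case False
  obtain t where t: "\<bar>t\<bar> \<le> \<bar>v\<bar>" "exp v = (\<Sum>m<2. v ^ m / fact m) + exp t / fact 2 * v ^ 2"
    using Maclaurin_exp_le[of v 2] by blast
  have "exp t * v\<^sup>2 \<le> exp c * v\<^sup>2" using t False assms by (intro mult_right_mono) auto
  with t(2) show ?thesis by (simp add: numeral_2_eq_2 mult.commute)
qed

text \<open>The quadratic coefficient stays exactly 1/2 and the excess goes into \<bar>v\<bar> powr
  p; this is what makes the total exponent l^2/2 + O(1) instead of a larger multiple of l^2. The
  cubic Lagrange coefficient is at most e/6 \<le> 1.\<close>

lemma exp_le_quadratic_powr:
  fixes v p :: real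
  assumes "v \<le> 1" "2 \<le> p" "p \<le> 3"
  shows "exp v \<le> 1 + v + v\<^sup>2 / 2 + \<bar>v\<bar> powr p"
proof (cases "v \<le> 0")
  case True
  then show ?thesis using exp_le_quadratic[of v 0] by (simp add: add_increasing2)
next
  case False
  obtain t where t: "\<bar>t\<bar> \<le> \<bar>v\<bar>" "exp v = (\<Sum>m<3. v ^ m / fact m) + exp t / fact 3 * v ^ 3"
    using Maclaurin_exp_le[of v 3] by blast
  have "exp t / fact 3 \<le> exp 1 / 6" using t False assms by (simp add: fact_numeral)
  also have "\<dots> \<le> 1" using exp_le by simp
  finally have "exp t / fact 3 * v ^ 3 \<le> 1 * v ^ 3" using False by (intro mult_right_mono) auto
  also have "v ^ 3 = v powr 3" using False by (simp add: powr_realpow)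
  also have "v powr 3 \<le> v powr p" using False assms by (intro powr_mono') auto
  finally show ?thesis using t(2) False by (simp add: numeral_3_eq_3 numeral_2_eq_2)
qed

text \<open>A value above y becomes 0 and not y. A summand that jumps then leaves the truncated sum
  altogether, and for y \<ge> 0 truncation only lowers values, so truncated means of centered
  variables are at most 0.\<close>

definition trunc :: "real \<Rightarrow> real \<Rightarrow> real" where
  "trunc y r = (if r \<le> y then r else 0)"

lemma trunc_borel [measurable]: "trunc y \<in> borel_measurable borel"
  unfolding trunc_def[abs_def] by measurable

lemma trunc_le: "0 \<le> y \<Longrightarrow> trunc y r \<le> y"
  by (simp add: trunc_def)

lemma abs_trunc_le: "\<bar>trunc y r\<bar> \<le> \<bar>r\<bar>"
  by (simp add: trunc_def)

lemma (in prob_space) prob_le_exp: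
  fixes X :: "'a \<Rightarrow> real"
  assumes "X \<in> borel_measurable M" "integrable M (\<lambda>\<omega>. exp (l * X \<omega>))" "0 \<le> l"
  shows "prob {\<omega> \<in> space M. z \<le> X \<omega>} \<le> exp (- l * z) * expectation (\<lambda>\<omega>. exp (l * X \<omega>))"
proof -
  note [measurable] = assms(1)
  have "prob {\<omega> \<in> space M. z \<le> X \<omega>} = expectation (indicator {\<omega> \<in> space M. z \<le> X \<omega>})"
    by simp
  also have "\<dots> \<le> expectation (\<lambda>\<omega>. exp (- l * z) * exp (l * X \<omega>))"
  proof (intro integral_mono integrable_mult_right assms)
    fix \<omega> assume "\<omega> \<in> space M"
    show "indicator {\<omega> \<in> space M. z \<le> X \<omega>} \<omega> \<le> exp (- l * z) * exp (l * X \<omega>)"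
      using assms(3) by (auto simp: indicator_def mult_left_mono simp flip: exp_add)
  qed (simp add: emeasure_eq_measure)
  finally show ?thesis using assms by simp
qed

locale indep_centered = prob_space M for M :: "'a measure" +
  fixes W :: "'i \<Rightarrow> 'a \<Rightarrow> real"
  assumes indep: "indep_vars (\<lambda>_. borel) W UNIV"
    and sq_int: "\<And>i. integrable M (\<lambda>\<omega>. (W i \<omega>)\<^sup>2)"
    and mean: "\<And>i. expectation (W i) = 0"
begin

definition var :: "'i \<Rightarrow> real" where "var i = expectation (\<lambda>\<omega>. (W i \<omega>)\<^sup>2)"

definition absm :: "real \<Rightarrow> 'i \<Rightarrow> real" where "absm p i = expectation (\<lambda>\<omega>. \<bar>W i \<omega>\<bar> powr p)"

definition tsum :: "real \<Rightarrow> 'i set \<Rightarrow> 'a \<Rightarrow> real" where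
  "tsum y F \<omega> = (\<Sum>i\<in>F. trunc y (W i \<omega>))"

lemma W_borel [measurable]: "W i \<in> borel_measurable M"
  using indep unfolding indep_vars_def2 by simp

lemma tsum_borel [measurable]: "tsum y F \<in> borel_measurable M"
  unfolding tsum_def[abs_def] by measurable

lemma W_int: "integrable M (W i)"
  by (rule square_integrable_imp_integrable[OF _ sq_int]) simp

lemma var_nonneg: "0 \<le> var i"
  unfolding var_def by (rule Bochner_Integration.integral_nonneg) simp

lemma absm_nonneg: "0 \<le> absm p i"
  unfolding absm_def by (rule Bochner_Integration.integral_nonneg) simp

lemma trunc_int: "integrable M (\<lambda>\<omega>. trunc y (W i \<omega>))" "integrable M (\<lambda>\<omega>. (trunc y (W i \<omega>))\<^sup>2)"
proof -
  show "integrable M (\<lambda>\<omega>. trunc y (W i \<omega>))"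
    by (rule Bochner_Integration.integrable_bound[OF W_int[of i]]) (auto simp: abs_trunc_le)
  show "integrable M (\<lambda>\<omega>. (trunc y (W i \<omega>))\<^sup>2)"
    by (rule Bochner_Integration.integrable_bound[OF sq_int[of i]])
       (auto simp: abs_trunc_le abs_le_square_iff[symmetric])
qed

lemma expectation_trunc_le:
  assumes "0 \<le> y"
  shows "expectation (\<lambda>\<omega>. trunc y (W i \<omega>)) \<le> 0"
proof -
  have "expectation (\<lambda>\<omega>. trunc y (W i \<omega>)) \<le> expectation (W i)"
    using assms by (intro integral_mono trunc_int W_int) (auto simp: trunc_def)
  then show ?thesis by (simp add: mean)
qed

lemma expectation_trunc_sq_le: "expectation (\<lambda>\<omega>. (trunc y (W i \<omega>))\<^sup>2) \<le> var i"
  unfolding var_def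
  by (intro integral_mono trunc_int sq_int) (auto simp: abs_trunc_le abs_le_square_iff[symmetric])

lemma exp_trunc_int: "0 \<le> y \<Longrightarrow> 0 \<le> l \<Longrightarrow> integrable M (\<lambda>\<omega>. exp (l * trunc y (W i \<omega>)))"
  by (rule integrable_const_bound[of _ "exp (l * y)"]) (auto intro!: mult_left_mono trunc_le)

lemma indep_trunc: "indep_vars (\<lambda>_. borel) (\<lambda>i \<omega>. trunc y (W i \<omega>)) F"
  by (rule indep_vars_subset[OF indep_vars_compose2[OF indep, of "\<lambda>_. trunc y" "\<lambda>_. borel"]]) auto

lemma tsum_insert: "finite F \<Longrightarrow> k \<notin> F \<Longrightarrow> tsum y (insert k F) \<omega> = trunc y (W k \<omega>) + tsum y F \<omega>"
  by (simp add: tsum_def)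

text \<open>The variable with index k stays untruncated while the others are truncated, since it has
  to serve both as the next summand to be replaced and as the jump.\<close>

lemma indep_tsum:
  assumes "finite F" "k \<notin> F"
  shows "indep_var borel (W k) borel (tsum y F)"
proof -
  have "indep_vars (\<lambda>_. borel) (\<lambda>i \<omega>. (if i = k then (\<lambda>x. x) else trunc y) (W i \<omega>)) (insert k F)"
    by (rule indep_vars_subset[OF indep_vars_compose2[OF indep, of "\<lambda>i. if i = k then (\<lambda>x. x) else trunc y" "\<lambda>_. borel"]]) auto
  from indep_vars_sum[OF assms this]
  have "indep_var borel (W k) borel (\<lambda>\<omega>. \<Sum>i\<in>F. (if i = k then (\<lambda>x. x) else trunc y) (W i \<omega>))" by simp
  also have "(\<lambda>\<omega>. \<Sum>i\<in>F. (if i = k then (\<lambda>x. x) else trunc y) (W i \<omega>)) = tsum y F"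
    using assms by (auto simp: tsum_def fun_eq_iff intro!: sum.cong)
  finally show ?thesis .
qed

text \<open>The negative truncated mean is dropped and the second moment is at most the full
  variance. Only the variance enters, so this bound serves the jump regime, where higher moments of
  the left tail may be infinite.\<close>

lemma mgf_trunc_le:
  assumes "0 \<le> y" "0 \<le> l"
  shows "expectation (\<lambda>\<omega>. exp (l * trunc y (W i \<omega>))) \<le> exp (l\<^sup>2 * exp (l * y) / 2 * var i)"
proof -
  have "expectation (\<lambda>\<omega>. exp (l * trunc y (W i \<omega>))) \<le>
      expectation (\<lambda>\<omega>. 1 + l * trunc y (W i \<omega>) + l\<^sup>2 * exp (l * y) / 2 * (trunc y (W i \<omega>))\<^sup>2)"
  proof (intro integral_mono exp_trunc_int assms)
    show "integrable M (\<lambda>\<omega>. 1 + l * trunc y (W i \<omega>) + l\<^sup>2 * exp (l * y) / 2 * (trunc y (W i \<omega>))\<^sup>2)"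
      using trunc_int[of y i] by simp
    fix \<omega>
    have "exp (l * trunc y (W i \<omega>)) \<le> 1 + l * trunc y (W i \<omega>) + (l * trunc y (W i \<omega>))\<^sup>2 / 2 * exp (l * y)"
      using assms by (intro exp_le_quadratic mult_left_mono trunc_le) auto
    then show "exp (l * trunc y (W i \<omega>)) \<le> 1 + l * trunc y (W i \<omega>) + l\<^sup>2 * exp (l * y) / 2 * (trunc y (W i \<omega>))\<^sup>2"
      by (simp add: power_mult_distrib mult_ac)
  qed
  also have "\<dots> = 1 + l * expectation (\<lambda>\<omega>. trunc y (W i \<omega>)) + l\<^sup>2 * exp (l * y) / 2 * expectation (\<lambda>\<omega>. (trunc y (W i \<omega>))\<^sup>2)"
    using trunc_int[of y i] prob_space by simp
  also have "\<dots> \<le> 1 + l * 0 + l\<^sup>2 * exp (l * y) / 2 * var i"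
    using assms expectation_trunc_le expectation_trunc_sq_le by (intro add_mono mult_left_mono) auto
  also have "\<dots> \<le> exp (l\<^sup>2 * exp (l * y) / 2 * var i)" by simp
  finally show ?thesis .
qed

lemma expectation_exp_tsum:
  assumes "finite F" "0 \<le> y" "0 \<le> l"
  shows "expectation (\<lambda>\<omega>. exp (l * tsum y F \<omega>)) = (\<Prod>i\<in>F. expectation (\<lambda>\<omega>. exp (l * trunc y (W i \<omega>))))"
    and "integrable M (\<lambda>\<omega>. exp (l * tsum y F \<omega>))"
proof -
  have eq: "exp (l * tsum y F \<omega>) = (\<Prod>i\<in>F. exp (l * trunc y (W i \<omega>)))" for \<omega>
    using assms by (simp add: tsum_def sum_distrib_left exp_sum)
  have ind: "indep_vars (\<lambda>_. borel) (\<lambda>i \<omega>. exp (l * trunc y (W i \<omega>))) F"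
    by (rule indep_vars_compose2[OF indep_trunc[of y F], of "\<lambda>_ x. exp (l * x)" "\<lambda>_. borel"]) auto
  show "expectation (\<lambda>\<omega>. exp (l * tsum y F \<omega>)) = (\<Prod>i\<in>F. expectation (\<lambda>\<omega>. exp (l * trunc y (W i \<omega>))))"
    unfolding eq using assms by (intro indep_vars_lebesgue_integral ind exp_trunc_int) auto
  show "integrable M (\<lambda>\<omega>. exp (l * tsum y F \<omega>))"
    unfolding eq using assms by (intro indep_vars_integrable ind exp_trunc_int) auto
qed

lemma chernoff:
  assumes "finite F" "0 \<le> y" "0 \<le> l"
  shows "prob {\<omega> \<in> space M. z \<le> tsum y F \<omega>} \<le> exp (l\<^sup>2 * exp (l * y) / 2 * sum var F - l * z)"
proof -
  have "prob {\<omega> \<in> space M. z \<le> tsum y F \<omega>} \<le> exp (- l * z) * (\<Prod>i\<in>F. expectation (\<lambda>\<omega>. exp (l * trunc y (W i \<omega>))))"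
    using prob_le_exp[OF tsum_borel expectation_exp_tsum(2)] assms by (simp add: expectation_exp_tsum)
  also have "\<dots> \<le> exp (- l * z) * (\<Prod>i\<in>F. exp (l\<^sup>2 * exp (l * y) / 2 * var i))"
    using assms by (intro mult_left_mono prod_mono conjI mgf_trunc_le integral_nonneg) auto
  also have "\<dots> = exp (l\<^sup>2 * exp (l * y) / 2 * sum var F - l * z)"
    using assms by (simp add: exp_sum[symmetric] sum_distrib_left exp_diff exp_minus divide_simps)
  finally show ?thesis .
qed

section \<open>Sharp exponential moments and replacement of summands\<close>

lemma absm_trunc:
  assumes p: "2 \<le> p" and int: "integrable M (\<lambda>\<omega>. \<bar>W i \<omega>\<bar> powr p)"
  shows "integrable M (\<lambda>\<omega>. \<bar>trunc y (W i \<omega>)\<bar> powr p)"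
    "expectation (\<lambda>\<omega>. \<bar>trunc y (W i \<omega>)\<bar> powr p) \<le> absm p i"
proof -
  have le: "\<bar>trunc y r\<bar> powr p \<le> \<bar>r\<bar> powr p" for r
    using p by (intro powr_mono2 abs_trunc_le) auto
  show "integrable M (\<lambda>\<omega>. \<bar>trunc y (W i \<omega>)\<bar> powr p)"
    by (rule Bochner_Integration.integrable_bound[OF int]) (auto simp: le)
  then show "expectation (\<lambda>\<omega>. \<bar>trunc y (W i \<omega>)\<bar> powr p) \<le> absm p i"
    unfolding absm_def using int le by (intro integral_mono)
qed

text \<open>Beyond the level one has l * r \<ge> 1, so a low power of r may be multiplied by a power
  of l * r until it becomes the p-th.\<close>

lemma trunc_moment_gap:
  assumes p: "2 \<le> p" and l: "1 \<le> l" and int: "integrable M (\<lambda>\<omega>. \<bar>W i \<omega>\<bar> powr p)"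
  shows "\<bar>expectation (\<lambda>\<omega>. trunc (1 / l) (W i \<omega>))\<bar> \<le> l powr (p - 1) * absm p i"
    and "\<bar>expectation (\<lambda>\<omega>. (trunc (1 / l) (W i \<omega>))\<^sup>2) - var i\<bar> \<le> l powr (p - 2) * absm p i"
proof -
  have tail: "\<bar>r\<bar> ^ k \<le> l powr (p - k) * \<bar>r\<bar> powr p" if "\<not> r \<le> 1 / l" "k \<le> 2" for r and k :: nat
  proof -
    have r: "0 < r" "1 \<le> l * r" using that l by (auto simp: field_simps order_less_trans[of 0 "1 / l" r])
    have "r powr k * 1 \<le> r powr k * (l * r) powr (p - k)"
      using r that p by (intro mult_left_mono ge_one_powr_ge_zero) auto
    also have "\<dots> = l powr (p - k) * r powr p"
      using r l by (simp add: powr_mult mult_ac flip: powr_add)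
    finally show ?thesis using r by (simp add: powr_realpow)
  qed
  have "\<bar>expectation (\<lambda>\<omega>. trunc (1 / l) (W i \<omega>))\<bar> = \<bar>expectation (\<lambda>\<omega>. trunc (1 / l) (W i \<omega>) - W i \<omega>)\<bar>"
    using trunc_int(1) W_int by (simp add: mean)
  also have "\<dots> \<le> expectation (\<lambda>\<omega>. \<bar>trunc (1 / l) (W i \<omega>) - W i \<omega>\<bar>)" by (rule integral_abs_bound)
  also have "\<dots> \<le> expectation (\<lambda>\<omega>. l powr (p - 1) * \<bar>W i \<omega>\<bar> powr p)"
    using trunc_int(1) W_int int tail[of _ 1]
    by (intro integral_mono integrable_abs Bochner_Integration.integrable_diff integrable_mult_right)
       (auto simp: trunc_def)
  finally show "\<bar>expectation (\<lambda>\<omega>. trunc (1 / l) (W i \<omega>))\<bar> \<le> l powr (p - 1) * absm p i"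
    by (simp add: absm_def)
  have "\<bar>expectation (\<lambda>\<omega>. (trunc (1 / l) (W i \<omega>))\<^sup>2) - var i\<bar> =
      \<bar>expectation (\<lambda>\<omega>. (trunc (1 / l) (W i \<omega>))\<^sup>2 - (W i \<omega>)\<^sup>2)\<bar>"
    using trunc_int(2) sq_int by (simp add: var_def)
  also have "\<dots> \<le> expectation (\<lambda>\<omega>. \<bar>(trunc (1 / l) (W i \<omega>))\<^sup>2 - (W i \<omega>)\<^sup>2\<bar>)" by (rule integral_abs_bound)
  also have "\<dots> \<le> expectation (\<lambda>\<omega>. l powr (p - 2) * \<bar>W i \<omega>\<bar> powr p)"
    using trunc_int(2) sq_int int tail[of _ 2]
    by (intro integral_mono integrable_abs Bochner_Integration.integrable_diff integrable_mult_right)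
       (auto simp: trunc_def)
  finally show "\<bar>expectation (\<lambda>\<omega>. (trunc (1 / l) (W i \<omega>))\<^sup>2) - var i\<bar> \<le> l powr (p - 2) * absm p i"
    by (simp add: absm_def)
qed

text \<open>At truncation level 1 / l the exponent never exceeds 1, so
  \<open>exp_le_quadratic_powr\<close> applies pointwise. Summed over the index the bound is
  exp(l^2/2 + O(1)) as soon as the p-th moments add up to at most l powr (- p) and the variances to
  at most 1.\<close>

lemma mgf_trunc_le_sharp:
  assumes p: "2 \<le> p" "p \<le> 3" and l: "1 \<le> l" and int: "integrable M (\<lambda>\<omega>. \<bar>W i \<omega>\<bar> powr p)"
  shows "expectation (\<lambda>\<omega>. exp (l * trunc (1 / l) (W i \<omega>))) \<le> exp (l\<^sup>2 * var i / 2 + l powr p * absm p i)"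
proof -
  let ?Y = "\<lambda>\<omega>. trunc (1 / l) (W i \<omega>)"
  have "expectation (\<lambda>\<omega>. exp (l * ?Y \<omega>)) \<le>
      expectation (\<lambda>\<omega>. 1 + l * ?Y \<omega> + l\<^sup>2 / 2 * (?Y \<omega>)\<^sup>2 + l powr p * \<bar>?Y \<omega>\<bar> powr p)"
  proof (intro integral_mono exp_trunc_int)
    show "integrable M (\<lambda>\<omega>. 1 + l * ?Y \<omega> + l\<^sup>2 / 2 * (?Y \<omega>)\<^sup>2 + l powr p * \<bar>?Y \<omega>\<bar> powr p)"
      using trunc_int[of "1 / l" i] absm_trunc[OF p(1) int, of "1 / l"] by simp
    fix \<omega>
    have "?Y \<omega> \<le> 1 / l" using l by (intro trunc_le) auto
    then have "l * ?Y \<omega> \<le> 1" using l by (simp add: field_simps)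
    then have "exp (l * ?Y \<omega>) \<le> 1 + l * ?Y \<omega> + (l * ?Y \<omega>)\<^sup>2 / 2 + \<bar>l * ?Y \<omega>\<bar> powr p"
      by (rule exp_le_quadratic_powr[OF _ p])
    also have "\<bar>l * ?Y \<omega>\<bar> powr p = l powr p * \<bar>?Y \<omega>\<bar> powr p"
      using l by (simp add: abs_mult powr_mult)
    finally show "exp (l * ?Y \<omega>) \<le> 1 + l * ?Y \<omega> + l\<^sup>2 / 2 * (?Y \<omega>)\<^sup>2 + l powr p * \<bar>?Y \<omega>\<bar> powr p"
      by (simp add: power_mult_distrib)
  qed (use l in auto)
  also have "\<dots> = 1 + l * expectation ?Y + l\<^sup>2 / 2 * expectation (\<lambda>\<omega>. (?Y \<omega>)\<^sup>2) +
      l powr p * expectation (\<lambda>\<omega>. \<bar>?Y \<omega>\<bar> powr p)"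
    using trunc_int[of "1 / l" i] absm_trunc[OF p(1) int, of "1 / l"] prob_space by simp
  also have "\<dots> \<le> 1 + l * 0 + l\<^sup>2 / 2 * var i + l powr p * absm p i"
    using l expectation_trunc_le expectation_trunc_sq_le absm_trunc(2)[OF p(1) int]
    by (intro add_mono mult_left_mono) auto
  also have "\<dots> = 1 + (l\<^sup>2 * var i / 2 + l powr p * absm p i)" by simp
  also have "\<dots> \<le> exp (l\<^sup>2 * var i / 2 + l powr p * absm p i)" by (rule exp_ge_add_one_self)
  finally show ?thesis .
qed

text \<open>The truncated summand and a normal variable of the untruncated variance are both
  expanded to second order around z. Four errors arise: the two remainders, the mean shift and the
  variance lost by truncation. As p \<le> 3, the powers l powr (p - 1) and l powr (p - 2) are at
  most l^2.\<close>

lemma lindeberg_one: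
  assumes T: "tilted_taylor p l D g g1 g2" and p: "2 \<le> p" "p \<le> 3" and l: "1 \<le> l"
    and int: "integrable M (\<lambda>\<omega>. \<bar>W i \<omega>\<bar> powr p)" and lv: "l * sqrt (var i) \<le> 1"
  shows "\<bar>expectation (\<lambda>\<omega>. g (z + trunc (1 / l) (W i \<omega>))) - smooth (var i) g z\<bar>
    \<le> D * exp (l * z) * (12 * exp 2 * l\<^sup>2 * (absm p i + sqrt (var i) powr p))"
proof -
  let ?Y = "\<lambda>\<omega>. trunc (1 / l) (W i \<omega>)" and ?m = "absm p i"
  note [measurable] = tilted_taylorD(1-3)[OF T]
  have D: "0 \<le> D" by (rule tilted_taylor_nonneg[OF T])
  obtain B where B: "\<And>z. \<bar>g z\<bar> \<le> B" using T unfolding tilted_taylor_def by blast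
  have intg: "integrable M (\<lambda>\<omega>. g (z + ?Y \<omega>))"
    by (rule integrable_const_bound[of _ B]) (auto simp: B)
  let ?rem = "\<lambda>\<omega>. g (z + ?Y \<omega>) - g z - ?Y \<omega> * g1 z - (?Y \<omega>)\<^sup>2 / 2 * g2 z"
  have intrem: "integrable M ?rem" using intg trunc_int[of "1 / l" i] by simp
  have "\<bar>expectation ?rem\<bar> \<le> expectation (\<lambda>\<omega>. \<bar>?rem \<omega>\<bar>)" by (rule integral_abs_bound)
  also have "\<dots> \<le> expectation (\<lambda>\<omega>. D * exp (l * z) * (exp 1 * \<bar>?Y \<omega>\<bar> powr p))"
  proof (intro integral_mono integrable_abs intrem)
    show "integrable M (\<lambda>\<omega>. D * exp (l * z) * (exp 1 * \<bar>?Y \<omega>\<bar> powr p))"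
      using absm_trunc[OF p(1) int] by simp
    fix \<omega>
    have "?Y \<omega> \<le> 1 / l" using l by (intro trunc_le) auto
    then have "l * max (?Y \<omega>) 0 \<le> 1" using l by (simp add: field_simps max_def)
    then show "\<bar>?rem \<omega>\<bar> \<le> D * exp (l * z) * (exp 1 * \<bar>?Y \<omega>\<bar> powr p)"
      using D by (intro order_trans[OF tilted_taylorD(6)[OF T]] mult_left_mono mult_right_mono) auto
  qed
  also have "\<dots> \<le> D * exp (l * z) * (exp 1 * ?m)"
    using absm_trunc[OF p(1) int] D by (simp add: mult_left_mono)
  finally have r1: "\<bar>expectation ?rem\<bar> \<le> D * exp (l * z) * (exp 1 * ?m)" .
  have eq: "expectation (\<lambda>\<omega>. g (z + ?Y \<omega>)) - smooth (var i) g z = expectation ?rem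
      + expectation ?Y * g1 z + (expectation (\<lambda>\<omega>. (?Y \<omega>)\<^sup>2) - var i) / 2 * g2 z
      - (smooth (var i) g z - g z - var i / 2 * g2 z)"
    using intg trunc_int[of "1 / l" i] prob_space by (simp add: field_simps)
  have r2: "\<bar>expectation ?Y * g1 z\<bar> \<le> D * exp (l * z) * (l\<^sup>2 * ?m)"
  proof -
    have "\<bar>expectation ?Y * g1 z\<bar> \<le> l powr (p - 1) * ?m * (D * exp (l * z))"
      unfolding abs_mult using trunc_moment_gap(1)[OF p(1) l int] tilted_taylorD(4)[OF T] absm_nonneg
      by (intro mult_mono) auto
    also have "\<dots> \<le> l powr 2 * ?m * (D * exp (l * z))"
      using l p D absm_nonneg by (intro mult_right_mono powr_mono) auto
    finally show ?thesis using l by (simp add: powr_realpow mult_ac)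
  qed
  have r3: "\<bar>(expectation (\<lambda>\<omega>. (?Y \<omega>)\<^sup>2) - var i) / 2 * g2 z\<bar> \<le> D * exp (l * z) * (l\<^sup>2 * ?m)"
  proof -
    have "\<bar>(expectation (\<lambda>\<omega>. (?Y \<omega>)\<^sup>2) - var i) / 2 * g2 z\<bar> \<le>
        \<bar>expectation (\<lambda>\<omega>. (?Y \<omega>)\<^sup>2) - var i\<bar> * \<bar>g2 z\<bar>" by (simp add: abs_mult)
    also have "\<dots> \<le> l powr (p - 2) * ?m * (D * exp (l * z))"
      using trunc_moment_gap(2)[OF p(1) l int] tilted_taylorD(5)[OF T] absm_nonneg
      by (intro mult_mono) auto
    also have "\<dots> \<le> l powr 2 * ?m * (D * exp (l * z))"
      using l p D absm_nonneg by (intro mult_right_mono powr_mono) auto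
    finally show ?thesis using l by (simp add: powr_realpow mult_ac)
  qed
  have r4: "\<bar>smooth (var i) g z - g z - var i / 2 * g2 z\<bar> \<le> D * exp (l * z) * (12 * exp 2 * sqrt (var i) powr p)"
    using l p lv var_nonneg by (intro smooth_taylor[OF T]) auto
  have "\<bar>expectation (\<lambda>\<omega>. g (z + ?Y \<omega>)) - smooth (var i) g z\<bar> \<le>
      D * exp (l * z) * (exp 1 * ?m) + D * exp (l * z) * (l\<^sup>2 * ?m) + D * exp (l * z) * (l\<^sup>2 * ?m)
      + D * exp (l * z) * (12 * exp 2 * sqrt (var i) powr p)"
    unfolding eq using r1 r2 r3 r4 by linarith
  also have "\<dots> = D * exp (l * z) * ((exp 1 + 2 * l\<^sup>2) * ?m + 12 * exp 2 * sqrt (var i) powr p)"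
    by (simp add: algebra_simps)
  also have "\<dots> \<le> D * exp (l * z) * (12 * exp 2 * l\<^sup>2 * ?m + 12 * exp 2 * l\<^sup>2 * sqrt (var i) powr p)"
  proof (intro mult_left_mono add_mono mult_right_mono)
    have l2: "1 \<le> l\<^sup>2" using l by simp
    have e: "(3::real) \<le> exp 2" using exp_ge_add_one_self[of "2::real"] by simp
    have "exp 1 + 2 * l\<^sup>2 \<le> 3 * l\<^sup>2 + 2 * l\<^sup>2" using exp_le l2 by linarith
    also have "\<dots> \<le> 12 * exp 2 * l\<^sup>2" using e l2
      by (subst distrib_right[symmetric], intro mult_right_mono) auto
    finally show "exp 1 + 2 * l\<^sup>2 \<le> 12 * exp 2 * l\<^sup>2" .
    show "12 * exp 2 \<le> 12 * exp 2 * l\<^sup>2" using l2 by simp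
  qed (use D absm_nonneg in auto)
  finally show ?thesis by (simp add: algebra_simps)
qed

end

text \<open>Conditioning on Y in the form of an iterated expectation over the same space, so that
  one summand can be replaced with the rest of the sum held fixed.\<close>

lemma (in prob_space) indep_var_expectation_fubini:
  fixes h :: "real \<times> real \<Rightarrow> real"
  assumes ind: "indep_var borel X borel Y"
    and [measurable]: "h \<in> borel_measurable (borel \<Otimes>\<^sub>M borel)" and B: "\<And>x. \<bar>h x\<bar> \<le> B"
  shows "expectation (\<lambda>\<omega>. h (X \<omega>, Y \<omega>)) = expectation (\<lambda>\<omega>'. expectation (\<lambda>\<omega>. h (X \<omega>, Y \<omega>')))"
proof -
  have [measurable]: "X \<in> borel_measurable M" "Y \<in> borel_measurable M"
    using ind indep_var_rv1 indep_var_rv2 by blast+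
  interpret DX: prob_space "distr M borel X" by (rule prob_space_distr) simp
  interpret DY: prob_space "distr M borel Y" by (rule prob_space_distr) simp
  interpret P: pair_prob_space "distr M borel X" "distr M borel Y" ..
  have eq: "distr M borel X \<Otimes>\<^sub>M distr M borel Y = distr M (borel \<Otimes>\<^sub>M borel) (\<lambda>x. (X x, Y x))"
    using ind unfolding indep_var_distribution_eq by simp
  have int: "integrable (distr M borel X \<Otimes>\<^sub>M distr M borel Y) (\<lambda>(x, y). h (x, y))"
    by (rule P.integrable_const_bound[of _ B]) (auto simp: B)
  have "expectation (\<lambda>\<omega>. h (X \<omega>, Y \<omega>)) = (\<integral>w. h w \<partial>(distr M borel X \<Otimes>\<^sub>M distr M borel Y))"
    unfolding eq by (subst integral_distr) auto
  also have "\<dots> = (\<integral>y. (\<integral>x. h (x, y) \<partial>distr M borel X) \<partial>distr M borel Y)"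
    using P.integral_snd[OF int] by simp
  also have "\<dots> = expectation (\<lambda>\<omega>'. expectation (\<lambda>\<omega>. h (X \<omega>, Y \<omega>')))"
    by (simp add: integral_distr)
  finally show ?thesis .
qed

context indep_centered
begin

text \<open>Once a summand is replaced, the remaining ones see the smoothed function, which lies
  again in the class with a larger constant. Replaced summands contribute their Gaussian exponential
  moment to the factor, the others the sharp truncated one; both are covered by the same exponent,
  which therefore appears once for the whole set.\<close>

lemma lindeberg:
  assumes "finite F" and p: "2 \<le> p" "p \<le> 3" and l: "1 \<le> l"
    and int: "\<And>i. i \<in> F \<Longrightarrow> integrable M (\<lambda>\<omega>. \<bar>W i \<omega>\<bar> powr p)"
    and lv: "\<And>i. i \<in> F \<Longrightarrow> l * sqrt (var i) \<le> 1"
    and "tilted_taylor p l D g g1 g2"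
  shows "\<bar>expectation (\<lambda>\<omega>. g (z + tsum (1 / l) F \<omega>)) - smooth (sum var F) g z\<bar>
    \<le> D * exp (l * z) * exp (\<Sum>i\<in>F. l\<^sup>2 * var i / 2 + l powr p * absm p i) *
       (\<Sum>i\<in>F. 12 * exp 2 * l\<^sup>2 * (absm p i + sqrt (var i) powr p))"
  using assms(1) int lv assms(7)
proof (induction F arbitrary: D g g1 g2 z rule: finite_induct)
  case empty
  then show ?case using prob_space by (simp add: tsum_def)
next
  case (insert k F)
  let ?c = "\<lambda>i. l\<^sup>2 * var i / 2 + l powr p * absm p i"
  let ?e = "\<lambda>i. 12 * exp 2 * l\<^sup>2 * (absm p i + sqrt (var i) powr p)"
  let ?T = "tsum (1 / l) F" and ?Y = "\<lambda>\<omega>. trunc (1 / l) (W k \<omega>)"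
  note T = insert.prems(3)
  note [measurable] = tilted_taylorD(1-3)[OF T]
  have D: "0 \<le> D" by (rule tilted_taylor_nonneg[OF T])
  have e0: "0 \<le> ?e i" for i using absm_nonneg by (intro mult_nonneg_nonneg add_nonneg_nonneg) auto
  have ck: "l\<^sup>2 * var k / 2 \<le> ?c k" using absm_nonneg by simp
  obtain B where B: "\<And>z. \<bar>g z\<bar> \<le> B" using T unfolding tilted_taylor_def by blast
  have T': "tilted_taylor p l (D * exp (l\<^sup>2 * var k / 2)) (smooth (var k) g) (smooth (var k) g1) (smooth (var k) g2)"
    by (rule tilted_taylor_smooth[OF T var_nonneg])
  then obtain B' where B': "\<And>z. \<bar>smooth (var k) g z\<bar> \<le> B'" unfolding tilted_taylor_def by blast
  have "expectation (\<lambda>\<omega>. g (z + tsum (1 / l) (insert k F) \<omega>)) =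
      expectation (\<lambda>\<omega>'. expectation (\<lambda>\<omega>. g (z + ?T \<omega>' + ?Y \<omega>)))"
    using indep_var_expectation_fubini[OF indep_tsum[OF insert.hyps(1,2), of "1 / l"],
        of "\<lambda>(a, b). g (z + b + trunc (1 / l) a)" B] B insert.hyps
    by (simp add: tsum_insert add_ac split_beta')
  moreover have int1: "integrable M (\<lambda>\<omega>'. expectation (\<lambda>\<omega>. g (z + ?T \<omega>' + ?Y \<omega>)))"
  proof (rule integrable_const_bound[of _ B])
    have "\<bar>expectation (\<lambda>\<omega>. g (c + ?Y \<omega>))\<bar> \<le> B" for c
    proof -
      have "\<bar>expectation (\<lambda>\<omega>. g (c + ?Y \<omega>))\<bar> \<le> expectation (\<lambda>\<omega>. \<bar>g (c + ?Y \<omega>)\<bar>)"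
        by (rule integral_abs_bound)
      also have "\<dots> \<le> expectation (\<lambda>_. B)"
        using B order_trans[OF abs_ge_zero B]
        by (intro integral_mono integrable_const_bound[of _ B] integrable_abs) auto
      finally show ?thesis using prob_space by simp
    qed
    then show "AE \<omega>' in M. norm (expectation (\<lambda>\<omega>. g (z + ?T \<omega>' + ?Y \<omega>))) \<le> B" by simp
  qed measurable
  moreover have int2: "integrable M (\<lambda>\<omega>'. smooth (var k) g (z + ?T \<omega>'))"
    using B' by (intro integrable_const_bound[of _ B']) auto
  ultimately have "\<bar>expectation (\<lambda>\<omega>. g (z + tsum (1 / l) (insert k F) \<omega>)) -
        expectation (\<lambda>\<omega>. smooth (var k) g (z + ?T \<omega>))\<bar> =
      \<bar>expectation (\<lambda>\<omega>'. expectation (\<lambda>\<omega>. g (z + ?T \<omega>' + ?Y \<omega>)) - smooth (var k) g (z + ?T \<omega>'))\<bar>"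
    by simp
  also have "\<dots> \<le> expectation (\<lambda>\<omega>'. \<bar>expectation (\<lambda>\<omega>. g (z + ?T \<omega>' + ?Y \<omega>)) - smooth (var k) g (z + ?T \<omega>')\<bar>)"
    by (rule integral_abs_bound)
  also have "\<dots> \<le> expectation (\<lambda>\<omega>'. D * exp (l * z) * ?e k * exp (l * ?T \<omega>'))"
  proof (intro integral_mono integrable_abs Bochner_Integration.integrable_diff int1 int2 integrable_mult_right
      expectation_exp_tsum insert.hyps)
    fix \<omega>'
    have "\<bar>expectation (\<lambda>\<omega>. g (z + ?T \<omega>' + ?Y \<omega>)) - smooth (var k) g (z + ?T \<omega>')\<bar> \<le>
        D * exp (l * (z + ?T \<omega>')) * ?e k"
      using insert.prems by (intro lindeberg_one[OF T p l]) auto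
    then show "\<bar>expectation (\<lambda>\<omega>. g (z + ?T \<omega>' + ?Y \<omega>)) - smooth (var k) g (z + ?T \<omega>')\<bar> \<le>
        D * exp (l * z) * ?e k * exp (l * ?T \<omega>')"
      by (simp add: distrib_left exp_add mult_ac)
  qed (use l in auto)
  also have "\<dots> = D * exp (l * z) * ?e k * (\<Prod>i\<in>F. expectation (\<lambda>\<omega>. exp (l * trunc (1 / l) (W i \<omega>))))"
    using l insert.hyps expectation_exp_tsum[OF insert.hyps(1), of "1 / l" l] by simp
  also have "\<dots> \<le> D * exp (l * z) * ?e k * (\<Prod>i\<in>F. exp (?c i))"
    using D e0[of k] insert.prems
    by (intro mult_left_mono prod_mono conjI mgf_trunc_le_sharp p l Bochner_Integration.integral_nonneg
        mult_nonneg_nonneg add_nonneg_nonneg absm_nonneg) auto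
  also have "\<dots> = D * exp (l * z) * exp (sum ?c F) * ?e k"
    using insert.hyps by (simp add: exp_sum)
  also have "\<dots> \<le> D * exp (l * z) * exp (sum ?c (insert k F)) * ?e k"
  proof -
    have "0 \<le> ?c k" using ck var_nonneg[of k] by (auto intro: order_trans[rotated])
    then show ?thesis using D e0[of k] insert.hyps by (intro mult_right_mono mult_left_mono) auto
  qed
  finally have s1: "\<bar>expectation (\<lambda>\<omega>. g (z + tsum (1 / l) (insert k F) \<omega>)) -
        expectation (\<lambda>\<omega>. smooth (var k) g (z + ?T \<omega>))\<bar> \<le> D * exp (l * z) * exp (sum ?c (insert k F)) * ?e k" .
  \<comment> \<open>The induction hypothesis is used for \<open>smooth (var k) g\<close> with its
    inflated constant; this is why the function, its derivatives and the constant are generalised in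
    the induction.\<close>
  have "\<bar>expectation (\<lambda>\<omega>. smooth (var k) g (z + ?T \<omega>)) - smooth (sum var F) (smooth (var k) g) z\<bar> \<le>
      D * exp (l\<^sup>2 * var k / 2) * exp (l * z) * exp (sum ?c F) * sum ?e F"
    using insert.prems by (intro insert.IH[OF _ _ T']) auto
  also have "\<dots> = D * exp (l * z) * exp (l\<^sup>2 * var k / 2 + sum ?c F) * sum ?e F"
    by (simp add: exp_add mult_ac)
  also have "\<dots> \<le> D * exp (l * z) * exp (sum ?c (insert k F)) * sum ?e F"
    using D e0 ck insert.hyps by (intro mult_right_mono mult_left_mono) (auto intro!: sum_nonneg)
  finally have s2: "\<bar>expectation (\<lambda>\<omega>. smooth (var k) g (z + ?T \<omega>)) - smooth (sum var (insert k F)) g z\<bar> \<le>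
      D * exp (l * z) * exp (sum ?c (insert k F)) * sum ?e F"
    using insert.hyps smooth_smooth[of g B "sum var F" "var k" z] B var_nonneg
    by (simp add: sum_nonneg add.commute)
  have "\<bar>expectation (\<lambda>\<omega>. g (z + tsum (1 / l) (insert k F) \<omega>)) - smooth (sum var (insert k F)) g z\<bar> \<le>
    D * exp (l * z) * exp (sum ?c (insert k F)) * ?e k + D * exp (l * z) * exp (sum ?c (insert k F)) * sum ?e F"
    using s1 s2 by linarith
  also have "\<dots> = D * exp (l * z) * exp (sum ?c (insert k F)) * sum ?e (insert k F)"
    using insert.hyps by (simp add: distrib_left)
  finally show ?case .
qed

text \<open>The indicator of the half-line from x lies between the steps starting at x and at x - 3
  * w. In the error, 48 is 4 from the step times 12 from one replacement, and exp 3 collects exp 2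
  and the exp 1 left from the p-th moments.\<close>

lemma gauss_tsum:
  assumes F: "finite F" and p: "2 \<le> p" "p \<le> 3" and l: "1 \<le> l" and w: "0 < w" "w \<le> 1"
    and int: "\<And>i. i \<in> F \<Longrightarrow> integrable M (\<lambda>\<omega>. \<bar>W i \<omega>\<bar> powr p)"
    and lv: "\<And>i. i \<in> F \<Longrightarrow> l * sqrt (var i) \<le> 1"
    and V: "0 < sum var F" "sum var F \<le> 1" and S: "l powr p * sum (absm p) F \<le> 1"
  defines "R \<equiv> (\<Sum>i\<in>F. absm p i + sqrt (var i) powr p)"
  shows "prob {\<omega> \<in> space M. x \<le> tsum (1 / l) F \<omega>} \<le> 1 - std_normal_cdf ((x - 3 * w) / sqrt (sum var F))
      + 48 * exp 3 / w ^ 3 * l\<^sup>2 * exp (l\<^sup>2 / 2 - l * x + 3 * l * w) * R" (is ?upper)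
    and "1 - std_normal_cdf ((x + 3 * w) / sqrt (sum var F))
      - 48 * exp 3 / w ^ 3 * l\<^sup>2 * exp (l\<^sup>2 / 2 - l * x) * R \<le> prob {\<omega> \<in> space M. x \<le> tsum (1 / l) F \<omega>}" (is ?lower)
proof -
  let ?T = "tsum (1 / l) F"
  have R: "0 \<le> R" unfolding R_def using absm_nonneg by (intro sum_nonneg add_nonneg_nonneg) auto
  have clt: "\<bar>expectation (\<lambda>\<omega>. step ((?T \<omega> - a) / w)) - smooth (sum var F) (\<lambda>s. step ((s - a) / w)) 0\<bar> \<le>
      48 * exp 3 / w ^ 3 * l\<^sup>2 * exp (l\<^sup>2 / 2 - l * a) * R" for a
  proof -
    have "\<bar>expectation (\<lambda>\<omega>. step ((0 + ?T \<omega> - a) / w)) - smooth (sum var F) (\<lambda>s. step ((s - a) / w)) 0\<bar> \<le>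
      4 / w ^ 3 * exp (- l * a) * exp (l * 0) * exp (\<Sum>i\<in>F. l\<^sup>2 * var i / 2 + l powr p * absm p i) *
       (\<Sum>i\<in>F. 12 * exp 2 * l\<^sup>2 * (absm p i + sqrt (var i) powr p))"
      using l by (intro lindeberg[OF F p l int lv tilted_taylor_step[OF p w]]) auto
    also have "\<dots> = 4 / w ^ 3 * exp (- l * a) * exp (\<Sum>i\<in>F. l\<^sup>2 * var i / 2 + l powr p * absm p i) * (12 * exp 2 * l\<^sup>2 * R)"
      by (simp add: R_def sum_distrib_left)
    also have "\<dots> \<le> 4 / w ^ 3 * exp (- l * a) * exp (l\<^sup>2 / 2 + 1) * (12 * exp 2 * l\<^sup>2 * R)"
    proof -
      have "(\<Sum>i\<in>F. l\<^sup>2 * var i / 2 + l powr p * absm p i) = l\<^sup>2 / 2 * sum var F + l powr p * sum (absm p) F"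
        by (simp add: sum.distrib sum_distrib_left)
      also have "\<dots> \<le> l\<^sup>2 / 2 * 1 + 1" using V S by (intro add_mono mult_left_mono) auto
      finally show ?thesis using R w l by (intro mult_right_mono mult_left_mono) auto
    qed
    also have "\<dots> = 48 / w ^ 3 * l\<^sup>2 * R * (exp (- l * a) * exp (l\<^sup>2 / 2 + 1) * exp 2)"
      by simp
    also have "exp (- l * a) * exp (l\<^sup>2 / 2 + 1) * exp 2 = exp 3 * exp (l\<^sup>2 / 2 - l * a)"
      by (simp flip: exp_add)
    finally show ?thesis by (simp add: mult_ac)
  qed
  have ints: "integrable M (\<lambda>\<omega>. step ((?T \<omega> - a) / w))" for a
    using step_bounds by (intro integrable_const_bound[of _ 1]) auto
  have ind: "prob {\<omega> \<in> space M. x \<le> ?T \<omega>} = expectation (indicator {\<omega> \<in> space M. x \<le> ?T \<omega>})"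
    by simp
  have iint: "integrable M (indicator {\<omega> \<in> space M. x \<le> ?T \<omega>} :: _ \<Rightarrow> real)"
    by (simp add: emeasure_eq_measure)
  have "expectation (indicator {\<omega> \<in> space M. x \<le> ?T \<omega>}) \<le> expectation (\<lambda>\<omega>. step ((?T \<omega> - (x - 3 * w)) / w))"
  proof (intro integral_mono ints iint)
    fix \<omega>
    show "indicator {\<omega> \<in> space M. x \<le> ?T \<omega>} \<omega> \<le> step ((?T \<omega> - (x - 3 * w)) / w)"
    proof (cases "x \<le> ?T \<omega>")
      case True
      then show ?thesis using w by (subst step_eq_1(1)) (auto simp: field_simps indicator_def)
    qed (simp add: step_bounds)
  qed
  with clt[of "x - 3 * w"] smooth_step_bounds(1)[OF V(1) w(1), of "x - 3 * w"]
  show ?upper unfolding ind by (simp add: algebra_simps)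
  have "expectation (\<lambda>\<omega>. step ((?T \<omega> - x) / w)) \<le> expectation (indicator {\<omega> \<in> space M. x \<le> ?T \<omega>})"
  proof (intro integral_mono ints iint)
    fix \<omega> assume "\<omega> \<in> space M"
    then show "step ((?T \<omega> - x) / w) \<le> indicator {\<omega> \<in> space M. x \<le> ?T \<omega>} \<omega>"
      using w by (cases "x \<le> ?T \<omega>") (auto simp: step_bounds step_eq_0 divide_le_0_iff)
  qed
  with clt[of x] smooth_step_bounds(2)[OF V(1) w(1), of x]
  show ?lower unfolding ind by simp
qed

lemma prob_W_square:
  assumes "0 < y"
  shows "prob {\<omega> \<in> space M. y \<le> W i \<omega>} \<le> var i / y\<^sup>2"
proof -
  have "prob {\<omega> \<in> space M. y \<le> W i \<omega>} = expectation (indicator {\<omega> \<in> space M. y \<le> W i \<omega>})" by simp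
  also have "\<dots> \<le> expectation (\<lambda>\<omega>. (W i \<omega>)\<^sup>2 / y\<^sup>2)"
  proof (intro integral_mono integrable_divide sq_int)
    fix \<omega>
    show "indicator {\<omega> \<in> space M. y \<le> W i \<omega>} \<omega> \<le> (W i \<omega>)\<^sup>2 / y\<^sup>2"
      using assms power_mono[of y "W i \<omega>" 2] by (auto simp: indicator_def divide_simps)
  qed (simp add: emeasure_eq_measure)
  finally show ?thesis by (simp add: var_def)
qed

lemma expectation_sum_sq:
  assumes "finite F"
  shows "expectation (\<lambda>\<omega>. (\<Sum>i\<in>F. W i \<omega>)\<^sup>2) = sum var F" "integrable M (\<lambda>\<omega>. (\<Sum>i\<in>F. W i \<omega>)\<^sup>2)"
proof -
  have "expectation (\<lambda>\<omega>. (\<Sum>i\<in>F. W i \<omega>)\<^sup>2) = sum var F \<and> integrable M (\<lambda>\<omega>. (\<Sum>i\<in>F. W i \<omega>)\<^sup>2)"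
    using assms
  proof (induction F rule: finite_induct)
    case (insert k F)
    let ?S = "\<lambda>\<omega>. \<Sum>i\<in>F. W i \<omega>"
    have ind: "indep_var borel (W k) borel ?S"
      by (rule indep_vars_sum[OF insert.hyps indep_vars_subset[OF indep]]) simp
    have S: "integrable M ?S" "expectation ?S = 0"
      using W_int mean by simp_all
    have "expectation (\<lambda>\<omega>. W k \<omega> * ?S \<omega>) = 0" and int: "integrable M (\<lambda>\<omega>. W k \<omega> * ?S \<omega>)"
      using indep_var_lebesgue_integral[OF ind W_int S(1)] indep_var_integrable[OF ind W_int S(1)] mean
      by simp_all
    moreover have "(\<Sum>i\<in>insert k F. W i \<omega>)\<^sup>2 = (W k \<omega>)\<^sup>2 + 2 * (W k \<omega> * ?S \<omega>) + (?S \<omega>)\<^sup>2" for \<omega>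
      using insert.hyps by (simp add: power2_sum)
    ultimately show ?case using insert sq_int[of k] by (simp add: var_def)
  qed simp
  then show "expectation (\<lambda>\<omega>. (\<Sum>i\<in>F. W i \<omega>)\<^sup>2) = sum var F" "integrable M (\<lambda>\<omega>. (\<Sum>i\<in>F. W i \<omega>)\<^sup>2)"
    by auto
qed

text \<open>Chebyshev's inequality in the form used for lower bounds: after one large jump, the
  other summands do not pull the sum back by more than c.\<close>

lemma prob_sum_ge:
  assumes "finite F" "0 < c"
  shows "1 - sum var F / c\<^sup>2 \<le> prob {\<omega> \<in> space M. - c \<le> (\<Sum>i\<in>F. W i \<omega>)}"
proof -
  let ?S = "\<lambda>\<omega>. \<Sum>i\<in>F. W i \<omega>"
  have "1 - sum var F / c\<^sup>2 = expectation (\<lambda>\<omega>. 1 - (?S \<omega>)\<^sup>2 / c\<^sup>2)"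
    using expectation_sum_sq[OF assms(1)] prob_space by simp
  also have "\<dots> \<le> expectation (indicator {\<omega> \<in> space M. - c \<le> ?S \<omega>})"
  proof (intro integral_mono)
    show "integrable M (\<lambda>\<omega>. 1 - (?S \<omega>)\<^sup>2 / c\<^sup>2)" using expectation_sum_sq[OF assms(1)] by simp
    fix \<omega> assume "\<omega> \<in> space M"
    then show "1 - (?S \<omega>)\<^sup>2 / c\<^sup>2 \<le> indicator {\<omega> \<in> space M. - c \<le> ?S \<omega>} \<omega>"
      using assms(2) power_mono[of c "- ?S \<omega>" 2] by (auto simp: indicator_def divide_simps)
  qed (simp add: emeasure_eq_measure)
  finally show ?thesis by simp
qed

end

section \<open>Decomposition by large jumps\<close>

lemma (in prob_space) indep_var_tails:
  fixes X Y :: "'a \<Rightarrow> real"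
  assumes "indep_var borel X borel Y"
  shows "prob {\<omega> \<in> space M. a \<le> X \<omega> \<and> b \<le> Y \<omega>} =
    prob {\<omega> \<in> space M. a \<le> X \<omega>} * prob {\<omega> \<in> space M. b \<le> Y \<omega>}"
proof -
  have "(\<lambda>x. (X x, Y x)) -` ({a..} \<times> {b..}) \<inter> space M = {\<omega> \<in> space M. a \<le> X \<omega> \<and> b \<le> Y \<omega>}"
    "X -` {a..} \<inter> space M = {\<omega> \<in> space M. a \<le> X \<omega>}" "Y -` {b..} \<inter> space M = {\<omega> \<in> space M. b \<le> Y \<omega>}"
    by auto
  with indep_varD[OF assms, of "{a..}" "{b..}"] show ?thesis by simp
qed

text \<open>The double sum runs over ordered pairs and so counts each intersection twice; this
  weakening is harmless and lets the correction be bounded by a square.\<close>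

lemma (in finite_measure) measure_UN_bonferroni:
  assumes F: "finite F" and B: "\<And>i. i \<in> F \<Longrightarrow> B i \<in> sets M"
  shows "(\<Sum>i\<in>F. measure M (B i)) - (\<Sum>i\<in>F. \<Sum>j\<in>F - {i}. measure M (B i \<inter> B j)) \<le> measure M (\<Union>i\<in>F. B i)"
  using assms
proof (induction F rule: finite_induct)
  case (insert k F)
  let ?U = "\<Union>i\<in>F. B i"
  have [measurable]: "B k \<in> sets M" "?U \<in> sets M" using insert by auto
  have "measure M (B k \<inter> ?U) \<le> (\<Sum>j\<in>F. measure M (B k \<inter> B j))"
    unfolding Int_UN_distrib using insert by (intro finite_measure_subadditive_finite) auto
  moreover have "measure M (\<Union>i\<in>insert k F. B i) = measure M (B k) + measure M ?U - measure M (B k \<inter> ?U)"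
    using measure_Un3[of "B k" M ?U] by (simp add: fmeasurable_eq_sets)
  moreover have "(\<Sum>i\<in>F. \<Sum>j\<in>F - {i}. measure M (B i \<inter> B j)) + (\<Sum>j\<in>F. measure M (B k \<inter> B j)) \<le>
      (\<Sum>i\<in>insert k F. \<Sum>j\<in>insert k F - {i}. measure M (B i \<inter> B j))"
  proof -
    have "(\<Sum>i\<in>F. \<Sum>j\<in>F - {i}. measure M (B i \<inter> B j)) \<le> (\<Sum>i\<in>F. \<Sum>j\<in>insert k F - {i}. measure M (B i \<inter> B j))"
      using insert.hyps by (intro sum_mono sum_mono2) auto
    moreover have "insert k F - {k} = F" using insert.hyps by auto
    ultimately show ?thesis using insert.hyps by simp
  qed
  moreover have "(\<Sum>i\<in>F. measure M (B i)) - (\<Sum>i\<in>F. \<Sum>j\<in>F - {i}. measure M (B i \<inter> B j)) \<le> measure M ?U"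
    using insert by simp
  ultimately show ?case using insert.hyps by simp
qed simp

lemma sum_offdiag_le_square:
  fixes f :: "'i \<Rightarrow> real"
  assumes "finite F" "\<And>i. 0 \<le> f i"
  shows "(\<Sum>i\<in>F. \<Sum>j\<in>F - {i}. f i * f j) \<le> (sum f F)\<^sup>2"
proof -
  have "(\<Sum>i\<in>F. \<Sum>j\<in>F - {i}. f i * f j) \<le> (\<Sum>i\<in>F. \<Sum>j\<in>F. f i * f j)"
    using assms by (intro sum_mono sum_mono2) auto
  then show ?thesis by (simp add: power2_eq_square sum_product)
qed

context indep_centered
begin

lemma indep_pair:
  assumes "i \<noteq> j"
  shows "indep_var borel (W i) borel (W j)"
  using indep_vars_sum[of "{j}" i W, OF _ _ indep_vars_subset[OF indep]] assms by simp

text \<open>The four terms are: no jump above y; a jump above y while the other truncated summands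
  reach d; a single jump above u; two jumps above y. Independence turns the second and the fourth
  into products.\<close>

lemma tail_upper_finite:
  assumes F: "finite F" and d: "d \<le> z - u"
  shows "prob {\<omega> \<in> space M. z \<le> (\<Sum>i\<in>F. W i \<omega>)} \<le> prob {\<omega> \<in> space M. z \<le> tsum y F \<omega>}
    + (\<Sum>j\<in>F. prob {\<omega> \<in> space M. y \<le> W j \<omega>} * prob {\<omega> \<in> space M. d \<le> tsum y (F - {j}) \<omega>})
    + (\<Sum>j\<in>F. prob {\<omega> \<in> space M. u \<le> W j \<omega>}) + (\<Sum>j\<in>F. prob {\<omega> \<in> space M. y \<le> W j \<omega>})\<^sup>2"
proof -
  let ?A = "{\<omega> \<in> space M. z \<le> tsum y F \<omega>}"
  let ?B = "\<lambda>j. {\<omega> \<in> space M. y \<le> W j \<omega> \<and> d \<le> tsum y (F - {j}) \<omega>}"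
  let ?C = "\<lambda>j. {\<omega> \<in> space M. u \<le> W j \<omega>}"
  let ?D = "\<lambda>i j. {\<omega> \<in> space M. y \<le> W i \<omega> \<and> y \<le> W j \<omega>}"
  have sub: "{\<omega> \<in> space M. z \<le> (\<Sum>i\<in>F. W i \<omega>)} \<subseteq>
      ?A \<union> ((\<Union>j\<in>F. ?B j) \<union> ((\<Union>j\<in>F. ?C j) \<union> (\<Union>i\<in>F. \<Union>j\<in>F - {i}. ?D i j)))" (is "_ \<subseteq> ?R")
  proof
    fix \<omega> assume \<omega>: "\<omega> \<in> {\<omega> \<in> space M. z \<le> (\<Sum>i\<in>F. W i \<omega>)}"
    show "\<omega> \<in> ?R"
    proof (cases "\<exists>j\<in>F. y < W j \<omega>")
      case False
      then have "tsum y F \<omega> = (\<Sum>i\<in>F. W i \<omega>)"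
        unfolding tsum_def trunc_def by (intro sum.cong) auto
      with \<omega> show ?thesis by auto
    next
      case True
      then obtain j where j: "j \<in> F" "y < W j \<omega>" by blast
      show ?thesis
      proof (cases "\<exists>i\<in>F - {j}. y < W i \<omega>")
        case True
        then obtain i where i: "i \<in> F - {j}" "y < W i \<omega>" by blast
        then have "\<omega> \<in> ?D j i" using j \<omega> by simp
        then have "\<omega> \<in> (\<Union>i\<in>F. \<Union>j\<in>F - {i}. ?D i j)" using i(1) j(1) by (intro UN_I)
        then show ?thesis by (intro UnI2)
      next
        case False
        then have "W i \<omega> \<le> y" if "i \<in> F - {j}" for i using that by (meson not_le)
        then have "tsum y (F - {j}) \<omega> = (\<Sum>i\<in>F - {j}. W i \<omega>)"
          unfolding tsum_def trunc_def by (intro sum.cong refl) (simp only: if_True)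
        moreover have "(\<Sum>i\<in>F. W i \<omega>) = W j \<omega> + (\<Sum>i\<in>F - {j}. W i \<omega>)"
          using F j by (simp add: sum.remove)
        \<comment> \<open>With a single jump below u the remaining sum is at least z - u, hence at
          least d.\<close>
        ultimately consider "u \<le> W j \<omega>" | "d \<le> tsum y (F - {j}) \<omega>" using \<omega> d by fastforce
        then show ?thesis
        proof cases
          case 1
          then have "\<omega> \<in> (\<Union>j\<in>F. ?C j)" using j \<omega> by (intro UN_I[of j]) auto
          then show ?thesis by (intro UnI2 UnI1)
        next
          case 2
          then have "\<omega> \<in> (\<Union>j\<in>F. ?B j)" using j \<omega> by (intro UN_I[of j]) auto
          then show ?thesis by (intro UnI2 UnI1)
        qed
      qed
    qed
  qed
  have le3: "prob (A \<union> (B \<union> (C \<union> D))) \<le> prob A + prob B + prob C + prob D"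
    if "A \<in> events" "B \<in> events" "C \<in> events" "D \<in> events" for A B C D
    using that measure_Un_le[of A M "B \<union> (C \<union> D)"] measure_Un_le[of B M "C \<union> D"]
      measure_Un_le[of C M D] by simp
  have UN: "prob (\<Union>j\<in>G. B j) \<le> (\<Sum>j\<in>G. prob (B j))" if "finite G" "\<And>j. B j \<in> events" for B :: "'i \<Rightarrow> 'a set" and G
    using that by (intro finite_measure_subadditive_finite) auto
  have "prob {\<omega> \<in> space M. z \<le> (\<Sum>i\<in>F. W i \<omega>)} \<le> prob ?R"
    using F by (intro finite_measure_mono sub) (auto intro!: sets.Un sets.finite_UN)
  also have "\<dots> \<le> prob ?A + prob (\<Union>j\<in>F. ?B j) + prob (\<Union>j\<in>F. ?C j) + prob (\<Union>i\<in>F. \<Union>j\<in>F - {i}. ?D i j)"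
    using F by (intro le3) (auto intro!: sets.finite_UN)
  also have "\<dots> \<le> prob ?A + (\<Sum>j\<in>F. prob (?B j)) + (\<Sum>j\<in>F. prob (?C j)) + (\<Sum>i\<in>F. \<Sum>j\<in>F - {i}. prob (?D i j))"
  proof -
    have "prob (\<Union>i\<in>F. \<Union>j\<in>F - {i}. ?D i j) \<le> (\<Sum>i\<in>F. prob (\<Union>j\<in>F - {i}. ?D i j))"
      using F by (intro UN) (auto intro!: sets.finite_UN)
    also have "\<dots> \<le> (\<Sum>i\<in>F. \<Sum>j\<in>F - {i}. prob (?D i j))" using F by (intro sum_mono UN) auto
    finally show ?thesis using F by (intro add_mono UN) auto
  qed
  also have "(\<Sum>j\<in>F. prob (?B j)) =
      (\<Sum>j\<in>F. prob {\<omega> \<in> space M. y \<le> W j \<omega>} * prob {\<omega> \<in> space M. d \<le> tsum y (F - {j}) \<omega>})"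
    using F by (intro sum.cong refl indep_var_tails indep_tsum) auto
  also have "(\<Sum>i\<in>F. \<Sum>j\<in>F - {i}. prob (?D i j)) =
      (\<Sum>i\<in>F. \<Sum>j\<in>F - {i}. prob {\<omega> \<in> space M. y \<le> W i \<omega>} * prob {\<omega> \<in> space M. y \<le> W j \<omega>})"
    by (intro sum.cong refl indep_var_tails indep_pair) auto
  also have "\<dots> \<le> (\<Sum>j\<in>F. prob {\<omega> \<in> space M. y \<le> W j \<omega>})\<^sup>2"
    using F by (intro sum_offdiag_le_square) auto
  finally show ?thesis by simp
qed

text \<open>Two disjoint ways to reach z are added: no jump above y with a large truncated sum, and
  a jump above v with the other summands not below -(v - z). They exclude each other because y <
  v.\<close>

lemma tail_lower_finite:
  assumes F: "finite F" and v: "z < v" "y < v"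
  shows "prob {\<omega> \<in> space M. z \<le> tsum y F \<omega>}
    - (\<Sum>j\<in>F. prob {\<omega> \<in> space M. y \<le> W j \<omega>} * prob {\<omega> \<in> space M. z \<le> tsum y (F - {j}) \<omega>})
    + (\<Sum>j\<in>F. prob {\<omega> \<in> space M. v \<le> W j \<omega>}) * (1 - sum var F / (v - z)\<^sup>2)
    - (\<Sum>j\<in>F. prob {\<omega> \<in> space M. v \<le> W j \<omega>})\<^sup>2 \<le> prob {\<omega> \<in> space M. z \<le> (\<Sum>i\<in>F. W i \<omega>)}"
proof -
  let ?A = "{\<omega> \<in> space M. z \<le> tsum y F \<omega>}"
  let ?A' = "{\<omega> \<in> space M. z \<le> tsum y F \<omega> \<and> (\<forall>j\<in>F. W j \<omega> \<le> y)}"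
  let ?J = "\<lambda>j. {\<omega> \<in> space M. y \<le> W j \<omega> \<and> z \<le> tsum y (F - {j}) \<omega>}"
  let ?B = "\<lambda>j. {\<omega> \<in> space M. v \<le> W j \<omega> \<and> - (v - z) \<le> (\<Sum>i\<in>F - {j}. W i \<omega>)}"
  let ?C = "\<lambda>j. {\<omega> \<in> space M. v \<le> W j \<omega>}"
  have A'[measurable]: "?A' \<in> events" using F by measurable
  have B[measurable]: "?B j \<in> events" for j by measurable
  have J[measurable]: "?J j \<in> events" for j by measurable
  have UB[measurable]: "(\<Union>j\<in>F. ?B j) \<in> events" "(\<Union>j\<in>F. ?J j) \<in> events" using F by (auto intro!: sets.finite_UN)
  have "?A' \<union> (\<Union>j\<in>F. ?B j) \<subseteq> {\<omega> \<in> space M. z \<le> (\<Sum>i\<in>F. W i \<omega>)}"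
  proof
    fix \<omega> assume "\<omega> \<in> ?A' \<union> (\<Union>j\<in>F. ?B j)"
    then consider "\<omega> \<in> ?A'" | j where "j \<in> F" "\<omega> \<in> ?B j" by blast
    then show "\<omega> \<in> {\<omega> \<in> space M. z \<le> (\<Sum>i\<in>F. W i \<omega>)}"
    proof cases
      case 1
      then have "tsum y F \<omega> = (\<Sum>i\<in>F. W i \<omega>)"
        unfolding tsum_def trunc_def by (intro sum.cong) auto
      with 1 show ?thesis by simp
    next
      case 2
      have "(\<Sum>i\<in>F. W i \<omega>) = W j \<omega> + (\<Sum>i\<in>F - {j}. W i \<omega>)" using F 2(1) by (rule sum.remove)
      with 2(2) show ?thesis by simp
    qed
  qed
  then have "prob (?A' \<union> (\<Union>j\<in>F. ?B j)) \<le> prob {\<omega> \<in> space M. z \<le> (\<Sum>i\<in>F. W i \<omega>)}"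
    by (intro finite_measure_mono) measurable
  moreover have "prob (?A' \<union> (\<Union>j\<in>F. ?B j)) = prob ?A' + prob (\<Union>j\<in>F. ?B j)"
  proof (intro finite_measure_Union A' UB)
    have "\<omega> \<notin> ?B j" if "\<omega> \<in> ?A'" "j \<in> F" for \<omega> j using that v by fastforce
    then show "?A' \<inter> (\<Union>j\<in>F. ?B j) = {}" by blast
  qed
  moreover have "prob ?A \<le> prob ?A' + (\<Sum>j\<in>F. prob {\<omega> \<in> space M. y \<le> W j \<omega>} * prob {\<omega> \<in> space M. z \<le> tsum y (F - {j}) \<omega>})"
  proof -
    have "?A \<subseteq> ?A' \<union> (\<Union>j\<in>F. ?J j)"
    proof
      fix \<omega> assume \<omega>: "\<omega> \<in> ?A"
      show "\<omega> \<in> ?A' \<union> (\<Union>j\<in>F. ?J j)"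
      proof (cases "\<forall>j\<in>F. W j \<omega> \<le> y")
        case False
        then obtain j where j: "j \<in> F" "y < W j \<omega>" by (meson not_le)
        \<comment> \<open>The jumping summand is truncated to 0, so omitting its index changes
          nothing; the truncated sum over the other indices is independent of the jump.\<close>
        then have "tsum y F \<omega> = tsum y (F - {j}) \<omega>"
          using sum.remove[OF F j(1), of "\<lambda>i. trunc y (W i \<omega>)"] by (simp add: tsum_def trunc_def)
        then have "\<omega> \<in> ?J j" using \<omega> j by simp
        then show ?thesis using j(1) by blast
      next
        case True
        then have "\<omega> \<in> ?A'" using \<omega> by simp
        then show ?thesis by (rule UnI1)
      qed
    qed
    then have "prob ?A \<le> prob (?A' \<union> (\<Union>j\<in>F. ?J j))"
      by (intro finite_measure_mono) (auto intro!: sets.Un A' UB)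
    also have "\<dots> \<le> prob ?A' + prob (\<Union>j\<in>F. ?J j)"
      by (intro measure_Un_le A' UB)
    also have "prob (\<Union>j\<in>F. ?J j) \<le> (\<Sum>j\<in>F. prob (?J j))"
      using F by (intro finite_measure_subadditive_finite) auto
    also have "\<dots> = (\<Sum>j\<in>F. prob {\<omega> \<in> space M. y \<le> W j \<omega>} * prob {\<omega> \<in> space M. z \<le> tsum y (F - {j}) \<omega>})"
      using F by (intro sum.cong refl indep_var_tails indep_tsum) auto
    finally show ?thesis by simp
  qed
  moreover have "(\<Sum>j\<in>F. prob (?C j)) * (1 - sum var F / (v - z)\<^sup>2) - (\<Sum>j\<in>F. prob (?C j))\<^sup>2 \<le> prob (\<Union>j\<in>F. ?B j)"
  proof -
    have one: "prob (?C j) * (1 - sum var F / (v - z)\<^sup>2) \<le> prob (?B j)" if j: "j \<in> F" for j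
    proof -
      have "sum var (F - {j}) \<le> sum var F" using F var_nonneg by (intro sum_mono2) auto
      then have "1 - sum var F / (v - z)\<^sup>2 \<le> 1 - sum var (F - {j}) / (v - z)\<^sup>2"
        by (simp add: divide_right_mono)
      also have "\<dots> \<le> prob {\<omega> \<in> space M. - (v - z) \<le> (\<Sum>i\<in>F - {j}. W i \<omega>)}"
        using F v by (intro prob_sum_ge) auto
      finally have "prob (?C j) * (1 - sum var F / (v - z)\<^sup>2) \<le>
          prob (?C j) * prob {\<omega> \<in> space M. - (v - z) \<le> (\<Sum>i\<in>F - {j}. W i \<omega>)}"
        by (intro mult_left_mono) auto
      also have "\<dots> = prob (?B j)"
        using F by (intro indep_var_tails[symmetric] indep_vars_sum indep_vars_subset[OF indep]) auto
      finally show ?thesis .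
    qed
    have two: "prob (?B i \<inter> ?B j) \<le> prob (?C i) * prob (?C j)" if "i \<noteq> j" for i j
    proof -
      have "prob (?B i \<inter> ?B j) \<le> prob {\<omega> \<in> space M. v \<le> W i \<omega> \<and> v \<le> W j \<omega>}"
        by (intro finite_measure_mono) auto
      then show ?thesis using indep_var_tails[OF indep_pair[OF that], of v v] by simp
    qed
    have "(\<Sum>i\<in>F. \<Sum>j\<in>F - {i}. prob (?B i \<inter> ?B j)) \<le> (\<Sum>i\<in>F. \<Sum>j\<in>F - {i}. prob (?C i) * prob (?C j))"
      by (intro sum_mono two) auto
    also have "\<dots> \<le> (\<Sum>j\<in>F. prob (?C j))\<^sup>2"
      using F by (intro sum_offdiag_le_square) auto
    finally have "(\<Sum>i\<in>F. \<Sum>j\<in>F - {i}. prob (?B i \<inter> ?B j)) \<le> (\<Sum>j\<in>F. prob (?C j))\<^sup>2" .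
    moreover have "(\<Sum>j\<in>F. prob (?C j)) * (1 - sum var F / (v - z)\<^sup>2) \<le> (\<Sum>j\<in>F. prob (?B j))"
      unfolding sum_distrib_right by (intro sum_mono one)
    moreover have "(\<Sum>i\<in>F. prob (?B i)) - (\<Sum>i\<in>F. \<Sum>j\<in>F - {i}. prob (?B i \<inter> ?B j)) \<le> prob (\<Union>i\<in>F. ?B i)"
      using F B by (rule measure_UN_bonferroni)
    ultimately show ?thesis by linarith
  qed
  ultimately show ?thesis by linarith
qed

text \<open>The expected number of summands reaching u, the leading term of the one-jump
  contribution.\<close>

definition jumps :: "real \<Rightarrow> real" where
  "jumps u = (\<Sum>\<^sub>\<infinity>i. prob {\<omega> \<in> space M. u \<le> W i \<omega>})"

end

section \<open>From finite subsums to the mean-square limit\<close>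

lemma (in prob_space) mean_square_deviation:
  assumes Z: "has_mean_square_sum M W Z" and [measurable]: "\<And>i. W i \<in> borel_measurable M" and c: "0 < c"
  shows "((\<lambda>F. prob {\<omega> \<in> space M. c \<le> \<bar>(\<Sum>i\<in>F. W i \<omega>) - Z \<omega>\<bar>}) \<longlongrightarrow> 0) (finite_subsets_at_top UNIV)"
proof -
  have [measurable]: "Z \<in> borel_measurable M" using Z unfolding has_mean_square_sum_def by simp
  let ?I = "\<lambda>F. \<integral>\<^sup>+ \<omega>. ennreal (((\<Sum>j\<in>F. W j \<omega>) - Z \<omega>)\<^sup>2) \<partial>M"
  have bound: "emeasure M {\<omega> \<in> space M. c \<le> \<bar>(\<Sum>i\<in>F. W i \<omega>) - Z \<omega>\<bar>} \<le> ennreal (1 / c\<^sup>2) * ?I F" for F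
  proof -
    let ?A = "{\<omega> \<in> space M. c \<le> \<bar>(\<Sum>i\<in>F. W i \<omega>) - Z \<omega>\<bar>}"
    have "emeasure M ?A = (\<integral>\<^sup>+ \<omega>. indicator ?A \<omega> \<partial>M)" by simp
    also have "\<dots> \<le> (\<integral>\<^sup>+ \<omega>. ennreal (1 / c\<^sup>2) * ennreal (((\<Sum>j\<in>F. W j \<omega>) - Z \<omega>)\<^sup>2) \<partial>M)"
    proof (intro nn_integral_mono)
      fix \<omega>
      show "indicator ?A \<omega> \<le> ennreal (1 / c\<^sup>2) * ennreal (((\<Sum>j\<in>F. W j \<omega>) - Z \<omega>)\<^sup>2)"
      proof (cases "\<omega> \<in> ?A")
        case True
        then have "c\<^sup>2 \<le> \<bar>(\<Sum>i\<in>F. W i \<omega>) - Z \<omega>\<bar>\<^sup>2" using c by (intro power_mono) auto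
        then have "1 \<le> 1 / c\<^sup>2 * ((\<Sum>j\<in>F. W j \<omega>) - Z \<omega>)\<^sup>2" using c by (simp add: field_simps)
        then show ?thesis using True by (simp add: ennreal_mult'[symmetric] flip: ennreal_1)
      qed simp
    qed
    also have "\<dots> = ennreal (1 / c\<^sup>2) * ?I F" by (intro nn_integral_cmult) measurable
    finally show ?thesis .
  qed
  have lim: "((\<lambda>F. ennreal (1 / c\<^sup>2) * ?I F) \<longlongrightarrow> ennreal (1 / c\<^sup>2) * 0) (finite_subsets_at_top UNIV)"
    using Z unfolding has_mean_square_sum_def by (intro ennreal_tendsto_cmult) auto
  have "((\<lambda>F. emeasure M {\<omega> \<in> space M. c \<le> \<bar>(\<Sum>i\<in>F. W i \<omega>) - Z \<omega>\<bar>}) \<longlongrightarrow> 0) (finite_subsets_at_top UNIV)"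
  proof (rule tendsto_sandwich[OF _ _ tendsto_const])
    show "\<forall>\<^sub>F F in finite_subsets_at_top UNIV. emeasure M {\<omega> \<in> space M. c \<le> \<bar>(\<Sum>i\<in>F. W i \<omega>) - Z \<omega>\<bar>} \<le> ennreal (1 / c\<^sup>2) * ?I F"
      by (rule always_eventually, rule allI, rule bound)
    show "((\<lambda>F. ennreal (1 / c\<^sup>2) * ?I F) \<longlongrightarrow> 0) (finite_subsets_at_top UNIV)"
      using lim by simp
  qed simp
  then have "((\<lambda>F. ennreal (prob {\<omega> \<in> space M. c \<le> \<bar>(\<Sum>i\<in>F. W i \<omega>) - Z \<omega>\<bar>})) \<longlongrightarrow> ennreal 0) (finite_subsets_at_top UNIV)"
    unfolding emeasure_eq_measure by simp
  then show ?thesis by (rule tendsto_ennrealD) simp_all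
qed

text \<open>The gap between z' and z absorbs the distance of the finite sum from its limit, which is
  small in probability. This is the reason why all later estimates leave a strictly positive slack
  at x.\<close>

lemma (in prob_space) mean_square_tail_upper:
  assumes Z: "has_mean_square_sum M W Z" and [measurable]: "\<And>i. W i \<in> borel_measurable M" and z: "z' < z"
    and ev: "\<forall>\<^sub>F F in finite_subsets_at_top UNIV. prob {\<omega> \<in> space M. z' \<le> (\<Sum>i\<in>F. W i \<omega>)} \<le> c"
  shows "prob {\<omega> \<in> space M. z \<le> Z \<omega>} \<le> c"
proof -
  have [measurable]: "Z \<in> borel_measurable M" using Z unfolding has_mean_square_sum_def by simp
  let ?D = "\<lambda>F. {\<omega> \<in> space M. z - z' \<le> \<bar>(\<Sum>i\<in>F. W i \<omega>) - Z \<omega>\<bar>}"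
  have "prob {\<omega> \<in> space M. z \<le> Z \<omega>} \<le> prob {\<omega> \<in> space M. z' \<le> (\<Sum>i\<in>F. W i \<omega>)} + prob (?D F)" for F
  proof -
    have "prob {\<omega> \<in> space M. z \<le> Z \<omega>} \<le> prob ({\<omega> \<in> space M. z' \<le> (\<Sum>i\<in>F. W i \<omega>)} \<union> ?D F)"
      by (intro finite_measure_mono) auto
    also have "\<dots> \<le> prob {\<omega> \<in> space M. z' \<le> (\<Sum>i\<in>F. W i \<omega>)} + prob (?D F)"
      by (intro measure_Un_le) measurable
    finally show ?thesis .
  qed
  then have "\<forall>\<^sub>F F in finite_subsets_at_top UNIV. prob {\<omega> \<in> space M. z \<le> Z \<omega>} \<le> c + prob (?D F)"
    by (intro eventually_mono[OF ev]) (meson add_right_mono order_trans)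
  moreover have "((\<lambda>F. c + prob (?D F)) \<longlongrightarrow> c + 0) (finite_subsets_at_top UNIV)"
    using z by (intro tendsto_intros mean_square_deviation[OF Z]) auto
  ultimately have "prob {\<omega> \<in> space M. z \<le> Z \<omega>} \<le> c + 0"
    by (intro tendsto_lowerbound) auto
  then show ?thesis by simp
qed

lemma (in prob_space) mean_square_tail_lower:
  assumes Z: "has_mean_square_sum M W Z" and [measurable]: "\<And>i. W i \<in> borel_measurable M" and z: "z < z'"
    and ev: "\<forall>\<^sub>F F in finite_subsets_at_top UNIV. f F \<le> prob {\<omega> \<in> space M. z' \<le> (\<Sum>i\<in>F. W i \<omega>)}"
    and f: "(f \<longlongrightarrow> c) (finite_subsets_at_top UNIV)"
  shows "c \<le> prob {\<omega> \<in> space M. z \<le> Z \<omega>}"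
proof -
  have [measurable]: "Z \<in> borel_measurable M" using Z unfolding has_mean_square_sum_def by simp
  let ?D = "\<lambda>F. {\<omega> \<in> space M. z' - z \<le> \<bar>(\<Sum>i\<in>F. W i \<omega>) - Z \<omega>\<bar>}"
  have dev: "prob {\<omega> \<in> space M. z' \<le> (\<Sum>i\<in>F. W i \<omega>)} \<le> prob {\<omega> \<in> space M. z \<le> Z \<omega>} + prob (?D F)" for F
  proof -
    have "prob {\<omega> \<in> space M. z' \<le> (\<Sum>i\<in>F. W i \<omega>)} \<le> prob ({\<omega> \<in> space M. z \<le> Z \<omega>} \<union> ?D F)"
      by (intro finite_measure_mono) auto
    also have "\<dots> \<le> prob {\<omega> \<in> space M. z \<le> Z \<omega>} + prob (?D F)"
      by (intro measure_Un_le) measurable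
    finally show ?thesis .
  qed
  have "\<forall>\<^sub>F F in finite_subsets_at_top UNIV. f F - prob (?D F) \<le> prob {\<omega> \<in> space M. z \<le> Z \<omega>}"
    using ev
  proof eventually_elim
    case (elim F)
    then show ?case using dev[of F] by linarith
  qed
  moreover have "((\<lambda>F. f F - prob (?D F)) \<longlongrightarrow> c - 0) (finite_subsets_at_top UNIV)"
    using z by (intro tendsto_intros f mean_square_deviation[OF Z]) auto
  ultimately have "c - 0 \<le> prob {\<omega> \<in> space M. z \<le> Z \<omega>}"
    by (intro tendsto_upperbound) auto
  then show ?thesis by simp
qed

context indep_centered
begin

lemma jump_summable:
  assumes "var summable_on UNIV" "0 < u"
  shows "(\<lambda>i. prob {\<omega> \<in> space M. u \<le> W i \<omega>}) summable_on UNIV"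
proof (rule summable_on_comparison_test)
  show "(\<lambda>i. var i / u\<^sup>2) summable_on UNIV"
    using summable_on_cmult_right[OF assms(1), of "1 / u\<^sup>2"] by simp
qed (use assms in \<open>auto intro: prob_W_square\<close>)

lemma sum_jump_le:
  assumes "var summable_on UNIV" "0 < u" "finite F"
  shows "(\<Sum>i\<in>F. prob {\<omega> \<in> space M. u \<le> W i \<omega>}) \<le> jumps u"
  unfolding jumps_def using jump_summable[OF assms(1,2)] assms(3)
  by (intro finite_sum_le_infsum) auto

lemma jumps_nonneg: "0 \<le> jumps u"
  unfolding jumps_def by (intro infsum_nonneg) auto

text \<open>The bound k must hold for every finite set because it is applied to F - {j} for each j,
  whereas g is asked for eventually only: the Gaussian estimate sets in when the variance of the
  finite sum is close to 1.\<close>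

lemma tail_upper:
  assumes Z: "has_mean_square_sum M W Z" and var: "var summable_on UNIV"
    and pos: "0 < y" "0 < u" and z: "z' < z" "d \<le> z' - u" and k0: "0 \<le> k"
    and g: "\<forall>\<^sub>F F in finite_subsets_at_top UNIV. prob {\<omega> \<in> space M. z' \<le> tsum y F \<omega>} \<le> g"
    and k: "\<And>F. finite F \<Longrightarrow> prob {\<omega> \<in> space M. d \<le> tsum y F \<omega>} \<le> k"
  shows "prob {\<omega> \<in> space M. z \<le> Z \<omega>} \<le> g + k * jumps y + jumps u + (jumps y)\<^sup>2"
proof (rule mean_square_tail_upper[OF Z W_borel z(1)])
  have fin: "\<forall>\<^sub>F F :: 'i set in finite_subsets_at_top UNIV. finite F" by auto
  show "\<forall>\<^sub>F F in finite_subsets_at_top UNIV.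
      prob {\<omega> \<in> space M. z' \<le> (\<Sum>i\<in>F. W i \<omega>)} \<le> g + k * jumps y + jumps u + (jumps y)\<^sup>2"
    using g fin
  proof eventually_elim
    case (elim F)
    then have F: "finite F" by simp
    have "(\<Sum>j\<in>F. prob {\<omega> \<in> space M. y \<le> W j \<omega>} * prob {\<omega> \<in> space M. d \<le> tsum y (F - {j}) \<omega>}) \<le>
        (\<Sum>j\<in>F. prob {\<omega> \<in> space M. y \<le> W j \<omega>} * k)"
      using F by (intro sum_mono mult_left_mono k) auto
    also have "\<dots> = k * (\<Sum>j\<in>F. prob {\<omega> \<in> space M. y \<le> W j \<omega>})"
      by (simp add: sum_distrib_left mult.commute)
    also have "\<dots> \<le> k * jumps y" using k0 sum_jump_le[OF var pos(1) F] by (intro mult_left_mono)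
    finally have "(\<Sum>j\<in>F. prob {\<omega> \<in> space M. y \<le> W j \<omega>} * prob {\<omega> \<in> space M. d \<le> tsum y (F - {j}) \<omega>}) \<le> k * jumps y" .
    moreover have "(\<Sum>j\<in>F. prob {\<omega> \<in> space M. y \<le> W j \<omega>})\<^sup>2 \<le> (jumps y)\<^sup>2"
      using sum_jump_le[OF var pos(1) F] by (intro power_mono sum_nonneg) auto
    ultimately show ?case
      using tail_upper_finite[OF F z(2), of y] sum_jump_le[OF var pos(2) F] elim by linarith
  qed
qed

text \<open>The lower bound for a finite set contains its own variance and its own jump sum. Both
  converge, so the bounds are passed to the limit together with the probabilities.\<close>

lemma tail_lower:
  assumes Z: "has_mean_square_sum M W Z" and var: "(var has_sum 1) UNIV"
    and y: "0 < y" "y < v" and z: "z < z'" "z' < v" and k0: "0 \<le> k"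
    and g: "\<forall>\<^sub>F F in finite_subsets_at_top UNIV. g \<le> prob {\<omega> \<in> space M. z' \<le> tsum y F \<omega>}"
    and k: "\<And>F. finite F \<Longrightarrow> prob {\<omega> \<in> space M. z' \<le> tsum y F \<omega>} \<le> k"
  shows "g - k * jumps y + (1 - 1 / (v - z')\<^sup>2) * jumps v - (jumps v)\<^sup>2 \<le> prob {\<omega> \<in> space M. z \<le> Z \<omega>}"
proof -
  have sm: "var summable_on UNIV" using var by (auto simp: summable_on_def)
  have v: "0 < v" using y by simp
  have fin: "\<forall>\<^sub>F F :: 'i set in finite_subsets_at_top UNIV. finite F" by auto
  let ?P = "\<lambda>F. \<Sum>j\<in>F. prob {\<omega> \<in> space M. v \<le> W j \<omega>}"
  let ?f = "\<lambda>F. g - k * jumps y + ?P F * (1 - sum var F / (v - z')\<^sup>2) - (?P F)\<^sup>2"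
  have ev: "\<forall>\<^sub>F F in finite_subsets_at_top UNIV. ?f F \<le> prob {\<omega> \<in> space M. z' \<le> (\<Sum>i\<in>F. W i \<omega>)}"
    using g fin
  proof eventually_elim
    case (elim F)
    then have F: "finite F" by simp
    have "(\<Sum>j\<in>F. prob {\<omega> \<in> space M. y \<le> W j \<omega>} * prob {\<omega> \<in> space M. z' \<le> tsum y (F - {j}) \<omega>}) \<le>
        (\<Sum>j\<in>F. prob {\<omega> \<in> space M. y \<le> W j \<omega>} * k)"
      using F by (intro sum_mono mult_left_mono k) auto
    also have "\<dots> = k * (\<Sum>j\<in>F. prob {\<omega> \<in> space M. y \<le> W j \<omega>})"
      by (simp add: sum_distrib_left mult.commute)
    also have "\<dots> \<le> k * jumps y" using k0 sum_jump_le[OF sm y(1) F] by (intro mult_left_mono)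
    finally show ?case using tail_lower_finite[OF F z(2) y(2)] elim by linarith
  qed
  have "(?f \<longlongrightarrow> g - k * jumps y + jumps v * (1 - 1 / (v - z')\<^sup>2) - (jumps v)\<^sup>2) (finite_subsets_at_top UNIV)"
    using infsum_tendsto[OF jump_summable[OF sm v]] var unfolding jumps_def has_sum_def
    by (intro tendsto_intros) (use z in auto)
  from mean_square_tail_lower[OF Z W_borel z(1) ev this] show ?thesis by (simp add: mult.commute)
qed

end

section \<open>Gaussian tails\<close>

lemma std_normal_cdf_diff_bounds:
  assumes "a \<le> b" and m: "\<And>x. a < x \<Longrightarrow> x \<le> b \<Longrightarrow> m \<le> std_normal_density x \<and> std_normal_density x \<le> K"
  shows "m * (b - a) \<le> std_normal_cdf b - std_normal_cdf a" "std_normal_cdf b - std_normal_cdf a \<le> K * (b - a)"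
proof -
  have eq: "std_normal_cdf b - std_normal_cdf a = (LINT x|lborel. std_normal_density x * indicator {a<..b} x)"
  proof (cases "a = b")
    case False
    have "std_normal_cdf b - std_normal_cdf a = measure std_normal_distribution {a<..b}"
      using False assms(1) finite_borel_measure.cdf_diff_eq[OF real_distribution.finite_borel_measure_M[OF real_dist_normal_dist], of a b]
      by simp
    also have "\<dots> = (LINT x|std_normal_distribution. indicator {a<..b} x)" by simp
    also have "\<dots> = (LINT x|lborel. std_normal_density x * indicator {a<..b} x)"
      by (subst integral_density) auto
    finally show ?thesis .
  qed simp
  have int: "integrable lborel (\<lambda>x. std_normal_density x * indicator {a<..b} x)"
    by (rule integrable_real_mult_indicator) auto
  have ind: "(LINT x|lborel. c * indicator {a<..b} x) = c * (b - a)" "integrable lborel (\<lambda>x. c * indicator {a<..b} x)" for c :: real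
    using assms(1) by simp_all
  show "m * (b - a) \<le> std_normal_cdf b - std_normal_cdf a"
    unfolding eq ind(1)[symmetric] using int ind(2) m by (intro integral_mono) (auto simp: indicator_def)
  show "std_normal_cdf b - std_normal_cdf a \<le> K * (b - a)"
    unfolding eq ind(1)[symmetric] using int ind(2) m by (intro integral_mono) (auto simp: indicator_def)
qed

lemma std_normal_cdf_mono: "a \<le> b \<Longrightarrow> std_normal_cdf a \<le> std_normal_cdf b"
  by (rule finite_borel_measure.cdf_nondecreasing[OF real_distribution.finite_borel_measure_M[OF real_dist_normal_dist]])

lemma std_normal_cdf_nonneg: "0 \<le> std_normal_cdf x"
  by (rule finite_borel_measure.cdf_nonneg[OF real_distribution.finite_borel_measure_M[OF real_dist_normal_dist]])

lemma std_normal_cdf_le_1: "std_normal_cdf x \<le> 1"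
  by (rule real_distribution.cdf_bounded_prob[OF real_dist_normal_dist])

lemma std_normal_density_le_1: "std_normal_density x \<le> exp (- x\<^sup>2 / 2)" "std_normal_density x \<le> 1"
proof -
  have "1 \<le> sqrt (2 * pi)" using pi_gt3 by simp
  then have "std_normal_density x \<le> 1 * exp (- x\<^sup>2 / 2)"
    unfolding std_normal_density_def by (intro mult_right_mono) auto
  then show "std_normal_density x \<le> exp (- x\<^sup>2 / 2)" by simp
  also have "\<dots> \<le> 1" by simp
  finally show "std_normal_density x \<le> 1" .
qed

text \<open>The constants below are explicit so that they are visibly independent of the random variables
  to which the estimates are applied.\<close>

definition mills_c :: real where "mills_c = exp (- 3 / 2) / sqrt (2 * pi)"

lemma mills_c_pos: "0 < mills_c"
  by (simp add: mills_c_def)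

text \<open>The density is integrated over the interval from x to x + 1/x only. There the square is
  at most x^2 + 3, so the density has dropped by a factor of at most exp(-3/2); this is the
  exponential in \<open>mills_c\<close>.\<close>

lemma std_normal_tail_ge:
  assumes x: "1 \<le> x"
  shows "mills_c * exp (- x\<^sup>2 / 2) / x \<le> 1 - std_normal_cdf x"
proof -
  have "mills_c * exp (- x\<^sup>2 / 2) * (x + 1 / x - x) \<le> std_normal_cdf (x + 1 / x) - std_normal_cdf x"
  proof (rule std_normal_cdf_diff_bounds(1)[where K = 1])
    fix s assume s: "x < s" "s \<le> x + 1 / x"
    have "s\<^sup>2 \<le> (x + 1 / x)\<^sup>2" using s x by (intro power_mono) auto
    also have "\<dots> = x\<^sup>2 + 2 + 1 / x\<^sup>2" using x by (simp add: power2_eq_square field_simps)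
    also have "\<dots> \<le> x\<^sup>2 + 3" using x by simp
    finally have "- 3 / 2 + - x\<^sup>2 / 2 \<le> - s\<^sup>2 / 2" by simp
    then have "exp (- 3 / 2) * exp (- x\<^sup>2 / 2) \<le> exp (- s\<^sup>2 / 2)"
      unfolding exp_add[symmetric] by (simp only: exp_le_cancel_iff)
    then have "exp (- 3 / 2) * exp (- x\<^sup>2 / 2) / sqrt (2 * pi) \<le> exp (- s\<^sup>2 / 2) / sqrt (2 * pi)"
      by (intro divide_right_mono) auto
    then show "mills_c * exp (- x\<^sup>2 / 2) \<le> std_normal_density s \<and> std_normal_density s \<le> 1"
      using std_normal_density_le_1 by (simp add: mills_c_def std_normal_density_def)
  qed (use x in auto)
  also have "\<dots> \<le> 1 - std_normal_cdf x" using std_normal_cdf_le_1[of "x + 1 / x"] by simp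
  finally show ?thesis using x by simp
qed

lemma std_normal_tail_pos: "0 < 1 - std_normal_cdf x"
proof -
  have "0 < mills_c * exp (- (max x 1)\<^sup>2 / 2) / max x 1" using mills_c_pos by simp
  also have "\<dots> \<le> 1 - std_normal_cdf (max x 1)" by (rule std_normal_tail_ge) simp
  also have "\<dots> \<le> 1 - std_normal_cdf x" using std_normal_cdf_mono[of x "max x 1"] by simp
  finally show ?thesis .
qed

lemma std_normal_tail_le:
  assumes "0 \<le> x"
  shows "1 - std_normal_cdf x \<le> exp (- x\<^sup>2 / 2)"
proof -
  have "std_normal.prob {\<omega> \<in> space std_normal_distribution. x \<le> \<omega>} \<le>
      exp (- x * x) * std_normal.expectation (\<lambda>\<omega>. exp (x * \<omega>))"
    using std_normal_exp[of x] assms by (intro std_normal.prob_le_exp) auto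
  moreover have "{\<omega> \<in> space std_normal_distribution. x \<le> \<omega>} = {x..}" by auto
  moreover have "exp (- x * x) * exp (x\<^sup>2 / 2) = exp (- x\<^sup>2 / 2)"
    by (simp add: power2_eq_square flip: exp_add)
  ultimately show ?thesis by (simp add: std_normal_exp std_normal_tail_eq)
qed

text \<open>The first summand serves arguments up to 1, where the tail is bounded below by its value
  at 1, the second serves larger ones through the lower Mills bound.\<close>

definition shift_c :: real where
  "shift_c = 2 / (1 - std_normal_cdf 1) + 2 * exp 1 / mills_c"

lemma shift_c_pos: "0 < shift_c"
  unfolding shift_c_def using std_normal_tail_pos[of 1] mills_c_pos by (intro add_pos_pos divide_pos_pos) auto

text \<open>Moving x by w changes the exponent by about w * x \<le> 1, so the density in the window
  is at most e times exp(-x^2/2). The tail has the further factor 1/x, and w * x * x = \<tau> then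
  makes the change small relative to it.\<close>

lemma std_normal_cdf_shift:
  assumes tau: "0 \<le> \<tau>" "\<tau> \<le> 1" and w: "w = \<tau> / (max x 1)\<^sup>2"
  shows "std_normal_cdf (x + w) - std_normal_cdf (x - w) \<le> shift_c * \<tau> * (1 - std_normal_cdf x)"
proof -
  have w0: "0 \<le> w" "w \<le> \<tau>" using tau by (auto simp: w divide_le_eq mult_le_cancel_left1 not_less)
  have q: "0 < 1 - std_normal_cdf x" "0 < 1 - std_normal_cdf 1" by (rule std_normal_tail_pos)+
  have parts: "0 \<le> 2 / (1 - std_normal_cdf 1)" "0 \<le> 2 * exp 1 / mills_c"
    using q mills_c_pos by auto
  show ?thesis
  proof (cases "x \<le> 1")
    case True
    have "std_normal_cdf (x + w) - std_normal_cdf (x - w) \<le> 1 * (x + w - (x - w))"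
      using w0 std_normal_density_le_1 by (intro std_normal_cdf_diff_bounds(2)[where m = 0]) auto
    also have "\<dots> \<le> 2 / (1 - std_normal_cdf 1) * \<tau> * (1 - std_normal_cdf 1)" using w0 q by simp
    also have "\<dots> \<le> 2 / (1 - std_normal_cdf 1) * \<tau> * (1 - std_normal_cdf x)"
      using std_normal_cdf_mono[OF True] tau q by (intro mult_left_mono) auto
    also have "\<dots> \<le> shift_c * \<tau> * (1 - std_normal_cdf x)"
      unfolding shift_c_def using parts tau q by (intro mult_right_mono) auto
    finally show ?thesis .
  next
    case False
    then have x: "1 \<le> x" "max x 1 = x" by auto
    have wx: "w * x \<le> 1" "w * x * x = \<tau>"
      using x tau unfolding w x(2) by (auto simp: power2_eq_square divide_simps)
    have "std_normal_cdf (x + w) - std_normal_cdf (x - w) \<le> exp 1 * exp (- x\<^sup>2 / 2) * (x + w - (x - w))"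
    proof (rule std_normal_cdf_diff_bounds(2)[where m = 0])
      fix s assume s: "x - w < s"
      have "(x - w)\<^sup>2 \<le> s\<^sup>2" using s w0 tau x by (intro power_mono) auto
      moreover have "x\<^sup>2 - 2 * (w * x) \<le> (x - w)\<^sup>2" by (simp add: power2_eq_square algebra_simps)
      ultimately have "- s\<^sup>2 / 2 \<le> 1 + - x\<^sup>2 / 2" using wx by linarith
      then have "exp (- s\<^sup>2 / 2) \<le> exp 1 * exp (- x\<^sup>2 / 2)"
        unfolding exp_add[symmetric] by (simp only: exp_le_cancel_iff)
      then show "0 \<le> std_normal_density s \<and> std_normal_density s \<le> exp 1 * exp (- x\<^sup>2 / 2)"
        using std_normal_density_le_1[of s] by auto
    qed (use w0 in auto)
    also have "\<dots> = 2 * exp 1 / mills_c * (w * x) * (mills_c * exp (- x\<^sup>2 / 2) / x)"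
      using x mills_c_pos by (simp add: field_simps)
    also have "\<dots> \<le> 2 * exp 1 / mills_c * \<tau> * (1 - std_normal_cdf x)"
    proof (intro mult_mono std_normal_tail_ge x(1) mult_left_mono)
      show "w * x \<le> \<tau>" using wx(2) x w0 mult_left_mono[of 1 x "w * x"] by simp
    qed (use parts tau x w0 mills_c_pos in auto)
    also have "\<dots> \<le> shift_c * \<tau> * (1 - std_normal_cdf x)"
      unfolding shift_c_def using parts tau q by (intro mult_right_mono) auto
    finally show ?thesis .
  qed
qed

definition tilt_c :: "real \<Rightarrow> real" where
  "tilt_c L = exp (L + 4) / (1 - std_normal_cdf 1) + exp 3 / mills_c"

lemma tilt_c_nonneg: "0 \<le> tilt_c L"
  unfolding tilt_c_def using std_normal_tail_pos[of 1] mills_c_pos by (intro add_nonneg_nonneg) auto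

text \<open>With l = x the exponent is -x^2/2, and passing to the Gaussian tail costs the factor l
  of the Mills ratio. For x \<le> 1 the choice l = 1 leaves a constant that depends on how far x may
  lie to the left.\<close>

lemma exp_tilt_le:
  assumes x: "- L \<le> x" and l: "l = max x 1" and s: "s \<le> 3"
  shows "exp (l\<^sup>2 / 2 - l * x + s) \<le> tilt_c L * l * (1 - std_normal_cdf x)"
proof -
  have q: "0 < 1 - std_normal_cdf x" "0 < 1 - std_normal_cdf 1" by (rule std_normal_tail_pos)+
  show ?thesis
  proof (cases "x \<le> 1")
    case True
    then have l1: "l = 1" using l by simp
    have "exp (l\<^sup>2 / 2 - l * x + s) \<le> exp (L + 4)" using x s by (simp add: l1)
    also have "\<dots> = exp (L + 4) / (1 - std_normal_cdf 1) * l * (1 - std_normal_cdf 1)" using q by (simp add: l1)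
    also have "\<dots> \<le> exp (L + 4) / (1 - std_normal_cdf 1) * l * (1 - std_normal_cdf x)"
      using std_normal_cdf_mono[OF True] q by (intro mult_left_mono) (auto simp: l1)
    also have "\<dots> \<le> tilt_c L * l * (1 - std_normal_cdf x)"
      unfolding tilt_c_def using q mills_c_pos by (intro mult_right_mono) (auto simp: l1)
    finally show ?thesis .
  next
    case False
    then have l1: "l = x" "1 \<le> x" using l by auto
    have "exp (l\<^sup>2 / 2 - l * x + s) \<le> exp (3 + - x\<^sup>2 / 2)" using s by (simp add: l1 power2_eq_square)
    also have "\<dots> = exp 3 / mills_c * l * (mills_c * exp (- x\<^sup>2 / 2) / x)"
      using l1 mills_c_pos unfolding exp_add by simp
    also have "\<dots> \<le> exp 3 / mills_c * l * (1 - std_normal_cdf x)"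
      using l1 mills_c_pos by (intro mult_left_mono std_normal_tail_ge) auto
    also have "\<dots> \<le> tilt_c L * l * (1 - std_normal_cdf x)"
      unfolding tilt_c_def using q l1 by (intro mult_right_mono) auto
    finally show ?thesis .
  qed
qed

context indep_centered
begin

text \<open>The width w is of order \<tau> / l^2, the scale on which a shift changes the tail by
  relative order \<tau>. The ninth power of l is made of l^6 from w^(-3), l^2 from the replacement
  and l from the Mills ratio.\<close>

lemma gauss_tsum_eventually:
  assumes var: "(var has_sum 1) UNIV" and p: "2 \<le> p" "p \<le> 3"
    and int: "\<And>i. integrable M (\<lambda>\<omega>. \<bar>W i \<omega>\<bar> powr p)"
    and R: "\<And>F. finite F \<Longrightarrow> (\<Sum>i\<in>F. absm p i + sqrt (var i) powr p) \<le> R"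
    and x: "- L \<le> x" and l: "l = max x 1" and lv: "\<And>i. l * sqrt (var i) \<le> 1" and lR: "l ^ 3 * R \<le> 1"
    and tau: "0 < \<tau>" "\<tau> \<le> 1" and w: "w = \<tau> / (8 * l\<^sup>2)"
  defines "G \<equiv> shift_c * \<tau> + 48 * exp 3 * 8 ^ 3 / \<tau> ^ 3 * tilt_c L * l ^ 9 * R"
  shows "\<forall>\<^sub>F F in finite_subsets_at_top UNIV. prob {\<omega> \<in> space M. x - w \<le> tsum (1 / l) F \<omega>} \<le> (1 + G) * (1 - std_normal_cdf x)"
    and "\<forall>\<^sub>F F in finite_subsets_at_top UNIV. (1 - G) * (1 - std_normal_cdf x) \<le> prob {\<omega> \<in> space M. x + w \<le> tsum (1 / l) F \<omega>}"
proof -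
  let ?Q = "1 - std_normal_cdf x" and ?P = "\<lambda>z F. prob {\<omega> \<in> space M. z \<le> tsum (1 / l) F \<omega>}"
  have l1: "1 \<le> l" "x \<le> l" using l by auto
  have w0: "0 < w" "w \<le> 1" "8 * w = \<tau> / l\<^sup>2" "l * w \<le> 1 / 8"
  proof -
    show "0 < w" "8 * w = \<tau> / l\<^sup>2" using tau l1 by (auto simp: w)
    have "l * w = \<tau> / (8 * l)" using l1 by (simp add: w power2_eq_square)
    also have "\<dots> \<le> 1 / 8" using tau l1 by (simp add: divide_simps)
    finally show "l * w \<le> 1 / 8" .
    moreover have "1 * w \<le> l * w" using l1 \<open>0 < w\<close> by (intro mult_right_mono) auto
    ultimately show "w \<le> 1" by simp
  qed
  have R0: "0 \<le> R" using R[of "{}"] by simp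
  have Q: "0 < ?Q" by (rule std_normal_tail_pos)
  have lim: "(sum var \<longlongrightarrow> 1) (finite_subsets_at_top UNIV)" using var by (simp add: has_sum_def)
  have Vle: "sum var F \<le> 1" if "finite F" for F
    using finite_sum_le_has_sum[OF var that] var_nonneg by auto
  have absR: "l powr p * sum (absm p) F \<le> 1" if "finite F" for F
  proof -
    have "sum (absm p) F \<le> (\<Sum>i\<in>F. absm p i + sqrt (var i) powr p)" by (intro sum_mono) simp
    then have "sum (absm p) F \<le> R" using R[OF that] by simp
    moreover have "l powr p \<le> l powr 3" using l1 p by (intro powr_mono) auto
    moreover have "0 \<le> sum (absm p) F" by (intro sum_nonneg absm_nonneg)
    ultimately have "l powr p * sum (absm p) F \<le> l powr 3 * R" by (intro mult_mono) auto
    also have "\<dots> = l ^ 3 * R" using l1 by (simp add: powr_realpow)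
    finally show ?thesis using lR by simp
  qed
  have fin: "\<forall>\<^sub>F F :: 'i set in finite_subsets_at_top UNIV. finite F" by auto
  have pos: "\<forall>\<^sub>F F in finite_subsets_at_top UNIV. 0 < sum var F"
    by (rule order_tendstoD(1)[OF lim]) simp
  have sq: "((\<lambda>F. c / sqrt (sum var F)) \<longlongrightarrow> c / sqrt 1) (finite_subsets_at_top UNIV)" for c
    by (intro tendsto_intros lim) simp
  have err: "48 * exp 3 / w ^ 3 * l\<^sup>2 * exp (l\<^sup>2 / 2 - l * x + s) * r \<le>
      48 * exp 3 * 8 ^ 3 / \<tau> ^ 3 * tilt_c L * l ^ 9 * R * ?Q" if s: "s \<le> 3" "0 \<le> r" "r \<le> R" for s r
  proof -
    have "48 * exp 3 / w ^ 3 * l\<^sup>2 * exp (l\<^sup>2 / 2 - l * x + s) * r \<le>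
        48 * exp 3 / w ^ 3 * l\<^sup>2 * (tilt_c L * l * ?Q) * R"
      using w0 s tilt_c_nonneg l1 Q
      by (intro mult_mono mult_left_mono exp_tilt_le[OF x l s(1)]) auto
    also have "\<dots> = 48 * exp 3 * 8 ^ 3 / \<tau> ^ 3 * tilt_c L * l ^ 9 * R * ?Q"
    proof -
      have "1 / w ^ 3 = 8 ^ 3 / \<tau> ^ 3 * l ^ 6"
        using tau l1 by (simp add: w power_divide power_mult_distrib flip: power_mult)
      then have "48 * exp 3 / w ^ 3 = 48 * exp 3 * (8 ^ 3 / \<tau> ^ 3 * l ^ 6)"
        by (metis times_divide_eq_right mult.right_neutral)
      moreover have "l ^ 6 * l\<^sup>2 * l = l ^ 9" by (simp add: power_add[symmetric] flip: power_Suc2)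
      ultimately show ?thesis by (simp add: mult_ac)
    qed
    finally show ?thesis .
  qed
  have r0: "0 \<le> (\<Sum>i\<in>F. absm p i + sqrt (var i) powr p)" for F
    using absm_nonneg by (intro sum_nonneg add_nonneg_nonneg) auto
  \<comment> \<open>Of the 8 * w at disposal, one w is slack for the mean-square limit, three are
    the width of the step, and a fifth covers the division by the standard deviation of the finite
    sum, which tends to 1.\<close>
  have shift: "std_normal_cdf (x + 8 * w) - std_normal_cdf (x - 8 * w) \<le> shift_c * \<tau> * ?Q"
    using tau w0(3) l by (intro std_normal_cdf_shift) auto
  have mono: "std_normal_cdf (x - 8 * w) \<le> std_normal_cdf (x - 5 * w)"
    "std_normal_cdf (x + 5 * w) \<le> std_normal_cdf (x + 8 * w)"
    "std_normal_cdf (x - 8 * w) \<le> std_normal_cdf x" "std_normal_cdf x \<le> std_normal_cdf (x + 8 * w)"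
    using w0 by (intro std_normal_cdf_mono; simp)+
  have "\<forall>\<^sub>F F in finite_subsets_at_top UNIV. x - 5 * w < (x - w - 3 * w) / sqrt (sum var F)"
    using w0 by (intro order_tendstoD(1)[OF sq]) simp
  then show "\<forall>\<^sub>F F in finite_subsets_at_top UNIV. ?P (x - w) F \<le> (1 + G) * ?Q"
    using fin pos
  proof eventually_elim
    case (elim F)
    let ?r = "\<Sum>i\<in>F. absm p i + sqrt (var i) powr p"
    have "?P (x - w) F \<le> 1 - std_normal_cdf ((x - w - 3 * w) / sqrt (sum var F))
      + 48 * exp 3 / w ^ 3 * l\<^sup>2 * exp (l\<^sup>2 / 2 - l * (x - w) + 3 * l * w) * ?r"
      using elim by (intro gauss_tsum(1) p l1 w0 int lv Vle absR)
    also have "l\<^sup>2 / 2 - l * (x - w) + 3 * l * w = l\<^sup>2 / 2 - l * x + 4 * (l * w)" by (simp add: algebra_simps)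
    also have "48 * exp 3 / w ^ 3 * l\<^sup>2 * exp (l\<^sup>2 / 2 - l * x + 4 * (l * w)) * ?r \<le>
        48 * exp 3 * 8 ^ 3 / \<tau> ^ 3 * tilt_c L * l ^ 9 * R * ?Q"
      using w0 elim by (intro err r0 R) auto
    also have "1 - std_normal_cdf ((x - w - 3 * w) / sqrt (sum var F)) \<le> 1 - std_normal_cdf (x - 5 * w)"
      using elim by (simp add: std_normal_cdf_mono)
    also have "\<dots> \<le> ?Q + shift_c * \<tau> * ?Q" using shift mono by linarith
    finally show ?case by (simp add: G_def algebra_simps)
  qed
  have "\<forall>\<^sub>F F in finite_subsets_at_top UNIV. (x + w + 3 * w) / sqrt (sum var F) < x + 5 * w"
    using w0 by (intro order_tendstoD(2)[OF sq]) simp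
  then show "\<forall>\<^sub>F F in finite_subsets_at_top UNIV. (1 - G) * ?Q \<le> ?P (x + w) F"
    using fin pos
  proof eventually_elim
    case (elim F)
    let ?r = "\<Sum>i\<in>F. absm p i + sqrt (var i) powr p"
    have "1 - std_normal_cdf ((x + w + 3 * w) / sqrt (sum var F))
      - 48 * exp 3 / w ^ 3 * l\<^sup>2 * exp (l\<^sup>2 / 2 - l * (x + w)) * ?r \<le> ?P (x + w) F"
      using elim by (intro gauss_tsum(2) p l1 w0 int lv Vle absR)
    moreover have "l\<^sup>2 / 2 - l * (x + w) = l\<^sup>2 / 2 - l * x + - (l * w)" by (simp add: algebra_simps)
    moreover have "48 * exp 3 / w ^ 3 * l\<^sup>2 * exp (l\<^sup>2 / 2 - l * x + - (l * w)) * ?r \<le>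
        48 * exp 3 * 8 ^ 3 / \<tau> ^ 3 * tilt_c L * l ^ 9 * R * ?Q"
      using w0 l1 elim by (intro err r0 R) (auto intro: order_trans[of _ 0])
    moreover have "1 - std_normal_cdf (x + 5 * w) \<le> 1 - std_normal_cdf ((x + w + 3 * w) / sqrt (sum var F))"
      using elim by (simp add: std_normal_cdf_mono)
    moreover have "?Q - shift_c * \<tau> * ?Q \<le> 1 - std_normal_cdf (x + 5 * w)" using shift mono by linarith
    ultimately have "?Q - shift_c * \<tau> * ?Q - 48 * exp 3 * 8 ^ 3 / \<tau> ^ 3 * tilt_c L * l ^ 9 * R * ?Q \<le> ?P (x + w) F"
      by simp
    then show ?case by (simp add: G_def algebra_simps)
  qed
qed

end

section \<open>Regularly varying tails and Lyapunov quotients\<close>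

text \<open>Regular variation of index -t for a monotone positive function. The slowly varying
  factor is hidden in the ratio limit, and the notion is stable under rescaling of the
  argument.\<close>

definition regvar :: "real \<Rightarrow> (real \<Rightarrow> real) \<Rightarrow> bool" where
  "regvar t f \<longleftrightarrow> antimono f \<and> (\<forall>u. 0 < f u) \<and> (\<forall>l>0. ((\<lambda>u. f (l * u) / f u) \<longlongrightarrow> l powr (- t)) at_top)"

lemma regvar_pos: "regvar t f \<Longrightarrow> 0 < f u"
  by (simp add: regvar_def)

lemma regvar_antimono: "regvar t f \<Longrightarrow> u \<le> v \<Longrightarrow> f v \<le> f u"
  by (auto simp: regvar_def antimono_def)

section \<open>Power bounds for regularly varying tails\<close>

lemma eventually_at_top_pos:
  assumes "\<forall>\<^sub>F u in at_top. P (u::real)"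
  obtains u0 where "1 \<le> u0" "\<And>u. u0 \<le> u \<Longrightarrow> P u"
proof -
  obtain N where N: "\<And>u. N \<le> u \<Longrightarrow> P u" using assms unfolding eventually_at_top_linorder by blast
  show thesis by (rule that[of "max N 1"]) (use N in auto)
qed

lemma dyadic_ivl:
  fixes v :: real
  assumes "1 \<le> v"
  obtains k :: nat where "2 ^ k \<le> v" "v < 2 ^ Suc k"
proof -
  define k where "k = nat \<lfloor>log 2 v\<rfloor>"
  have k: "real k = of_int \<lfloor>log 2 v\<rfloor>" using assms by (simp add: k_def)
  have "(2::real) powr real k \<le> 2 powr (log 2 v)" "2 powr (log 2 v) < 2 powr (real k + 1)"
    using k by (auto intro!: powr_mono powr_less_mono)
  then have "2 powr real k \<le> v" "v < 2 powr (real (Suc k))"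
    using assms by (auto simp: add.commute)
  then show thesis by (intro that[of k]) (simp_all add: powr_realpow del: power_Suc of_nat_Suc)
qed

text \<open>A Potter bound by doubling: beyond u0 each doubling of the argument costs at most 2 powr
  q, and monotonicity fills the gap between consecutive powers of 2, at the price of one more
  doubling.\<close>

lemma regvar_potter:
  assumes f: "regvar t f" and q: "t < q" "0 < q"
  obtains C u0 where "1 \<le> C" "1 \<le> u0" "\<And>u v. u0 \<le> u \<Longrightarrow> 1 \<le> v \<Longrightarrow> f u \<le> C * v powr q * f (v * u)"
proof -
  have "((\<lambda>u. f (2 * u) / f u) \<longlongrightarrow> 2 powr (- t)) at_top" using f by (simp add: regvar_def)
  then have "\<forall>\<^sub>F u in at_top. 2 powr (- q) < f (2 * u) / f u"
    by (rule order_tendstoD(1)) (use q in \<open>simp add: powr_less_mono\<close>)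
  then obtain u0 where u0: "1 \<le> u0" and *: "\<And>u. u0 \<le> u \<Longrightarrow> 2 powr (- q) < f (2 * u) / f u"
    by (rule eventually_at_top_pos) blast
  have step: "f u \<le> 2 powr q * f (2 * u)" if "u0 \<le> u" for u
    using *[OF that] regvar_pos[OF f, of u] by (simp add: powr_minus field_simps)
  have dyadic: "f u \<le> (2 ^ k) powr q * f (2 ^ k * u)" if "u0 \<le> u" for u k
  proof (induction k)
    case (Suc k)
    have "u0 \<le> 2 ^ k * u" using that u0 mult_mono[of 1 "2 ^ k" u0 u] by simp
    from step[OF this] have "(2 ^ k) powr q * f (2 ^ k * u) \<le> (2 ^ k) powr q * (2 powr q * f (2 * (2 ^ k * u)))"
      by (intro mult_left_mono) auto
    also have "\<dots> = (2 ^ Suc k) powr q * f (2 ^ Suc k * u)" by (simp add: powr_mult mult_ac)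
    finally show ?case using Suc by linarith
  qed simp
  show thesis
  proof (rule that[of "2 powr q" u0])
    fix u v :: real assume u: "u0 \<le> u" and v: "1 \<le> v"
    obtain k where k: "2 ^ k \<le> v" "v < 2 ^ Suc k" using dyadic_ivl[OF v] .
    have "f u \<le> (2 ^ Suc k) powr q * f (2 ^ Suc k * u)" by (rule dyadic[OF u])
    also have "\<dots> \<le> (2 * v) powr q * f (v * u)"
      using k q u0 u v regvar_pos[OF f] by (intro mult_mono powr_mono2 regvar_antimono[OF f] mult_right_mono less_imp_le[OF regvar_pos[OF f]]) auto
    finally show "f u \<le> 2 powr q * v powr q * f (v * u)" using v by (simp add: powr_mult)
  qed (use q u0 in \<open>auto intro: ge_one_powr_ge_zero\<close>)
qed

lemma regvar_lower:
  assumes f: "regvar t f" and q: "t < q" "0 < q"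
  obtains c u0 where "0 < c" "1 \<le> u0" "\<And>u. u0 \<le> u \<Longrightarrow> c * u powr (- q) \<le> f u"
proof -
  obtain C u0 where C: "1 \<le> C" "1 \<le> u0" and *: "\<And>u v. u0 \<le> u \<Longrightarrow> 1 \<le> v \<Longrightarrow> f u \<le> C * v powr q * f (v * u)"
    using regvar_potter[OF f q] by metis
  show thesis
  proof (rule that[of "f u0 * u0 powr q / C" u0])
    fix u assume u: "u0 \<le> u"
    have "f u0 \<le> C * (u / u0) powr q * f (u / u0 * u0)" using u C by (intro *) auto
    then have "f u0 \<le> C * u powr q / u0 powr q * f u" using u C by (simp add: powr_divide)
    then show "f u0 * u0 powr q / C * u powr (- q) \<le> f u"
      using u C by (simp add: powr_minus field_simps)
  qed (use C regvar_pos[OF f] in auto)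
qed

text \<open>The doubling argument in the other direction: for q < t each doubling gains at least 2
  powr q, starting from the fixed point u0, and monotonicity covers the arguments in
  between.\<close>

lemma regvar_upper:
  assumes f: "regvar t f" and q: "q < t" "0 < q"
  obtains C u0 where "0 < C" "1 \<le> u0" "\<And>u. u0 \<le> u \<Longrightarrow> f u \<le> C * u powr (- q)"
proof -
  have "((\<lambda>u. f (2 * u) / f u) \<longlongrightarrow> 2 powr (- t)) at_top" using f by (simp add: regvar_def)
  then have "\<forall>\<^sub>F u in at_top. f (2 * u) / f u < 2 powr (- q)"
    by (rule order_tendstoD(2)) (use q in \<open>simp add: powr_less_mono\<close>)
  then obtain u0 where u0: "1 \<le> u0" and *: "\<And>u. u0 \<le> u \<Longrightarrow> f (2 * u) / f u < 2 powr (- q)"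
    by (rule eventually_at_top_pos) blast
  have step: "2 powr q * f (2 * u) \<le> f u" if "u0 \<le> u" for u
    using *[OF that] regvar_pos[OF f, of u] by (simp add: powr_minus field_simps)
  have dyadic: "(2 ^ k) powr q * f (2 ^ k * u0) \<le> f u0" for k
  proof (induction k)
    case (Suc k)
    have "u0 \<le> 2 ^ k * u0" using u0 mult_mono[of 1 "2 ^ k" u0 u0] by simp
    from step[OF this] have "(2 ^ k) powr q * (2 powr q * f (2 * (2 ^ k * u0))) \<le> (2 ^ k) powr q * f (2 ^ k * u0)"
      by (intro mult_left_mono) auto
    moreover have "(2 ^ k) powr q * (2 powr q * f (2 * (2 ^ k * u0))) = (2 ^ Suc k) powr q * f (2 ^ Suc k * u0)"
      by (simp add: powr_mult mult_ac)
    ultimately show ?case using Suc by linarith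
  qed simp
  show thesis
  proof (rule that[of "(2 * u0) powr q * f u0" u0])
    fix u assume u: "u0 \<le> u"
    then have "1 \<le> u / u0" using u0 by simp
    then obtain k where k: "2 ^ k \<le> u / u0" "u / u0 < 2 ^ Suc k" using dyadic_ivl by blast
    have "u powr q * f u \<le> ((2 * u0) * 2 ^ k) powr q * f (2 ^ k * u0)"
      using k q u0 u regvar_pos[OF f]
      by (intro mult_mono powr_mono2 regvar_antimono[OF f] less_imp_le[OF regvar_pos[OF f]]) (auto simp: field_simps)
    also have "\<dots> = (2 * u0) powr q * ((2 ^ k) powr q * f (2 ^ k * u0))"
      using u0 by (simp add: powr_mult mult_ac)
    also have "\<dots> \<le> (2 * u0) powr q * f u0" by (intro mult_left_mono dyadic) auto
    finally show "f u \<le> (2 * u0) powr q * f u0 * u powr (- q)"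
      using u u0 by (simp add: powr_minus field_simps)
  qed (use u0 regvar_pos[OF f] in auto)
qed

text \<open>First d is chosen by continuity of the limits (1 - d) powr (- t) and (1 + d) powr (- t)
  at d = 0, and only then u0 by convergence of the ratios.\<close>

lemma regvar_near_one:
  assumes f: "regvar t f" and e: "0 < e"
  obtains d u0 where "0 < d" "d \<le> 1 / 2" "1 \<le> u0"
    "\<And>u. u0 \<le> u \<Longrightarrow> f ((1 - d) * u) \<le> (1 + e) * f u \<and> (1 - e) * f u \<le> f ((1 + d) * u)"
proof -
  have "((\<lambda>d. (1 - d) powr (- t)) \<longlongrightarrow> (1 - 0) powr (- t)) (at_right (0::real))"
    "((\<lambda>d. (1 + d) powr (- t)) \<longlongrightarrow> (1 + 0) powr (- t)) (at_right (0::real))"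
    by (intro tendsto_intros; simp)+
  then have "\<forall>\<^sub>F d in at_right (0::real). (1 - d) powr (- t) < 1 + e \<and> 1 - e < (1 + d) powr (- t) \<and> 0 < d \<and> d \<le> 1 / 2"
    using e by (intro eventually_conj order_tendstoD eventually_at_right_less)
      (auto simp: eventually_at_right_field intro!: exI[of _ "1 / 2"])
  then obtain d :: real where d: "(1 - d) powr (- t) < 1 + e" "1 - e < (1 + d) powr (- t)" "0 < d" "d \<le> 1 / 2"
    using eventually_happens[of _ "at_right (0::real)"] by force
  have "\<forall>\<^sub>F u in at_top. f ((1 - d) * u) / f u < 1 + e"
    using f d by (intro order_tendstoD(2)[OF _ d(1)]) (auto simp: regvar_def)
  moreover have "\<forall>\<^sub>F u in at_top. 1 - e < f ((1 + d) * u) / f u"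
    using f d by (intro order_tendstoD(1)[OF _ d(2)]) (auto simp: regvar_def)
  ultimately have "\<forall>\<^sub>F u in at_top. f ((1 - d) * u) \<le> (1 + e) * f u \<and> (1 - e) * f u \<le> f ((1 + d) * u)"
  proof eventually_elim
    case (elim u)
    then have "f ((1 - d) * u) < (1 + e) * f u" "(1 - e) * f u < f ((1 + d) * u)"
      by (simp_all only: pos_divide_less_eq[OF regvar_pos[OF f]] pos_less_divide_eq[OF regvar_pos[OF f]])
    then show ?case by simp
  qed
  then obtain u0 where "1 \<le> u0" "\<And>u. u0 \<le> u \<Longrightarrow> f ((1 - d) * u) \<le> (1 + e) * f u \<and> (1 - e) * f u \<le> f ((1 + d) * u)"
    by (rule eventually_at_top_pos) blast
  with d show thesis using that by blast
qed

text \<open>After normalisation, \<open>lyap w s\<close> is the Lyapunov quotient \<open>U\<^sub>n\<^sub>s\<close>.\<close>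

definition lyap :: "('i \<Rightarrow> real) \<Rightarrow> real \<Rightarrow> real" where
  "lyap w s = (\<Sum>\<^sub>\<infinity>i. \<bar>w i\<bar> powr s)"

section \<open>Lyapunov quotients of square-summable weights\<close>

context
  fixes w :: "'i \<Rightarrow> real"
  assumes w: "((\<lambda>i. (w i)\<^sup>2) has_sum 1) UNIV"
begin

lemma weight_le_1: "\<bar>w i\<bar> \<le> 1"
proof -
  have "(w i)\<^sup>2 \<le> 1" using finite_sum_le_has_sum[OF w, of "{i}"] by simp
  then show ?thesis by (simp add: abs_square_le_1)
qed

lemma powr_weight_le:
  assumes "2 \<le> s"
  shows "\<bar>w i\<bar> powr s \<le> (w i)\<^sup>2"
proof -
  have "\<bar>w i\<bar> powr s \<le> \<bar>w i\<bar> powr 2" using weight_le_1[of i] assms by (intro powr_mono') auto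
  also have "\<dots> = (w i)\<^sup>2" by (cases "w i = 0") (simp_all add: powr_realpow)
  finally show ?thesis .
qed

lemma lyap_summable: "2 \<le> s \<Longrightarrow> (\<lambda>i. \<bar>w i\<bar> powr s) summable_on UNIV"
  by (rule summable_on_comparison_test[OF has_sum_imp_summable[OF w]]) (auto simp: powr_weight_le)

lemma powr_weight_le_lyap: "2 \<le> s \<Longrightarrow> \<bar>w i\<bar> powr s \<le> lyap w s"
  unfolding lyap_def using finite_sum_le_infsum[OF lyap_summable, of s "{i}"] by simp

lemma lyap_pos:
  assumes "2 \<le> s"
  shows "0 < lyap w s"
proof -
  obtain i where "w i \<noteq> 0"
  proof (rule ccontr)
    assume "\<not> thesis"
    then have "w i = 0" for i using that by blast
    then have "((\<lambda>i. (w i)\<^sup>2) has_sum 0) UNIV" by simp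
    with w show False using has_sum_unique zero_neq_one by blast
  qed
  then have "0 < \<bar>w i\<bar> powr s" by simp
  also have "\<dots> \<le> lyap w s" by (rule powr_weight_le_lyap[OF assms])
  finally show ?thesis .
qed

lemma lyap_le_1: "2 \<le> s \<Longrightarrow> lyap w s \<le> 1"
  unfolding lyap_def infsumI[OF w, symmetric]
  by (intro infsum_mono lyap_summable powr_weight_le has_sum_imp_summable[OF w])

lemma weight_le_lyap:
  assumes "2 \<le> s"
  shows "\<bar>w i\<bar> \<le> lyap w s powr (1 / s)"
proof -
  have "(\<bar>w i\<bar> powr s) powr (1 / s) \<le> lyap w s powr (1 / s)"
    using assms by (intro powr_mono2 powr_weight_le_lyap) auto
  then show ?thesis using assms by (cases "w i = 0") (simp_all add: powr_powr)
qed

text \<open>The power r - 2 of the largest weight is pulled out, and the squares that remain sum to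
  1. Unlike interpolation this compares any two exponents, in either order, at the price of a weaker
  power.\<close>

lemma lyap_le_powr:
  assumes r: "2 \<le> r" and s: "2 \<le> s"
  shows "lyap w r \<le> lyap w s powr ((r - 2) / s)"
proof -
  have "\<bar>w i\<bar> powr r \<le> lyap w s powr ((r - 2) / s) * (w i)\<^sup>2" for i
  proof (cases "w i = 0")
    case False
    have "\<bar>w i\<bar> powr r = \<bar>w i\<bar> powr (r - 2) * \<bar>w i\<bar> powr 2"
      using powr_add[of "\<bar>w i\<bar>" "r - 2" 2] by (simp only: diff_add_cancel)
    also have "\<bar>w i\<bar> powr (r - 2) \<le> (lyap w s powr (1 / s)) powr (r - 2)"
      using r by (intro powr_mono2 weight_le_lyap s) auto
    also have "\<bar>w i\<bar> powr 2 = (w i)\<^sup>2" using False by (simp add: powr_realpow)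
    finally show ?thesis by (simp add: powr_powr mult_right_mono)
  qed simp
  then have "lyap w r \<le> (\<Sum>\<^sub>\<infinity>i. lyap w s powr ((r - 2) / s) * (w i)\<^sup>2)"
    unfolding lyap_def using r
    by (intro infsum_mono lyap_summable summable_on_cmult_right has_sum_imp_summable[OF w])
  also have "\<dots> = lyap w s powr ((r - 2) / s)" using has_sum_cmult_right[OF w] by (simp add: infsumI)
  finally show ?thesis .
qed

text \<open>Young's inequality is the tangent-line form of concavity, so no Hoelder inequality for
  infinite sums is needed.\<close>

lemma lyap_interpolation:
  assumes "2 < r" "r < s"
  shows "lyap w r \<le> lyap w s powr ((r - 2) / (s - 2))"
proof -
  define th where "th = (r - 2) / (s - 2)"
  define U where "U = lyap w s"
  have th: "0 < th" "th < 1" using assms by (auto simp: th_def)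
  have U: "0 < U" unfolding U_def using assms by (intro lyap_pos) simp
  \<comment> \<open>The factor U powr (1 - th) is chosen so that after summation the two terms of
    Young's inequality become th * U and (1 - th) * U.\<close>
  have pt: "\<bar>w i\<bar> powr r * U powr (1 - th) \<le> th * \<bar>w i\<bar> powr s + (1 - th) * U * (w i)\<^sup>2" for i
  proof (cases "w i = 0")
    case False
    let ?b = "\<bar>w i\<bar>"
    have b: "0 < ?b" using False by simp
    have "(?b powr (s - 2)) powr th * U powr (1 - th) \<le> th * ?b powr (s - 2) + (1 - th) * U"
      using th U b by (intro Youngs_inequality_0) auto
    then have "?b powr 2 * ((?b powr (s - 2)) powr th * U powr (1 - th)) \<le> ?b powr 2 * (th * ?b powr (s - 2) + (1 - th) * U)"
      by (intro mult_left_mono) auto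
    moreover have "?b powr 2 * (?b powr (s - 2)) powr th = ?b powr r"
      using assms powr_add[of ?b 2 "r - 2"] by (simp only: powr_powr th_def) (simp del: powr_numeral)
    moreover have "?b powr 2 * ?b powr (s - 2) = ?b powr s"
      using powr_add[of ?b 2 "s - 2"] by (simp del: powr_numeral)
    moreover have "?b powr 2 = (w i)\<^sup>2" using b by (simp add: powr_realpow)
    ultimately show ?thesis by (simp add: algebra_simps)
  qed simp
  have "lyap w r * U powr (1 - th) = (\<Sum>\<^sub>\<infinity>i. \<bar>w i\<bar> powr r * U powr (1 - th))"
    unfolding lyap_def using assms by (intro infsum_cmult_left[symmetric] lyap_summable) auto
  also have "\<dots> \<le> (\<Sum>\<^sub>\<infinity>i. th * \<bar>w i\<bar> powr s + (1 - th) * U * (w i)\<^sup>2)"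
    using assms pt
    by (intro infsum_mono summable_on_cmult_left summable_on_add summable_on_cmult_right lyap_summable
        has_sum_imp_summable[OF w]) auto
  also have "\<dots> = th * U + (1 - th) * U * 1"
    unfolding U_def lyap_def using assms w
    by (intro infsumI has_sum_add has_sum_cmult_right has_sum_infsum lyap_summable) auto
  also have "\<dots> = U powr th * U powr (1 - th)" using U by (simp add: algebra_simps flip: powr_add)
  finally have "lyap w r \<le> U powr th" using U by (simp add: mult_le_cancel_right)
  then show ?thesis by (simp add: th_def U_def)
qed

text \<open>The interpolation inequality solved for its larger exponent. It bounds the quotient of
  order q > t from below in terms of the one of order t.\<close>

lemma lyap_interpolation_ge:
  assumes "2 < s" "s < q"
  shows "lyap w s powr ((q - 2) / (s - 2)) \<le> lyap w q"
proof -
  have q: "0 < lyap w q" using assms by (intro lyap_pos) simp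
  have "lyap w s powr ((q - 2) / (s - 2)) \<le> (lyap w q powr ((s - 2) / (q - 2))) powr ((q - 2) / (s - 2))"
    using assms lyap_pos[of s] by (intro powr_mono2 lyap_interpolation) auto
  also have "\<dots> = lyap w q" using assms q by (simp add: powr_powr)
  finally show ?thesis .
qed

end

text \<open>Positivity lets the event that a weighted variable reaches u be read as the variable
  reaching u / w i, so only the right tail occurs.\<close>

definition unit_weights :: "('i \<Rightarrow> real) \<Rightarrow> bool" where
  "unit_weights w \<longleftrightarrow> (\<forall>i. 0 < w i) \<and> ((\<lambda>i. (w i)\<^sup>2) has_sum 1) UNIV"

lemma unit_weightsD:
  assumes "unit_weights w"
  shows "0 < w i" "w i \<le> 1" "((\<lambda>i. (w i)\<^sup>2) has_sum 1) UNIV" "\<bar>w i\<bar> = w i"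
  using assms weight_le_1[of w i] by (auto simp: unit_weights_def less_imp_le)

text \<open>Weights are at most 1, so the rescaled level x / w i is never below x. One threshold on
  x thus serves all indices and all weight families.\<close>

lemma le_divide_weight:
  assumes "unit_weights w" "0 \<le> x" "u0 \<le> x"
  shows "u0 \<le> x / w i"
proof -
  have "u0 * w i \<le> x * w i" "x * w i \<le> x * 1"
    using assms unit_weightsD(1,2)[OF assms(1), of i] by (intro mult_right_mono mult_left_mono; simp)+
  then have "u0 * w i \<le> x" by linarith
  then show ?thesis using unit_weightsD(1)[OF assms(1), of i] by (simp add: pos_le_divide_eq)
qed

section \<open>Sums of tails over the weights\<close>

definition jsum :: "(real \<Rightarrow> real) \<Rightarrow> ('i \<Rightarrow> real) \<Rightarrow> real \<Rightarrow> real" where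
  "jsum f w u = (\<Sum>\<^sub>\<infinity>i. f (u / w i))"

lemma powr_small:
  fixes a c :: real
  assumes "0 < a" "0 < e"
  obtains U0 where "0 < U0" "U0 < 1" "\<And>U. 0 < U \<Longrightarrow> U \<le> U0 \<Longrightarrow> c * U powr a \<le> e"
proof -
  have "((\<lambda>U. c * U powr a) \<longlongrightarrow> 0) (at_right 0)" using assms by real_asymp
  then have "\<forall>\<^sub>F U in at_right 0. c * U powr a < e" using assms by (intro order_tendstoD(2))
  then obtain b where b: "0 < b" "\<And>U. 0 < U \<Longrightarrow> U < b \<Longrightarrow> c * U powr a < e"
    unfolding eventually_at_right_field by auto
  show thesis by (rule that[of "min (b / 2) (1 / 2)"]) (use b in \<open>auto simp: less_imp_le\<close>)
qed

text \<open>The bound \<open>f2\<close> is Chebyshev's inequality for unit variance; it makes the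
  sums over the weights converge at every positive level, also where regular variation says
  nothing.\<close>

locale heavy_tail =
  fixes t :: real and f :: "real \<Rightarrow> real"
  assumes f: "regvar t f" and t: "2 < t" and f2: "\<And>u. 0 < u \<Longrightarrow> f u \<le> 1 / u\<^sup>2"
begin

lemma f_pos: "0 < f u"
  by (rule regvar_pos[OF f])

lemma jsum_summable:
  assumes w: "unit_weights w" and u: "0 < u"
  shows "(\<lambda>i. f (u / w i)) summable_on UNIV"
proof (rule summable_on_comparison_test)
  show "(\<lambda>i. 1 / u\<^sup>2 * (w i)\<^sup>2) summable_on UNIV"
    by (intro summable_on_cmult_right has_sum_imp_summable[OF unit_weightsD(3)[OF w]])
  show "f (u / w i) \<le> 1 / u\<^sup>2 * (w i)\<^sup>2" for i
    using f2[of "u / w i"] u unit_weightsD(1)[OF w, of i] by (simp add: power_divide)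
qed (simp add: less_imp_le[OF f_pos])

lemma jsum_pos:
  assumes "unit_weights w" "0 < u"
  shows "0 < jsum f w u"
proof -
  have "0 < (\<Sum>i\<in>{undefined}. f (u / w i))" using f_pos by simp
  also have "\<dots> \<le> jsum f w u"
    unfolding jsum_def by (intro finite_sum_le_infsum jsum_summable assms) (auto simp: less_imp_le[OF f_pos])
  finally show ?thesis .
qed

lemma jsum_mono_scale:
  assumes w: "unit_weights w" and uv: "0 < u" "0 < v" and le: "\<And>i. f (u / w i) \<le> c * f (v / w i)"
  shows "jsum f w u \<le> c * jsum f w v"
proof -
  have "jsum f w u \<le> (\<Sum>\<^sub>\<infinity>i. c * f (v / w i))"
    unfolding jsum_def using le by (intro infsum_mono jsum_summable summable_on_cmult_right w uv)
  also have "\<dots> = c * jsum f w v"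
    unfolding jsum_def by (intro infsum_cmult_right jsum_summable w uv)
  finally show ?thesis .
qed

lemma jsum_antimono:
  assumes w: "unit_weights w" and uv: "0 < u" "u \<le> v"
  shows "jsum f w v \<le> jsum f w u"
proof -
  have "jsum f w v \<le> 1 * jsum f w u"
  proof (rule jsum_mono_scale[OF w])
    show "f (v / w i) \<le> 1 * f (u / w i)" for i
      using uv unit_weightsD(1)[OF w, of i] by (simp add: regvar_antimono[OF f] divide_right_mono)
  qed (use uv in auto)
  then show ?thesis by simp
qed

text \<open>The constants come from the tail alone, so they are uniform in the weights. The
  threshold is imposed on y / w i and not on y, because y may be as small as a multiple of 1/x while
  the weights are smaller still.\<close>

lemma jsum_potter:
  obtains C u0 where "1 \<le> C" "1 \<le> u0"
    "\<And>(w :: 'i \<Rightarrow> real) x y. unit_weights w \<Longrightarrow> 0 < y \<Longrightarrow> y \<le> x \<Longrightarrow> (\<And>i. u0 \<le> y / w i) \<Longrightarrow>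
      jsum f w y \<le> C * (x / y) powr (t + 1) * jsum f w x"
proof -
  obtain C u0 where C: "1 \<le> C" "1 \<le> u0"
    and *: "\<And>u v. u0 \<le> u \<Longrightarrow> 1 \<le> v \<Longrightarrow> f u \<le> C * v powr (t + 1) * f (v * u)"
    using regvar_potter[OF f, of "t + 1"] t by auto
  show thesis
  proof (rule that[OF C])
    fix w :: "'i \<Rightarrow> real" and x y :: real
    assume w: "unit_weights w" and y: "0 < y" "y \<le> x" and u: "\<And>i. u0 \<le> y / w i"
    show "jsum f w y \<le> C * (x / y) powr (t + 1) * jsum f w x"
    proof (rule jsum_mono_scale[OF w])
      fix i
      have "f (y / w i) \<le> C * (x / y) powr (t + 1) * f (x / y * (y / w i))" using y u by (intro *) auto
      then show "f (y / w i) \<le> C * (x / y) powr (t + 1) * f (x / w i)" using y by simp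
    qed (use y in auto)
  qed
qed

text \<open>A power bound of order s < t for the tail sums to the Lyapunov quotient of order s.
  Together with the lower bound of order q > t this encloses the jump sum between quotients of
  orders arbitrarily close to t.\<close>

lemma jsum_upper:
  assumes s: "2 \<le> s" "s < t"
  obtains C u0 where "0 < C" "1 \<le> u0"
    "\<And>(w :: 'i \<Rightarrow> real) x. unit_weights w \<Longrightarrow> 0 < x \<Longrightarrow> (\<And>i. u0 \<le> x / w i) \<Longrightarrow>
      jsum f w x \<le> C * x powr (- s) * lyap w s"
proof -
  obtain C u0 where C: "0 < C" "1 \<le> u0" and *: "\<And>u. u0 \<le> u \<Longrightarrow> f u \<le> C * u powr (- s)"
    using regvar_upper[OF f s(2)] s by auto
  show thesis
  proof (rule that[OF C])
    fix w :: "'i \<Rightarrow> real" and x :: real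
    assume w: "unit_weights w" and x: "0 < x" and u: "\<And>i. u0 \<le> x / w i"
    note W = unit_weightsD[OF w]
    have "jsum f w x \<le> (\<Sum>\<^sub>\<infinity>i. C * x powr (- s) * \<bar>w i\<bar> powr s)"
      unfolding jsum_def
    proof (intro infsum_mono jsum_summable w x summable_on_cmult_right lyap_summable[OF W(3) s(1)])
      fix i
      have "(x / w i) powr (- s) = x powr (- s) * \<bar>w i\<bar> powr s"
        using x W(1,4)[of i] by (simp add: powr_divide powr_minus field_simps)
      then show "f (x / w i) \<le> C * x powr (- s) * \<bar>w i\<bar> powr s" using *[OF u[of i]] by (simp only: mult.assoc)
    qed
    also have "\<dots> = C * x powr (- s) * lyap w s"
      unfolding lyap_def by (intro infsum_cmult_right lyap_summable[OF W(3) s(1)])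
    finally show "jsum f w x \<le> C * x powr (- s) * lyap w s" .
  qed
qed

lemma jsum_lower:
  assumes q: "t < q"
  obtains c u0 where "0 < c" "1 \<le> u0"
    "\<And>(w :: 'i \<Rightarrow> real) x. unit_weights w \<Longrightarrow> 0 < x \<Longrightarrow> (\<And>i. u0 \<le> x / w i) \<Longrightarrow>
      c * x powr (- q) * lyap w q \<le> jsum f w x"
proof -
  obtain c u0 where c: "0 < c" "1 \<le> u0" and *: "\<And>u. u0 \<le> u \<Longrightarrow> c * u powr (- q) \<le> f u"
    using regvar_lower[OF f q] q t by auto
  have q2: "2 \<le> q" using q t by simp
  show thesis
  proof (rule that[OF c])
    fix w :: "'i \<Rightarrow> real" and x :: real
    assume w: "unit_weights w" and x: "0 < x" and u: "\<And>i. u0 \<le> x / w i"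
    note W = unit_weightsD[OF w]
    have "c * x powr (- q) * lyap w q = (\<Sum>\<^sub>\<infinity>i. c * x powr (- q) * \<bar>w i\<bar> powr q)"
      unfolding lyap_def by (intro infsum_cmult_right[symmetric] lyap_summable[OF W(3) q2])
    also have "\<dots> \<le> jsum f w x"
      unfolding jsum_def
    proof (intro infsum_mono jsum_summable w x summable_on_cmult_right lyap_summable[OF W(3) q2])
      fix i
      have "(x / w i) powr (- q) = x powr (- q) * \<bar>w i\<bar> powr q"
        using x W(1,4)[of i] by (simp add: powr_divide powr_minus field_simps)
      then show "c * x powr (- q) * \<bar>w i\<bar> powr q \<le> f (x / w i)" using *[OF u[of i]] by (simp only: mult.assoc)
    qed
    finally show "c * x powr (- q) * lyap w q \<le> jsum f w x" .
  qed
qed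

lemma jsum_near_one:
  assumes e: "0 < e" "e < 1"
  obtains d u0 where "0 < d" "d \<le> 1 / 2" "1 \<le> u0"
    "\<And>(w :: 'i \<Rightarrow> real) x. unit_weights w \<Longrightarrow> u0 \<le> x \<Longrightarrow> jsum f w ((1 - d) * x) \<le> (1 + e) * jsum f w x"
    "\<And>(w :: 'i \<Rightarrow> real) x. unit_weights w \<Longrightarrow> u0 \<le> x \<Longrightarrow> (1 - e) * jsum f w x \<le> jsum f w ((1 + d) * x)"
proof -
  obtain d u0 where d: "0 < d" "d \<le> 1 / 2" "1 \<le> u0"
    and *: "\<And>u. u0 \<le> u \<Longrightarrow> f ((1 - d) * u) \<le> (1 + e) * f u \<and> (1 - e) * f u \<le> f ((1 + d) * u)"
    using regvar_near_one[OF f e(1)] by metis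
  show thesis
  proof (rule that[OF d])
    fix w :: "'i \<Rightarrow> real" and x :: real
    assume w: "unit_weights w" and x: "u0 \<le> x"
    have u: "u0 \<le> x / w i" for i using le_divide_weight[OF w] d x by simp
    show "jsum f w ((1 - d) * x) \<le> (1 + e) * jsum f w x"
      using *[OF u] x d by (intro jsum_mono_scale[OF w]) auto
    have "jsum f w x \<le> 1 / (1 - e) * jsum f w ((1 + d) * x)"
    proof (rule jsum_mono_scale[OF w])
      show "f (x / w i) \<le> 1 / (1 - e) * f ((1 + d) * x / w i)" for i
        using conjunct2[OF *[OF u[of i]]] e by (simp add: field_simps)
    qed (use x d in auto)
    then show "(1 - e) * jsum f w x \<le> jsum f w ((1 + d) * x)" using e by (simp add: field_simps)
  qed
qed

text \<open>The level may be a small constant c: if the quotient of order t is small, all weights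
  are small, so c / w i is in the range of the power bound anyway. Taking s midway between 2 and t
  leaves the positive power (s - 2) / t of the quotient.\<close>

lemma jsum_small:
  assumes c: "0 < c" and e: "0 < e"
  obtains U0 where "0 < U0" "U0 < 1"
    "\<And>(w :: 'i \<Rightarrow> real) x. unit_weights w \<Longrightarrow> lyap w t \<le> U0 \<Longrightarrow> c \<le> x \<Longrightarrow> jsum f w x \<le> e"
proof -
  define s where "s = (t + 2) / 2"
  have s: "2 \<le> s" "s < t" "2 < s" using t by (auto simp: s_def)
  obtain C u0 where C: "0 < C" "1 \<le> u0"
    and J: "\<And>(w :: 'i \<Rightarrow> real) x. unit_weights w \<Longrightarrow> 0 < x \<Longrightarrow> (\<And>i. u0 \<le> x / w i) \<Longrightarrow>
      jsum f w x \<le> C * x powr (- s) * lyap w s"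
    using jsum_upper[OF s(1,2)] by metis
  have t0: "0 < 1 / t" using t by simp
  have st: "0 < (s - 2) / t" using s t by simp
  obtain U1 where U1: "0 < U1" "U1 < 1" "\<And>U. 0 < U \<Longrightarrow> U \<le> U1 \<Longrightarrow> u0 * U powr (1 / t) \<le> c"
    using powr_small[OF t0 c] by metis
  obtain U2 where U2: "0 < U2" "U2 < 1" "\<And>U. 0 < U \<Longrightarrow> U \<le> U2 \<Longrightarrow> C * c powr (- s) * U powr ((s - 2) / t) \<le> e"
    using powr_small[OF st e, of "C * c powr (- s)"] by metis
  show thesis
  proof (rule that[of "min U1 U2"])
    fix w :: "'i \<Rightarrow> real" and x :: real
    assume w: "unit_weights w" and U: "lyap w t \<le> min U1 U2" and x: "c \<le> x"
    note W = unit_weightsD[OF w]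
    have U0: "0 < lyap w t" using lyap_pos[OF W(3)] t by simp
    have u: "u0 \<le> c / w i" for i
    proof -
      have "u0 * w i \<le> u0 * lyap w t powr (1 / t)"
        using weight_le_lyap[OF W(3), of t i] t C W(4)[of i] by (intro mult_left_mono) auto
      also have "\<dots> \<le> c" using U U0 by (intro U1(3)) auto
      finally show ?thesis using W(1)[of i] by (simp add: field_simps)
    qed
    have "jsum f w x \<le> jsum f w c" using c x by (intro jsum_antimono w)
    also have "\<dots> \<le> C * c powr (- s) * lyap w s" by (rule J[OF w c u])
    also have "\<dots> \<le> C * c powr (- s) * lyap w t powr ((s - 2) / t)"
      using C s t by (intro mult_left_mono lyap_le_powr[OF W(3)]) auto
    also have "\<dots> \<le> e" using U U0 by (intro U2(3)) auto
    finally show "jsum f w x \<le> e" .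
  qed (use U1 U2 in auto)
qed

text \<open>Lowering the level from x to e1 / x multiplies the jump sum by at most a power of x. A
  Gaussian factor beats this power when one jump meets a large remainder; for two jumps the
  additional jump sum, itself a positive power of the quotient, beats it.\<close>

lemma jsum_moderate:
  assumes e: "0 < e" "e \<le> 1" and d: "0 < d" and e1: "0 < e1" "e1 \<le> 1"
  obtains \<kappa> U0 L where "0 < \<kappa>" "0 < U0" "U0 < 1" "1 \<le> L"
    "\<And>(w :: 'i \<Rightarrow> real) x. unit_weights w \<Longrightarrow> lyap w t \<le> U0 \<Longrightarrow> L \<le> x \<Longrightarrow> x \<le> lyap w t powr (- \<kappa>) \<Longrightarrow>
      exp (- (d\<^sup>2 * x\<^sup>2 / 24)) * jsum f w (e1 / x) \<le> e * jsum f w x \<and> (jsum f w (e1 / x))\<^sup>2 \<le> e * jsum f w x"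
proof -
  define s where "s = (t + 2) / 2"
  define q where "q = t + 1"
  have s: "2 \<le> s" "s < t" "2 < s" "(s - 2) / (t - 2) = 1 / 2" using t by (auto simp: s_def field_simps)
  have q: "0 < q" using t by (simp add: q_def)
  obtain C1 u1 where C1: "1 \<le> C1" "1 \<le> u1"
    and J1: "\<And>(w :: 'i \<Rightarrow> real) x y. unit_weights w \<Longrightarrow> 0 < y \<Longrightarrow> y \<le> x \<Longrightarrow> (\<And>i. u1 \<le> y / w i) \<Longrightarrow>
      jsum f w y \<le> C1 * (x / y) powr q * jsum f w x"
    unfolding q_def using jsum_potter by metis
  obtain C2 u2 where C2: "0 < C2" "1 \<le> u2"
    and J2: "\<And>(w :: 'i \<Rightarrow> real) x. unit_weights w \<Longrightarrow> 0 < x \<Longrightarrow> (\<And>i. u2 \<le> x / w i) \<Longrightarrow>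
      jsum f w x \<le> C2 * x powr (- s) * lyap w s"
    using jsum_upper[OF s(1,2)] by metis
  \<comment> \<open>The first bound keeps w i * x below a positive power of U, so that the Potter
    bound applies at e1 / x. The second keeps x powr (4 * q) below U powr (- 1/4), half of what the
    factor U powr (1/2) in the jump sum can pay for.\<close>
  define \<kappa> where "\<kappa> = min (1 / (2 * t)) (1 / (16 * q))"
  have k: "0 < \<kappa>" "\<kappa> \<le> 1 / (2 * t)" "\<kappa> \<le> 1 / (16 * q)" using t q by (auto simp: \<kappa>_def)
  have t2: "0 < 1 / (2 * t)" using t by simp
  obtain U1 where U1: "0 < U1" "U1 < 1" "\<And>U. 0 < U \<Longrightarrow> U \<le> U1 \<Longrightarrow> u1 * U powr (1 / (2 * t)) \<le> e1"
    using powr_small[OF t2 e1(1)] by metis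
  define K where "K = C1\<^sup>2 * (1 / e1) powr (2 * q) * C2"
  obtain U2 where U2: "0 < U2" "U2 < 1" "\<And>U. 0 < U \<Longrightarrow> U \<le> U2 \<Longrightarrow> K * U powr (1 / 4) \<le> e"
    using powr_small[of "1 / 4" e K] e by auto
  have "((\<lambda>x. C1 * (x\<^sup>2 / e1) powr q * exp (- (d\<^sup>2 * x\<^sup>2 / 24))) \<longlongrightarrow> 0) at_top"
    using d e1 by real_asymp
  then have "\<forall>\<^sub>F x in at_top. C1 * (x\<^sup>2 / e1) powr q * exp (- (d\<^sup>2 * x\<^sup>2 / 24)) < e"
    using e by (intro order_tendstoD(2))
  then obtain L where L: "1 \<le> L" "\<And>x. L \<le> x \<Longrightarrow> C1 * (x\<^sup>2 / e1) powr q * exp (- (d\<^sup>2 * x\<^sup>2 / 24)) < e"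
    by (rule eventually_at_top_pos) blast
  show thesis
  proof (rule that[of \<kappa> "min U1 U2" "max L u2"])
    fix w :: "'i \<Rightarrow> real" and x :: real
    assume w: "unit_weights w" and U: "lyap w t \<le> min U1 U2" and x: "max L u2 \<le> x" and xk: "x \<le> lyap w t powr (- \<kappa>)"
    define U where "U = lyap w t"
    note W = unit_weightsD[OF w]
    have Upos: "0 < U" "U \<le> 1" "U \<le> U1" "U \<le> U2"
      using lyap_pos[OF W(3), of t] lyap_le_1[OF W(3), of t] t U by (auto simp: U_def)
    have x1: "1 \<le> x" "L \<le> x" "u2 \<le> x" using x L by auto
    let ?y = "e1 / x" and ?J = "jsum f w x"
    have Jpos: "0 < ?J" using x1 by (intro jsum_pos w) auto
    have "e1 \<le> 1 * x * x" using e1 x1 mult_mono[of 1 x 1 x] by simp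
    then have y: "0 < ?y" "?y \<le> x" using x1 e1 by (auto simp: divide_le_eq)
    have yu: "u1 \<le> ?y / w i" for i
    proof -
      have "u1 * (w i * x) \<le> u1 * (U powr (1 / t) * U powr (- \<kappa>))"
        using weight_le_lyap[OF W(3), of t i] t C1 W(1,4)[of i] xk x1
        by (intro mult_left_mono mult_mono) (auto simp: U_def)
      also have "U powr (1 / t) * U powr (- \<kappa>) = U powr (1 / t - \<kappa>)" by (simp add: powr_diff powr_minus field_simps)
      also have "\<dots> \<le> U powr (1 / (2 * t))" using k Upos t by (intro powr_mono') (auto simp: field_simps)
      also have "u1 * U powr (1 / (2 * t)) \<le> e1" using Upos by (intro U1(3)) auto
      finally show ?thesis using W(1)[of i] C1 x1 by (simp add: field_simps mult_left_mono)
    qed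
    have xy: "x / ?y = x\<^sup>2 / e1" using x1 e1 by (simp add: power2_eq_square)
    have Jy: "jsum f w ?y \<le> C1 * (x\<^sup>2 / e1) powr q * ?J" using J1[OF w y yu] unfolding xy .
    have "exp (- (d\<^sup>2 * x\<^sup>2 / 24)) * jsum f w ?y \<le> exp (- (d\<^sup>2 * x\<^sup>2 / 24)) * (C1 * (x\<^sup>2 / e1) powr q * ?J)"
      by (intro mult_left_mono Jy) auto
    also have "\<dots> = C1 * (x\<^sup>2 / e1) powr q * exp (- (d\<^sup>2 * x\<^sup>2 / 24)) * ?J" by simp
    also have "\<dots> \<le> e * ?J" using L(2)[OF x1(2)] Jpos by (intro mult_right_mono) auto
    finally have 1: "exp (- (d\<^sup>2 * x\<^sup>2 / 24)) * jsum f w ?y \<le> e * ?J" .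
    have Jle: "?J \<le> C2 * U powr (1 / 2)"
    proof -
      have "?J \<le> C2 * x powr (- s) * lyap w s"
        using x1 C2 by (intro J2 w le_divide_weight) auto
      also have "\<dots> \<le> C2 * 1 * U powr (1 / 2)"
        using lyap_interpolation[OF W(3) s(3,2)] lyap_pos[OF W(3) s(1)] C2 x1 s
        by (intro mult_mono mult_left_mono) (auto simp: U_def powr_le1 powr_minus divide_simps ge_one_powr_ge_zero)
      finally show ?thesis by simp
    qed
    have "(jsum f w ?y)\<^sup>2 \<le> (C1 * (x\<^sup>2 / e1) powr q * ?J)\<^sup>2"
      using Jy less_imp_le[OF jsum_pos[OF w y(1)]] by (intro power_mono)
    also have "\<dots> = C1\<^sup>2 * (1 / e1) powr (2 * q) * x powr (4 * q) * ?J * ?J"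
    proof -
      have "((x\<^sup>2 / e1) powr q)\<^sup>2 = (x\<^sup>2 / e1) powr (2 * q)"
        by (simp add: power2_eq_square flip: powr_add)
      also have "\<dots> = (1 / e1) powr (2 * q) * (x\<^sup>2) powr (2 * q)"
        using e1 by (simp flip: powr_mult)
      also have "(x\<^sup>2) powr (2 * q) = (x powr 2) powr (2 * q)" using x1 by (simp add: powr_realpow)
      also have "\<dots> = x powr (4 * q)" by (simp only: powr_powr) simp
      finally show ?thesis by (simp add: power_mult_distrib power2_eq_square mult_ac)
    qed
    also have "\<dots> \<le> C1\<^sup>2 * (1 / e1) powr (2 * q) * (U powr (- \<kappa>)) powr (4 * q) * (C2 * U powr (1 / 2)) * ?J"
      using xk x1 q Jle Jpos C2 by (intro mult_right_mono mult_mono mult_left_mono powr_mono2) (auto simp: U_def)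
    also have "\<dots> = K * (U powr (- \<kappa> * (4 * q)) * U powr (1 / 2)) * ?J"
      by (simp add: K_def powr_powr mult_ac)
    also have "U powr (- \<kappa> * (4 * q)) * U powr (1 / 2) = U powr (1 / 2 - \<kappa> * (4 * q))"
      by (simp only: powr_add[symmetric]) simp
    also have "K * U powr (1 / 2 - \<kappa> * (4 * q)) * ?J \<le> K * U powr (1 / 4) * ?J"
    proof -
      have "\<kappa> * (4 * q) \<le> 1 / (16 * q) * (4 * q)" using k q by (intro mult_right_mono) auto
      also have "\<dots> = 1 / 4" using q by simp
      finally show ?thesis using Upos Jpos C1 C2 e1
        by (intro mult_right_mono mult_left_mono powr_mono') (auto simp: K_def)
    qed
    also have "\<dots> \<le> e * ?J" using Upos Jpos U2(3)[of U] by (intro mult_right_mono) auto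
    finally show "exp (- (d\<^sup>2 * x\<^sup>2 / 24)) * jsum f w ?y \<le> e * ?J \<and> (jsum f w ?y)\<^sup>2 \<le> e * ?J" using 1 by simp
  qed (use k U1 U2 L C2 in auto)
qed

text \<open>In this range U is at least a negative power of x, so the jump sum is bounded below by a
  power of x, and a Chernoff bound with a large enough polynomial order is negligible against it.
  Levels x and \<eta> * x differ by a fixed ratio, hence by a fixed factor in the jump sum.\<close>

lemma jsum_huge:
  assumes k: "0 < \<kappa>" and e: "0 < e" "e \<le> 1" and d: "0 < d"
  obtains \<eta> L where "0 < \<eta>" "\<eta> \<le> 1 / 2" "1 \<le> L"
    "\<And>(w :: 'i \<Rightarrow> real) x. unit_weights w \<Longrightarrow> L \<le> x \<Longrightarrow> lyap w t powr (- \<kappa>) \<le> x \<Longrightarrow>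
      exp 1 * x powr (- d / (2 * \<eta>)) * jsum f w (\<eta> * x) \<le> e * jsum f w x \<and>
      (jsum f w (\<eta> * x))\<^sup>2 \<le> e * jsum f w x \<and> exp 1 * x powr (- 1 / (2 * \<eta>)) \<le> e * jsum f w x"
proof -
  define s where "s = (t + 2) / 2"
  define q where "q = t + 1"
  have s: "2 \<le> s" "s < t" "2 < s" using t by (auto simp: s_def)
  have q: "0 < q" "t < q" using t by (auto simp: q_def)
  obtain C1 u1 where C1: "1 \<le> C1" "1 \<le> u1"
    and J1: "\<And>(w :: 'i \<Rightarrow> real) x y. unit_weights w \<Longrightarrow> 0 < y \<Longrightarrow> y \<le> x \<Longrightarrow> (\<And>i. u1 \<le> y / w i) \<Longrightarrow>
      jsum f w y \<le> C1 * (x / y) powr q * jsum f w x"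
    unfolding q_def using jsum_potter by metis
  obtain C2 u2 where C2: "0 < C2" "1 \<le> u2"
    and J2: "\<And>(w :: 'i \<Rightarrow> real) x. unit_weights w \<Longrightarrow> 0 < x \<Longrightarrow> (\<And>i. u2 \<le> x / w i) \<Longrightarrow>
      jsum f w x \<le> C2 * x powr (- s) * lyap w s"
    using jsum_upper[OF s(1,2)] by metis
  obtain c u3 where c: "0 < c" "1 \<le> u3"
    and J3: "\<And>(w :: 'i \<Rightarrow> real) x. unit_weights w \<Longrightarrow> 0 < x \<Longrightarrow> (\<And>i. u3 \<le> x / w i) \<Longrightarrow>
      c * x powr (- q) * lyap w q \<le> jsum f w x"
    using jsum_lower[OF q(2)] by metis
  \<comment> \<open>The jump sum will be at least c * x powr (- m): q comes from the lower power
    bound, the rest from the interpolated quotient after inserting U \<ge> x powr (- 1 / \<kappa>).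
    The choice of \<eta> makes the Chernoff order m + 1, one power better.\<close>
  define m where "m = q + (q - 2) / (t - 2) / \<kappa>"
  have m: "0 < m" using t k by (auto simp: m_def q_def intro!: add_pos_pos)
  define \<eta> where "\<eta> = 1 / (2 * (m + 1))"
  have eta: "0 < \<eta>" "\<eta> \<le> 1 / 2" "1 / (2 * \<eta>) = m + 1" using m by (auto simp: \<eta>_def field_simps)
  define K where "K = C1 * (1 / \<eta>) powr q"
  have K: "0 < K" using C1 eta by (simp add: K_def)
  have d2: "0 < d / (2 * \<eta>)" using d eta by simp
  have s0: "0 < s" using s by simp
  have "((\<lambda>x. exp 1 * x powr (- (d / (2 * \<eta>))) * K) \<longlongrightarrow> 0) at_top"
    using d2 by real_asymp
  then have "\<forall>\<^sub>F x in at_top. exp 1 * x powr (- (d / (2 * \<eta>))) * K < e"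
    using e by (intro order_tendstoD(2))
  then obtain L1 where L1: "1 \<le> L1" "\<And>x. L1 \<le> x \<Longrightarrow> exp 1 * x powr (- (d / (2 * \<eta>))) * K < e"
    by (rule eventually_at_top_pos) blast
  have "((\<lambda>x. K\<^sup>2 * C2 * x powr (- s)) \<longlongrightarrow> 0) at_top" using s0 by real_asymp
  then have "\<forall>\<^sub>F x in at_top. K\<^sup>2 * C2 * x powr (- s) < e" using e by (intro order_tendstoD(2))
  then obtain L2 where L2: "1 \<le> L2" "\<And>x. L2 \<le> x \<Longrightarrow> K\<^sup>2 * C2 * x powr (- s) < e"
    by (rule eventually_at_top_pos) blast
  define L where "L = Max {L1, L2, u1 / \<eta>, u2, u3, exp 1 / (e * c)}"
  show thesis
  proof (rule that[of \<eta> L])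
    show "1 \<le> L" using L1 by (simp add: L_def)
    fix w :: "'i \<Rightarrow> real" and x :: real
    assume w: "unit_weights w" and x: "L \<le> x" and xk: "lyap w t powr (- \<kappa>) \<le> x"
    define U where "U = lyap w t"
    note W = unit_weightsD[OF w]
    have Upos: "0 < U" "U \<le> 1" using lyap_pos[OF W(3), of t] lyap_le_1[OF W(3), of t] t by (auto simp: U_def)
    have x1: "1 \<le> x" "L1 \<le> x" "L2 \<le> x" "u1 / \<eta> \<le> x" "u2 \<le> x" "u3 \<le> x" "exp 1 / (e * c) \<le> x"
      using x L1 by (auto simp: L_def)
    let ?y = "\<eta> * x" and ?J = "jsum f w x"
    have Jpos: "0 < ?J" using x1 by (intro jsum_pos w) auto
    have y: "0 < ?y" "?y \<le> x" "u1 \<le> ?y" using x1 eta by (auto simp: field_simps)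
    have Jy: "jsum f w ?y \<le> K * ?J"
      using J1[OF w y(1,2) le_divide_weight[OF w less_imp_le[OF y(1)] y(3)]] x1 eta by (simp add: K_def)
    have "exp 1 * x powr (- d / (2 * \<eta>)) * jsum f w ?y \<le> exp 1 * x powr (- d / (2 * \<eta>)) * (K * ?J)"
      by (intro mult_left_mono Jy) auto
    also have "\<dots> = exp 1 * x powr (- (d / (2 * \<eta>))) * K * ?J" by simp
    also have "\<dots> \<le> e * ?J" using L1(2)[OF x1(2)] Jpos by (intro mult_right_mono) auto
    finally have 1: "exp 1 * x powr (- d / (2 * \<eta>)) * jsum f w ?y \<le> e * ?J" .
    have Jle: "?J \<le> C2 * x powr (- s)"
    proof -
      have "?J \<le> C2 * x powr (- s) * lyap w s"
        using x1 C2 by (intro J2 w le_divide_weight) auto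
      also have "\<dots> \<le> C2 * x powr (- s) * 1"
        using lyap_le_1[OF W(3) s(1)] C2 by (intro mult_left_mono) auto
      finally show ?thesis by simp
    qed
    have "(jsum f w ?y)\<^sup>2 \<le> (K * ?J)\<^sup>2"
      using Jy less_imp_le[OF jsum_pos[OF w y(1)]] by (intro power_mono)
    also have "\<dots> = K\<^sup>2 * ?J * ?J" by (simp add: power2_eq_square)
    also have "\<dots> \<le> K\<^sup>2 * (C2 * x powr (- s)) * ?J"
      using Jle Jpos by (intro mult_right_mono mult_left_mono) auto
    also have "\<dots> = K\<^sup>2 * C2 * x powr (- s) * ?J" by simp
    also have "\<dots> \<le> e * ?J" using L2(2)[OF x1(3)] Jpos by (intro mult_right_mono) auto
    finally have 2: "(jsum f w ?y)\<^sup>2 \<le> e * ?J" .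
    have Uge: "x powr (- 1 / \<kappa>) \<le> U"
    proof -
      have "x powr (- 1 / \<kappa>) \<le> (U powr (- \<kappa>)) powr (- 1 / \<kappa>)"
        using xk k x1 Upos by (intro powr_mono2') (auto simp: U_def)
      also have "\<dots> = U" using k Upos by (simp add: powr_powr)
      finally show ?thesis .
    qed
    have Jge: "c * x powr (- m) \<le> ?J"
    proof -
      have "x powr (- m) = x powr (- q) * (x powr (- 1 / \<kappa>)) powr ((q - 2) / (t - 2))"
        by (simp add: m_def powr_powr powr_add[symmetric] field_simps)
      also have "\<dots> \<le> x powr (- q) * U powr ((q - 2) / (t - 2))"
        using Uge t by (intro mult_left_mono powr_mono2) (auto simp: q_def)
      also have "\<dots> \<le> x powr (- q) * lyap w q"
        unfolding U_def using t q by (intro mult_left_mono lyap_interpolation_ge[OF W(3)]) auto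
      finally have "c * x powr (- m) \<le> c * (x powr (- q) * lyap w q)" using c by (intro mult_left_mono) auto
      also have "\<dots> \<le> ?J" using J3[OF w _ le_divide_weight[OF w]] x1 c by (simp add: mult.assoc)
      finally show ?thesis .
    qed
    have "exp 1 * x powr (- 1 / (2 * \<eta>)) = exp 1 * x powr (- m) / x"
      using x1 eta(3) by (simp add: powr_diff powr_minus_divide)
    also have "\<dots> = exp 1 / x * x powr (- m)" by simp
    also have "\<dots> \<le> e * c * x powr (- m)"
      using x1 e c by (intro mult_right_mono) (auto simp: field_simps)
    also have "\<dots> \<le> e * ?J" using Jge e by (simp add: mult.assoc mult_left_mono)
    finally show "exp 1 * x powr (- d / (2 * \<eta>)) * jsum f w ?y \<le> e * ?J \<and> (jsum f w ?y)\<^sup>2 \<le> e * ?J \<and>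
      exp 1 * x powr (- 1 / (2 * \<eta>)) \<le> e * ?J" using 1 2 by simp
  qed (use eta in auto)
qed

text \<open>By assumption U \<ge> exp(-x^2 / A^2), and 1 / A^2 < 1/2 leaves room for some a < 1/2.
  That a is strictly below 1/2 is essential later: it pays for the factor by which truncation
  enlarges the Chernoff exponent.\<close>

lemma gauss_le_jsum:
  assumes A: "sqrt 2 < A" and e: "0 < e"
  obtains a L where "0 \<le> a" "a < 1 / 2" "1 \<le> L"
    "\<And>(w :: 'i \<Rightarrow> real) x. unit_weights w \<Longrightarrow> L \<le> x \<Longrightarrow> A\<^sup>2 * ln (inverse (lyap w t)) \<le> x\<^sup>2 \<Longrightarrow>
      exp (- (a * x\<^sup>2)) \<le> e * jsum f w x"
proof -
  have A0: "0 < A" using A by (meson less_trans real_sqrt_gt_zero zero_less_numeral)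
  have A2: "2 < A\<^sup>2" using A0 power_strict_mono[OF A, of 2] by simp
  define a where "a = (1 / 2 + 1 / A\<^sup>2) / 2"
  have "1 / A\<^sup>2 < 1 / 2" "0 \<le> 1 / A\<^sup>2" using A2 by (simp_all add: divide_less_eq)
  moreover have "y < (1 / 2 + y) / 2 \<and> (1 / 2 + y) / 2 < 1 / 2 \<and> 0 \<le> (1 / 2 + y) / 2"
    if "y < 1 / 2" "0 \<le> y" for y :: real
    using that by auto
  ultimately have a: "1 / A\<^sup>2 < a" "a < 1 / 2" "0 \<le> a" unfolding a_def by blast+
  define r where "r = (1 + a * A\<^sup>2) / 2"
  have A2p: "0 < A\<^sup>2" using A2 by linarith
  have aA: "1 < a * A\<^sup>2" using a(1) pos_divide_less_eq[OF A2p, of 1 a] by blast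
  have r: "1 < r" "r < a * A\<^sup>2" using aA by (auto simp: r_def)
  define b where "b = a - r / A\<^sup>2"
  have b: "0 < b" using r(2) pos_divide_less_eq[OF A2p, of r a] by (simp add: b_def)
  \<comment> \<open>Chosen so that the quotient of order q is at least U powr r with r > 1. What
    remains of the exponent, b = a - r / A^2 > 0, beats the power x powr q.\<close>
  define q where "q = 2 + r * (t - 2)"
  have "1 * (t - 2) < r * (t - 2)" using r t by (intro mult_strict_right_mono) auto
  moreover have "1 * (t - 2) < P \<Longrightarrow> t < 2 + P" for P by simp
  ultimately have "t < q" unfolding q_def by blast
  moreover have "(q - 2) / (t - 2) = r" using t by (simp add: q_def)
  ultimately have q: "t < q" "(q - 2) / (t - 2) = r" by simp_all
  obtain c u0 where c: "0 < c" "1 \<le> u0"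
    and J: "\<And>(w :: 'i \<Rightarrow> real) x. unit_weights w \<Longrightarrow> 0 < x \<Longrightarrow> (\<And>i. u0 \<le> x / w i) \<Longrightarrow>
      c * x powr (- q) * lyap w q \<le> jsum f w x"
    using jsum_lower[OF q(1)] by metis
  have "((\<lambda>x. exp (- (b * x\<^sup>2)) * x powr q) \<longlongrightarrow> 0) at_top" using b by real_asymp
  then have "\<forall>\<^sub>F x in at_top. exp (- (b * x\<^sup>2)) * x powr q < e * c" using e c by (intro order_tendstoD(2)) auto
  then obtain L where L: "1 \<le> L" "\<And>x. L \<le> x \<Longrightarrow> exp (- (b * x\<^sup>2)) * x powr q < e * c"
    by (rule eventually_at_top_pos) blast
  show thesis
  proof (rule that[OF a(3,2), of "max L u0"])
    fix w :: "'i \<Rightarrow> real" and x :: real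
    assume w: "unit_weights w" and x: "max L u0 \<le> x" and xA: "A\<^sup>2 * ln (inverse (lyap w t)) \<le> x\<^sup>2"
    define U where "U = lyap w t"
    note W = unit_weightsD[OF w]
    have Upos: "0 < U" using lyap_pos[OF W(3), of t] t by (auto simp: U_def)
    have x1: "1 \<le> x" "L \<le> x" "u0 \<le> x" using x L by auto
    have "(- ln U) * A\<^sup>2 \<le> x\<^sup>2"
      using xA unfolding U_def[symmetric] ln_inverse by (simp only: mult.commute)
    then have "- ln U \<le> x\<^sup>2 / A\<^sup>2" by (simp only: pos_le_divide_eq[OF A2p])
    then have "exp (- (r / A\<^sup>2) * x\<^sup>2) \<le> exp (r * ln U)"
      using mult_left_mono[of "- ln U" "x\<^sup>2 / A\<^sup>2" r] r by simp
    also have "\<dots> = U powr r" using Upos by (simp add: powr_def)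
    also have "\<dots> \<le> lyap w q" using lyap_interpolation_ge[OF W(3) t q(1)] q(2) by (simp add: U_def)
    finally have lq: "exp (- (r / A\<^sup>2) * x\<^sup>2) \<le> lyap w q" .
    have "exp (- (a * x\<^sup>2)) = exp (- (b * x\<^sup>2)) * exp (- (r / A\<^sup>2) * x\<^sup>2)"
      by (simp add: b_def algebra_simps flip: exp_add)
    also have "\<dots> = exp (- (b * x\<^sup>2)) * x powr q * (x powr (- q) * exp (- (r / A\<^sup>2) * x\<^sup>2))"
      using x1 by (simp add: powr_minus)
    also have "\<dots> \<le> e * c * (x powr (- q) * lyap w q)"
      using e c by (intro mult_mono[OF less_imp_le[OF L(2)[OF x1(2)]] mult_left_mono[OF lq]]) auto
    also have "\<dots> \<le> e * jsum f w x"
      using J[OF w _ le_divide_weight[OF w]] x1 c e by (simp add: mult.assoc)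
    finally show "exp (- (a * x\<^sup>2)) \<le> e * jsum f w x" .
  qed (use L in auto)
qed

text \<open>The mirror image for B below sqrt 2: an order s < t is chosen for which the quotient is
  already at most exp(-x^2/2). Of the power x powr (- s) a square is kept: one factor 1/x matches
  the Gaussian tail and the other makes the bound small.\<close>

lemma jsum_le_gauss:
  assumes B: "0 < B" "B < sqrt 2" and e: "0 < e"
  obtains L where "1 \<le> L"
    "\<And>(w :: 'i \<Rightarrow> real) x. unit_weights w \<Longrightarrow> L \<le> x \<Longrightarrow> x\<^sup>2 \<le> B\<^sup>2 * ln (inverse (lyap w t)) \<Longrightarrow>
      jsum f w x \<le> e * (exp (- x\<^sup>2 / 2) / x)"
proof -
  have B2: "B\<^sup>2 < 2" "0 < B\<^sup>2" using B power_strict_mono[OF B(2), of 2] by auto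
  \<comment> \<open>With this exponent U powr th \<le> exp(-x^2/2) is the assumption on x itself,
    and th < 1 places s below t.\<close>
  define th where "th = B\<^sup>2 / 2"
  have th: "0 < th" "th < 1" using B2 by (auto simp: th_def)
  define s where "s = 2 + th * (t - 2)"
  have "th * (t - 2) < 1 * (t - 2)" "0 < th * (t - 2)" using th t by (auto intro!: mult_strict_right_mono)
  then have s: "2 < s" "s < t" unfolding s_def mult_1 by (auto simp only: less_diff_eq add.commute less_add_same_cancel1)
  have s3: "(s - 2) / (t - 2) = th" using t by (simp add: s_def)
  obtain C u0 where C: "0 < C" "1 \<le> u0"
    and J: "\<And>(w :: 'i \<Rightarrow> real) x. unit_weights w \<Longrightarrow> 0 < x \<Longrightarrow> (\<And>i. u0 \<le> x / w i) \<Longrightarrow>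
      jsum f w x \<le> C * x powr (- s) * lyap w s"
    using jsum_upper[of s] s by (metis less_imp_le)
  show thesis
  proof (rule that[of "max u0 (C / e)"])
    fix w :: "'i \<Rightarrow> real" and x :: real
    assume w: "unit_weights w" and x: "max u0 (C / e) \<le> x" and xB: "x\<^sup>2 \<le> B\<^sup>2 * ln (inverse (lyap w t))"
    define U where "U = lyap w t"
    note W = unit_weightsD[OF w]
    have Upos: "0 < U" using lyap_pos[OF W(3), of t] t by (auto simp: U_def)
    have x1: "1 \<le> x" "u0 \<le> x" "C / e \<le> x" using x C by auto
    have "U powr th = exp (th * ln U)" using Upos by (simp add: powr_def)
    also have "\<dots> \<le> exp (- x\<^sup>2 / 2)"
      using xB Upos by (simp add: U_def th_def ln_inverse)
    finally have Uth: "U powr th \<le> exp (- x\<^sup>2 / 2)" .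
    have "jsum f w x \<le> C * x powr (- s) * lyap w s"
      using x1 C by (intro J w le_divide_weight) auto
    also have "\<dots> \<le> C * x powr (- 2) * exp (- x\<^sup>2 / 2)"
      using lyap_interpolation[OF W(3) s(1,2)] Uth C s s3 x1 lyap_pos[OF W(3), of s]
      by (intro mult_mono mult_left_mono powr_mono) (auto simp: U_def)
    also have "\<dots> = C / x * (exp (- x\<^sup>2 / 2) / x)"
      using x1 by (simp add: powr_minus_divide power2_eq_square)
    also have "\<dots> \<le> e * (exp (- x\<^sup>2 / 2) / x)"
      using x1 e by (intro mult_right_mono) (auto simp: field_simps)
    finally show "jsum f w x \<le> e * (exp (- x\<^sup>2 / 2) / x)" .
  qed (use C in auto)
qed

end

section \<open>Deviation regimes for normalised weighted sums\<close>

locale iid_unit = prob_space M for M :: "'a measure" +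
  fixes \<xi> :: "int \<Rightarrow> 'a \<Rightarrow> real"
  assumes indep: "indep_vars (\<lambda>_. borel) \<xi> UNIV"
    and ident: "\<And>i. distr M borel (\<xi> i) = distr M borel (\<xi> 0)"
    and sq: "integrable M (\<lambda>\<omega>. (\<xi> 0 \<omega>)\<^sup>2)"
    and var1: "expectation (\<lambda>\<omega>. (\<xi> 0 \<omega>)\<^sup>2) = 1"
    and mean0: "expectation (\<xi> 0) = 0"
begin

definition unit_sum :: "(int \<Rightarrow> real) \<Rightarrow> ('a \<Rightarrow> real) \<Rightarrow> bool" where
  "unit_sum w Z \<longleftrightarrow> ((\<lambda>i. (w i)\<^sup>2) has_sum 1) UNIV \<and> has_mean_square_sum M (\<lambda>i \<omega>. w i * \<xi> i \<omega>) Z"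

definition mom :: "real \<Rightarrow> real" where "mom p = expectation (\<lambda>\<omega>. \<bar>\<xi> 0 \<omega>\<bar> powr p)"

definition tail :: "real \<Rightarrow> real" where "tail u = prob {\<omega> \<in> space M. u \<le> \<xi> 0 \<omega>}"

lemma xi_borel [measurable]: "\<xi> i \<in> borel_measurable M"
  using indep unfolding indep_vars_def2 by simp

lemma expectation_xi:
  assumes [measurable]: "g \<in> borel_measurable borel"
  shows "expectation (\<lambda>\<omega>. g (\<xi> i \<omega>) :: real) = expectation (\<lambda>\<omega>. g (\<xi> 0 \<omega>))"
    and "integrable M (\<lambda>\<omega>. g (\<xi> i \<omega>) :: real) \<longleftrightarrow> integrable M (\<lambda>\<omega>. g (\<xi> 0 \<omega>))"
proof -
  have "expectation (\<lambda>\<omega>. g (\<xi> j \<omega>)) = (\<integral>x. g x \<partial>distr M borel (\<xi> j))" for j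
    by (subst integral_distr) auto
  then show "expectation (\<lambda>\<omega>. g (\<xi> i \<omega>) :: real) = expectation (\<lambda>\<omega>. g (\<xi> 0 \<omega>))"
    by (simp add: ident[of i])
  have "integrable M (\<lambda>\<omega>. g (\<xi> j \<omega>)) \<longleftrightarrow> integrable (distr M borel (\<xi> j)) g" for j
    by (subst integrable_distr_eq) auto
  then show "integrable M (\<lambda>\<omega>. g (\<xi> i \<omega>) :: real) \<longleftrightarrow> integrable M (\<lambda>\<omega>. g (\<xi> 0 \<omega>))"
    by (simp add: ident[of i])
qed

lemma prob_xi:
  assumes [measurable]: "Measurable.pred borel Q"
  shows "prob {\<omega> \<in> space M. Q (\<xi> i \<omega>)} = prob {\<omega> \<in> space M. Q (\<xi> 0 \<omega>)}"
proof -
  have "prob {\<omega> \<in> space M. Q (\<xi> j \<omega>)} = measure (distr M borel (\<xi> j)) {x. Q x}" for j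
    by (subst measure_distr) (auto intro!: arg_cong[where f = prob])
  then show ?thesis by (simp add: ident[of i])
qed

lemma centered: "indep_centered M (\<lambda>i \<omega>. w i * \<xi> i \<omega>)"
proof
  show "indep_vars (\<lambda>_. borel) (\<lambda>i \<omega>. w i * \<xi> i \<omega>) UNIV"
    by (rule indep_vars_compose2[OF indep, of "\<lambda>i x. w i * x" "\<lambda>_. borel"]) auto
  show "integrable M (\<lambda>\<omega>. (w i * \<xi> i \<omega>)\<^sup>2)" for i
    using expectation_xi(2)[of "\<lambda>x. x\<^sup>2" i] sq by (simp add: power_mult_distrib)
  show "expectation (\<lambda>\<omega>. w i * \<xi> i \<omega>) = 0" for i
    using expectation_xi(1)[of "\<lambda>x. x" i] mean0 by simp
qed

lemma var_eq: "indep_centered.var M (\<lambda>i \<omega>. w i * \<xi> i \<omega>) i = (w i)\<^sup>2"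
  unfolding indep_centered.var_def[OF centered]
  using expectation_xi(1)[of "\<lambda>x. x\<^sup>2" i] var1 by (simp add: power_mult_distrib)

lemma absm_eq: "indep_centered.absm M (\<lambda>i \<omega>. w i * \<xi> i \<omega>) p i = \<bar>w i\<bar> powr p * mom p"
  unfolding indep_centered.absm_def[OF centered] mom_def
  using expectation_xi(1)[of "\<lambda>x. \<bar>x\<bar> powr p" i] by (simp add: abs_mult powr_mult)

lemma absm_integrable:
  assumes "integrable M (\<lambda>\<omega>. \<bar>\<xi> 0 \<omega>\<bar> powr p)"
  shows "integrable M (\<lambda>\<omega>. \<bar>w i * \<xi> i \<omega>\<bar> powr p)"
  using expectation_xi(2)[of "\<lambda>x. \<bar>x\<bar> powr p" i] assms by (simp add: abs_mult powr_mult)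

lemma mom_nonneg: "0 \<le> mom p"
  unfolding mom_def by (rule Bochner_Integration.integral_nonneg) simp

abbreviation jumps :: "(int \<Rightarrow> real) \<Rightarrow> real \<Rightarrow> real" where
  "jumps w \<equiv> indep_centered.jumps M (\<lambda>i \<omega>. w i * \<xi> i \<omega>)"

lemma jumps_eq_infsum: "jumps w u = (\<Sum>\<^sub>\<infinity>i. prob {\<omega> \<in> space M. u \<le> w i * \<xi> 0 \<omega>})"
  unfolding indep_centered.jumps_def[OF centered]
proof (rule infsum_cong)
  show "prob {\<omega> \<in> space M. u \<le> w i * \<xi> i \<omega>} = prob {\<omega> \<in> space M. u \<le> w i * \<xi> 0 \<omega>}" for i
    by (rule prob_xi[of "\<lambda>x. u \<le> w i * x"]) simp
qed

lemma jumps_eq_jsum: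
  assumes "unit_weights w"
  shows "jumps w u = jsum tail w u"
  unfolding jumps_eq_infsum jsum_def tail_def using unit_weightsD(1)[OF assms]
  by (simp add: divide_le_eq mult.commute)

lemma jumps_nonneg: "0 \<le> jumps w u"
  by (rule indep_centered.jumps_nonneg[OF centered])

lemma jumps_markov:
  assumes w: "((\<lambda>i. (w i)\<^sup>2) has_sum 1) UNIV" and p: "2 \<le> p" and u: "0 < u"
    and int: "integrable M (\<lambda>\<omega>. \<bar>\<xi> 0 \<omega>\<bar> powr p)"
  shows "jumps w u \<le> mom p * u powr (- p) * lyap w p"
proof -
  have one: "prob {\<omega> \<in> space M. u \<le> w i * \<xi> 0 \<omega>} \<le> mom p * u powr (- p) * \<bar>w i\<bar> powr p" for i
  proof -
    have "prob {\<omega> \<in> space M. u \<le> w i * \<xi> 0 \<omega>} = expectation (indicator {\<omega> \<in> space M. u \<le> w i * \<xi> 0 \<omega>})"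
      by simp
    also have "\<dots> \<le> expectation (\<lambda>\<omega>. u powr (- p) * \<bar>w i\<bar> powr p * \<bar>\<xi> 0 \<omega>\<bar> powr p)"
    proof (intro integral_mono integrable_mult_right int)
      fix \<omega>
      show "indicator {\<omega> \<in> space M. u \<le> w i * \<xi> 0 \<omega>} \<omega> \<le> u powr (- p) * \<bar>w i\<bar> powr p * \<bar>\<xi> 0 \<omega>\<bar> powr p"
      proof (cases "u \<le> w i * \<xi> 0 \<omega>")
        case True
        then have "u powr p \<le> \<bar>w i * \<xi> 0 \<omega>\<bar> powr p" using u p by (intro powr_mono2) auto
        then have "1 \<le> u powr (- p) * (\<bar>w i\<bar> powr p * \<bar>\<xi> 0 \<omega>\<bar> powr p)"
          using u by (simp add: abs_mult powr_mult powr_minus field_simps)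
        then show ?thesis by (simp add: indicator_def mult.assoc)
      qed simp
    qed (simp add: emeasure_eq_measure)
    finally show ?thesis by (simp add: mom_def mult_ac)
  qed
  have "jumps w u \<le> (\<Sum>\<^sub>\<infinity>i. mom p * u powr (- p) * \<bar>w i\<bar> powr p)"
    unfolding jumps_eq_infsum
  proof (intro infsum_mono one summable_on_cmult_right lyap_summable[OF w p])
    show "(\<lambda>i. prob {\<omega> \<in> space M. u \<le> w i * \<xi> 0 \<omega>}) summable_on UNIV"
      by (rule summable_on_comparison_test[OF summable_on_cmult_right[OF lyap_summable[OF w p]]])
        (rule one, simp)
  qed
  also have "\<dots> = mom p * u powr (- p) * lyap w p"
    unfolding lyap_def by (intro infsum_cmult_right lyap_summable[OF w p])
  finally show ?thesis .
qed

abbreviation tsum :: "(int \<Rightarrow> real) \<Rightarrow> real \<Rightarrow> int set \<Rightarrow> 'a \<Rightarrow> real" where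
  "tsum w \<equiv> indep_centered.tsum (\<lambda>i \<omega>. w i * \<xi> i \<omega>)"

lemma chernoff_unit:
  assumes w: "((\<lambda>i. (w i)\<^sup>2) has_sum 1) UNIV" and F: "finite F" and y: "0 \<le> y" "0 \<le> l"
    and le: "l\<^sup>2 * exp (l * y) / 2 - l * z \<le> c"
  shows "prob {\<omega> \<in> space M. z \<le> tsum w y F \<omega>} \<le> exp c"
proof -
  interpret W: indep_centered M "\<lambda>i \<omega>. w i * \<xi> i \<omega>" by (rule centered)
  have "sum W.var F \<le> 1"
    using finite_sum_le_has_sum[OF w F] by (simp add: var_eq)
  then have "l\<^sup>2 * exp (l * y) / 2 * sum W.var F \<le> l\<^sup>2 * exp (l * y) / 2 * 1" by (intro mult_left_mono) auto
  then have "l\<^sup>2 * exp (l * y) / 2 * sum W.var F - l * z \<le> c" using le by linarith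
  then show ?thesis using W.chernoff[OF F y, of z] by (meson exp_le_cancel_iff order_trans)
qed

text \<open>With exponent d * x / 6 the truncation factor is at most exp 1 \<le> 3, which gives 3/2
  - 3 = -3/2 times the square of the exponent, that is d^2 x^2 / 24.\<close>

lemma chernoff_crude:
  assumes w: "((\<lambda>i. (w i)\<^sup>2) has_sum 1) UNIV" and F: "finite F" and x: "0 < x" and y: "0 \<le> y" "y \<le> 1 / x"
    and d: "0 \<le> d" "d \<le> 1"
  shows "prob {\<omega> \<in> space M. d * x / 2 \<le> tsum w y F \<omega>} \<le> exp (- (d\<^sup>2 * x\<^sup>2 / 24))"
proof (rule chernoff_unit[OF w F y(1), of "d * x / 6"])
  have "d * x / 6 * y \<le> d * x / 6 * (1 / x)" using d x y by (intro mult_left_mono) auto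
  also have "\<dots> \<le> 1" using d x by simp
  finally have "exp (d * x / 6 * y) \<le> 3" using exp_le by (smt (verit, best) exp_le_cancel_iff)
  then have "(d * x / 6)\<^sup>2 * exp (d * x / 6 * y) \<le> (d * x / 6)\<^sup>2 * 3" by (intro mult_left_mono) auto
  moreover have "d * x / 6 * (d * x / 2) = 3 * (d * x / 6)\<^sup>2" "d\<^sup>2 * x\<^sup>2 / 24 = 3 / 2 * (d * x / 6)\<^sup>2"
    by (simp_all add: power2_eq_square)
  moreover have "A * E \<le> A * 3 \<Longrightarrow> A * E / 2 - 3 * A \<le> - (3 / 2 * A)" for A E :: real
    by simp
  ultimately show "(d * x / 6)\<^sup>2 * exp (d * x / 6 * y) / 2 - d * x / 6 * (d * x / 2) \<le> - (d\<^sup>2 * x\<^sup>2 / 24)"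
    by presburger
qed (use d x in auto)

lemma unit_tail_upper:
  assumes Z: "unit_sum w Z" and "0 < y" "0 < u" "z' < z" "d \<le> z' - u" "0 \<le> k"
    and "\<forall>\<^sub>F F in finite_subsets_at_top UNIV. prob {\<omega> \<in> space M. z' \<le> tsum w y F \<omega>} \<le> g"
    and "\<And>F. finite F \<Longrightarrow> prob {\<omega> \<in> space M. d \<le> tsum w y F \<omega>} \<le> k"
  shows "prob {\<omega> \<in> space M. z \<le> Z \<omega>} \<le> g + k * jumps w y + jumps w u + (jumps w y)\<^sup>2"
proof -
  interpret W: indep_centered M "\<lambda>i \<omega>. w i * \<xi> i \<omega>" by (rule centered)
  have "W.var = (\<lambda>i. (w i)\<^sup>2)" by (simp add: fun_eq_iff var_eq)
  then have "W.var summable_on UNIV" using Z by (auto simp: unit_sum_def intro: has_sum_imp_summable)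
  then show ?thesis using assms by (intro W.tail_upper[of Z y u z' z d k g]) (auto simp: unit_sum_def)
qed

lemma unit_tail_lower:
  assumes Z: "unit_sum w Z" and "0 < y" "y < v" "z < z'" "z' < v" "0 \<le> k"
    and "\<forall>\<^sub>F F in finite_subsets_at_top UNIV. g \<le> prob {\<omega> \<in> space M. z' \<le> tsum w y F \<omega>}"
    and "\<And>F. finite F \<Longrightarrow> prob {\<omega> \<in> space M. z' \<le> tsum w y F \<omega>} \<le> k"
  shows "g - k * jumps w y + (1 - 1 / (v - z')\<^sup>2) * jumps w v - (jumps w v)\<^sup>2 \<le> prob {\<omega> \<in> space M. z \<le> Z \<omega>}"
proof -
  interpret W: indep_centered M "\<lambda>i \<omega>. w i * \<xi> i \<omega>" by (rule centered)
  have "W.var = (\<lambda>i. (w i)\<^sup>2)" by (simp add: fun_eq_iff var_eq)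
  then show ?thesis using assms by (intro W.tail_lower[of Z y v z z' k g]) (auto simp: unit_sum_def)
qed

lemma absm_integrable_mono:
  assumes int: "integrable M (\<lambda>\<omega>. \<bar>\<xi> 0 \<omega>\<bar> powr p)" and r: "0 < r" "r \<le> p"
  shows "integrable M (\<lambda>\<omega>. \<bar>\<xi> 0 \<omega>\<bar> powr r)"
proof (rule Bochner_Integration.integrable_bound[of M "\<lambda>\<omega>. 1 + \<bar>\<xi> 0 \<omega>\<bar> powr p"])
  show "integrable M (\<lambda>\<omega>. 1 + \<bar>\<xi> 0 \<omega>\<bar> powr p)" using int by simp
  have "u powr r \<le> 1 + u powr p" if "0 \<le> u" for u :: real
  proof (cases "u \<le> 1")
    case True
    then have "u powr r \<le> 1" using that r powr_mono2[of r u 1] by simp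
    then show ?thesis by (simp add: add_increasing2)
  next
    case False
    then have "u powr r \<le> u powr p" using r by (intro powr_mono) auto
    then show ?thesis by simp
  qed
  then show "AE \<omega> in M. norm (\<bar>\<xi> 0 \<omega>\<bar> powr r) \<le> norm (1 + \<bar>\<xi> 0 \<omega>\<bar> powr p)" by simp
qed measurable

text \<open>The slack v is positive so that the mean-square limit can be taken, and below the scale
  1 / max x 1 on which the Gaussian tail changes.\<close>

definition gauss_window :: "(int \<Rightarrow> real) \<Rightarrow> real \<Rightarrow> real \<Rightarrow> bool" where
  "gauss_window w e x \<longleftrightarrow> (\<exists>v>0. v * max x 1 \<le> 1 / 8 \<and>
     (\<forall>\<^sub>F F in finite_subsets_at_top UNIV.
       prob {\<omega> \<in> space M. x - v \<le> tsum w (1 / max x 1) F \<omega>} \<le> (1 + e) * (1 - std_normal_cdf x)) \<and>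
     (\<forall>\<^sub>F F in finite_subsets_at_top UNIV.
       (1 - e) * (1 - std_normal_cdf x) \<le> prob {\<omega> \<in> space M. x + v \<le> tsum w (1 / max x 1) F \<omega>}))"

text \<open>The logarithm absorbs every power of \<open>x\<close> when \<open>x\<^sup>2\<close> is at most a multiple of
  \<open>ln (1 / lyap w s)\<close>.\<close>

lemma gauss_uniform:
  assumes r: "2 < r" "r \<le> 3" and int: "integrable M (\<lambda>\<omega>. \<bar>\<xi> 0 \<omega>\<bar> powr r)"
    and s: "2 \<le> s" and e: "0 < e" and L: "0 \<le> L" and K: "0 < K"
  obtains U0 where "0 < U0" "U0 < 1"
    "\<And>(w :: int \<Rightarrow> real) x. ((\<lambda>i. (w i)\<^sup>2) has_sum 1) UNIV \<Longrightarrow> lyap w s \<le> U0 \<Longrightarrow> - L \<le> x \<Longrightarrow>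
      x \<le> L \<or> x\<^sup>2 \<le> K * ln (inverse (lyap w s)) \<Longrightarrow>
      gauss_window w e x"
proof -
  define \<tau> where "\<tau> = min 1 (e / (2 * shift_c))"
  have tau: "0 < \<tau>" "\<tau> \<le> 1" "shift_c * \<tau> \<le> e / 2"
  proof -
    show "0 < \<tau>" "\<tau> \<le> 1" using e shift_c_pos by (auto simp: \<tau>_def)
    have "shift_c * \<tau> \<le> shift_c * (e / (2 * shift_c))" using shift_c_pos by (intro mult_left_mono) (auto simp: \<tau>_def)
    then show "shift_c * \<tau> \<le> e / 2" using shift_c_pos by simp
  qed
  define c0 where "c0 = 48 * exp 3 * 8 ^ 3 / \<tau> ^ 3 * tilt_c L"
  have c0: "0 \<le> c0" using tau tilt_c_nonneg by (simp add: c0_def)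
  define m where "m = mom r + 1"
  have m: "1 \<le> m" using mom_nonneg by (simp add: m_def)
  \<comment> \<open>The common exponent of U under which both error sources fall: the largest
    weight, of order U powr (1 / s), and the sum of r-th powers, of order U powr ((r - 2) /
    s).\<close>
  define a where "a = min (1 / s) ((r - 2) / s)"
  have a: "0 < a" "a \<le> 1 / s" "a \<le> (r - 2) / s" using r s by (auto simp: a_def)
  define e0 where "e0 = min (1 / m) (e / (2 * ((c0 + 1) * m)))"
  have e0: "0 < e0" using m c0 e by (simp add: e0_def)
  have "((\<lambda>U. (1 + L + K * ln (inverse U)) ^ 9 * U powr a) \<longlongrightarrow> 0) (at_right 0)"
    using a(1) K by real_asymp
  then have "\<forall>\<^sub>F U in at_right 0. (1 + L + K * ln (inverse U)) ^ 9 * U powr a < e0"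
    using e0 by (intro order_tendstoD(2))
  then obtain b where b: "0 < b" "\<And>U. 0 < U \<Longrightarrow> U < b \<Longrightarrow> (1 + L + K * ln (inverse U)) ^ 9 * U powr a < e0"
    unfolding eventually_at_right_field by auto
  show thesis
  proof (rule that[of "min (b / 2) (1 / 2)"])
    fix w :: "int \<Rightarrow> real" and x :: real
    assume w: "((\<lambda>i. (w i)\<^sup>2) has_sum 1) UNIV" and U: "lyap w s \<le> min (b / 2) (1 / 2)" and x: "- L \<le> x"
      and xK: "x \<le> L \<or> x\<^sup>2 \<le> K * ln (inverse (lyap w s))"
    interpret W: indep_centered M "\<lambda>i \<omega>. w i * \<xi> i \<omega>" by (rule centered)
    define U where "U = lyap w s"
    define l where "l = max x 1"
    have Upos: "0 < U" "U < b" "U \<le> 1" using lyap_pos[OF w s] U b(1) by (auto simp: U_def)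
    have lnU: "0 \<le> ln (inverse U)" using Upos by (intro ln_ge_zero) (simp add: one_le_inverse)
    have KlnU: "0 \<le> K * ln (inverse U)" using lnU K by (intro mult_nonneg_nonneg) auto
    have l1: "1 \<le> l" by (simp add: l_def)
    have lle: "l \<le> 1 + L + K * ln (inverse U)"
    proof (cases "x \<le> 1 + L")
      case False
      then have "x \<le> x\<^sup>2" using L by (simp add: power2_eq_square)
      then have "x \<le> K * ln (inverse U)" using False xK by (auto simp: U_def)
      then show ?thesis using L KlnU by (simp add: l_def)
    qed (use L KlnU in \<open>auto simp: l_def\<close>)
    have l9: "l ^ 9 * U powr a \<le> e0"
    proof -
      have "l ^ 9 * U powr a \<le> (1 + L + K * ln (inverse U)) ^ 9 * U powr a"
        using lle l1 by (intro mult_right_mono power_mono) auto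
      then show ?thesis using b(2)[OF Upos(1,2)] by simp
    qed
    define R where "R = m * U powr a"
    have l9R: "l ^ 9 * R \<le> 1" "c0 * l ^ 9 * R \<le> e / 2"
    proof -
      have eq: "l ^ 9 * R = m * (l ^ 9 * U powr a)" by (simp add: R_def)
      also have "\<dots> \<le> m * e0" using l9 m by (intro mult_left_mono) auto
      also have "\<dots> \<le> m * (1 / m)" using m by (intro mult_left_mono) (auto simp: e0_def)
      finally show "l ^ 9 * R \<le> 1" using m by simp
      have "c0 * (l ^ 9 * R) = c0 * m * (l ^ 9 * U powr a)" by (simp add: eq)
      also have "\<dots> \<le> (c0 + 1) * m * e0" using l9 m c0 l1 by (intro mult_mono mult_right_mono) auto
      also have "\<dots> \<le> (c0 + 1) * m * (e / (2 * ((c0 + 1) * m)))"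
        using m c0 by (intro mult_left_mono) (auto simp: e0_def)
      also have "\<dots> = e / 2"
      proof -
        have "0 < (c0 + 1) * m" using m c0 by simp
        then show ?thesis by (metis less_irrefl mult.commute mult_divide_mult_cancel_left mult.right_neutral times_divide_eq_right)
      qed
      finally show "c0 * l ^ 9 * R \<le> e / 2" by (simp add: mult.assoc)
    qed
    have R0: "0 \<le> R" using m by (simp add: R_def)
    have lw: "l * sqrt (W.var i) \<le> 1" for i
    proof -
      have "l * sqrt (W.var i) = l * \<bar>w i\<bar>" by (simp add: var_eq)
      also have "\<dots> \<le> l ^ 9 * U powr (1 / s)"
        using weight_le_lyap[OF w s, of i] l1 power_increasing[of 1 9 l] by (intro mult_mono) (auto simp: U_def)
      also have "\<dots> \<le> l ^ 9 * (m * U powr a)"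
      proof (intro mult_left_mono)
        have "U powr (1 / s) \<le> U powr a" using Upos a by (intro powr_mono') auto
        also have "\<dots> \<le> m * U powr a" using m mult_right_mono[of 1 m "U powr a"] by simp
        finally show "U powr (1 / s) \<le> m * U powr a" .
      qed (use l1 in auto)
      also have "\<dots> \<le> 1" using l9R by (simp add: R_def)
      finally show ?thesis .
    qed
    have lR: "l ^ 3 * R \<le> 1"
    proof -
      have "l ^ 3 * R \<le> l ^ 9 * R" using l1 R0 by (intro mult_right_mono power_increasing) auto
      then show ?thesis using l9R by simp
    qed
    have RF: "(\<Sum>i\<in>F. W.absm r i + sqrt (W.var i) powr r) \<le> R" if F: "finite F" for F
    proof -
      have "(\<Sum>i\<in>F. W.absm r i + sqrt (W.var i) powr r) = m * (\<Sum>i\<in>F. \<bar>w i\<bar> powr r)"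
        by (simp add: absm_eq var_eq m_def sum_distrib_left algebra_simps sum.distrib)
      also have "\<dots> \<le> m * lyap w r"
        unfolding lyap_def using r m F by (intro mult_left_mono finite_sum_le_infsum lyap_summable[OF w]) auto
      also have "\<dots> \<le> m * U powr ((r - 2) / s)"
        unfolding U_def using r s m by (intro mult_left_mono lyap_le_powr[OF w]) auto
      also have "\<dots> \<le> R" unfolding R_def using Upos a m by (intro mult_left_mono powr_mono') auto
      finally show ?thesis .
    qed
    define v where "v = \<tau> / (8 * l\<^sup>2)"
    let ?G = "shift_c * \<tau> + 48 * exp 3 * 8 ^ 3 / \<tau> ^ 3 * tilt_c L * l ^ 9 * R"
    have G: "?G \<le> e" using tau(3) l9R(2) by (simp add: c0_def)
    have Q: "0 \<le> 1 - std_normal_cdf x" using std_normal_tail_pos[of x] by simp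
    have varsum: "(W.var has_sum 1) UNIV"
      using w by (subst has_sum_cong[of _ _ "\<lambda>i. (w i)\<^sup>2"]) (auto simp: var_eq)
    have intw: "integrable M (\<lambda>\<omega>. \<bar>w i * \<xi> i \<omega>\<bar> powr r)" for i by (rule absm_integrable[OF int])
    note G2 = W.gauss_tsum_eventually[OF varsum less_imp_le[OF r(1)] r(2) intw RF x l_def lw lR tau(1,2) v_def]
    have up: "\<forall>\<^sub>F F in finite_subsets_at_top UNIV.
        prob {\<omega> \<in> space M. x - v \<le> tsum w (1 / l) F \<omega>} \<le> (1 + ?G) * (1 - std_normal_cdf x)"
      and lo: "\<forall>\<^sub>F F in finite_subsets_at_top UNIV.
        (1 - ?G) * (1 - std_normal_cdf x) \<le> prob {\<omega> \<in> space M. x + v \<le> tsum w (1 / l) F \<omega>}"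
      by (rule G2, assumption)+
    have "\<forall>\<^sub>F F in finite_subsets_at_top UNIV. prob {\<omega> \<in> space M. x - v \<le> tsum w (1 / l) F \<omega>} \<le> (1 + e) * (1 - std_normal_cdf x)"
      using up
    proof eventually_elim
      case (elim F)
      also have "(1 + ?G) * (1 - std_normal_cdf x) \<le> (1 + e) * (1 - std_normal_cdf x)"
        using G by (intro mult_right_mono Q) linarith
      finally show ?case .
    qed
    moreover have "\<forall>\<^sub>F F in finite_subsets_at_top UNIV. (1 - e) * (1 - std_normal_cdf x) \<le> prob {\<omega> \<in> space M. x + v \<le> tsum w (1 / l) F \<omega>}"
      using lo
    proof eventually_elim
      case (elim F)
      have "(1 - e) * (1 - std_normal_cdf x) \<le> (1 - ?G) * (1 - std_normal_cdf x)"
        using G by (intro mult_right_mono Q) linarith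
      also note elim
      finally show ?case .
    qed
    moreover have "0 < v" using tau l1 by (simp add: v_def)
    moreover have "v * l \<le> 1 / 8"
    proof -
      have "v * l = \<tau> / (8 * l)" using l1 by (simp add: v_def power2_eq_square)
      also have "\<dots> \<le> 1 / 8" using tau l1 by (simp add: divide_simps)
      finally show ?thesis .
    qed
    ultimately show "gauss_window w e x"
      unfolding gauss_window_def l_def by blast
  qed (use b in auto)
qed

end

text \<open>Under a moment condition alone x^2 is bounded but the sign of x is free. Far to the left
  both probabilities are close to 1, and L marks where that argument takes over.\<close>

lemma std_normal_tail_at_bot:
  assumes "0 < e"
  obtains L where "1 \<le> L" "1 - e \<le> 1 - std_normal_cdf (- L)"
proof -
  have "(std_normal_cdf \<longlongrightarrow> 0) at_bot"
    by (rule finite_borel_measure.cdf_lim_at_bot[OF real_distribution.finite_borel_measure_M[OF real_dist_normal_dist]])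
  then have "\<forall>\<^sub>F x in at_bot. std_normal_cdf x < e" using assms by (rule order_tendstoD(2))
  then obtain N where N: "\<And>x. x \<le> N \<Longrightarrow> std_normal_cdf x < e" unfolding eventually_at_bot_linorder by auto
  have "- max 1 (- N) \<le> N" by linarith
  from N[OF this] show thesis by (intro that[of "max 1 (- N)"]) simp_all
qed

lemma rel_error_iff: "\<bar>P - Q\<bar> \<le> e * Q \<longleftrightarrow> (1 - e) * Q \<le> P \<and> P \<le> (1 + e) * (Q :: real)"
  by (auto simp: abs_le_iff algebra_simps)

lemma one_minus_inverse_nonneg: "1 \<le> X \<Longrightarrow> 0 \<le> 1 - 1 / (X :: real)"
  by (simp add: divide_le_eq_1)

section \<open>The normal regime under a moment condition\<close>

context iid_unit
begin

lemma tail_prob_antimono: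
  assumes "unit_sum w Z" "x \<le> y"
  shows "prob {\<omega> \<in> space M. y \<le> Z \<omega>} \<le> prob {\<omega> \<in> space M. x \<le> Z \<omega>}"
proof -
  have [measurable]: "Z \<in> borel_measurable M" using assms(1) by (auto simp: unit_sum_def has_mean_square_sum_def)
  show ?thesis using assms(2) by (intro finite_measure_mono) auto
qed

lemma jumps_markov_scaled:
  assumes w: "((\<lambda>i. (w i)\<^sup>2) has_sum 1) UNIV" and p: "2 \<le> p" and l: "0 < l" "1 / l \<le> u"
    and int: "integrable M (\<lambda>\<omega>. \<bar>\<xi> 0 \<omega>\<bar> powr p)"
  shows "jumps w u \<le> mom p * l powr p * lyap w p"
proof -
  have u: "0 < u" using l by (meson divide_pos_pos less_le_trans zero_less_one)
  have "jumps w u \<le> mom p * u powr (- p) * lyap w p" by (rule jumps_markov[OF w p u int])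
  also have "u powr (- p) \<le> (1 / l) powr (- p)" using l p by (intro powr_mono2') auto
  also have "(1 / l) powr (- p) = l powr p" using l by (simp add: powr_divide powr_minus)
  finally show ?thesis using mom_nonneg lyap_pos[OF w p] by (simp add: mult_left_mono mult_right_mono)
qed

text \<open>Weights of both signs are allowed, so jumps are bounded by Markov's inequality instead
  of regular variation. The assumption on x says that the quotient is at most exp(-x^2/2), and all
  jump terms inherit this factor.\<close>

lemma gauss_regime:
  assumes p: "2 < p" and int: "integrable M (\<lambda>\<omega>. \<bar>\<xi> 0 \<omega>\<bar> powr p)" and e: "0 < e" "e \<le> 1"
  obtains U0 where "0 < U0" "U0 < 1"
    "\<And>(w :: int \<Rightarrow> real) Z x. unit_sum w Z \<Longrightarrow> lyap w p \<le> U0 \<Longrightarrow> x\<^sup>2 \<le> 2 * ln (inverse (lyap w p)) \<Longrightarrow>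
      \<bar>prob {\<omega> \<in> space M. x \<le> Z \<omega>} - (1 - std_normal_cdf x)\<bar> \<le> e * (1 - std_normal_cdf x)"
proof -
  define r where "r = min p 3"
  have r: "2 < r" "r \<le> 3" "r \<le> p" using p by (auto simp: r_def)
  have intr: "integrable M (\<lambda>\<omega>. \<bar>\<xi> 0 \<omega>\<bar> powr r)" using r by (intro absm_integrable_mono[OF int]) auto
  have p2: "2 \<le> p" using p by simp
  define m where "m = mom p"
  have m: "0 \<le> m" by (simp add: m_def mom_nonneg)
  \<comment> \<open>The three jump contributions divided by exp(-x^2/2)/x: a jump above 1/x with a
    large rest, a single jump above x/2, and two jumps. Each tends to 0; for the middle one this is
    x * x powr (- p) with p > 1.\<close>
  define B where "B x = m * (x powr (p + 1) * exp (- (x\<^sup>2 / 96))) + m * (x * (2 / x) powr p) + m\<^sup>2 * (x powr (2 * p + 1) * exp (- (x\<^sup>2 / 2)))" for x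
  have "((\<lambda>x. x powr (p + 1) * exp (- (x\<^sup>2 / 96))) \<longlongrightarrow> 0) at_top"
    "((\<lambda>x. x * (2 / x) powr p) \<longlongrightarrow> 0) at_top"
    "((\<lambda>x. x powr (2 * p + 1) * exp (- (x\<^sup>2 / 2))) \<longlongrightarrow> 0) at_top"
    using p by real_asymp+
  then have "(B \<longlongrightarrow> m * 0 + m * 0 + m\<^sup>2 * 0) at_top"
    unfolding B_def[abs_def] by (intro tendsto_intros)
  then have "\<forall>\<^sub>F x in at_top. B x < e / 4 * mills_c" using e mills_c_pos by (intro order_tendstoD(2)) auto
  then obtain L1 where L1: "1 \<le> L1" "\<And>x. L1 \<le> x \<Longrightarrow> B x < e / 4 * mills_c"
    by (rule eventually_at_top_pos) blast
  obtain L2 where L2: "1 \<le> L2" "1 - e / 2 \<le> 1 - std_normal_cdf (- L2)"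
    using std_normal_tail_at_bot[of "e / 2"] e by auto
  define L where "L = max L1 L2"
  have L: "1 \<le> L" "L1 \<le> L" using L1 by (auto simp: L_def)
  have LQ: "1 - e / 2 \<le> 1 - std_normal_cdf (- L)"
    using L2(2) std_normal_cdf_mono[of "- L" "- L2"] by (simp add: L_def)
  have L0: "0 \<le> L" and e4: "0 < e / 4" using L e by auto
  obtain U1 where U1: "0 < U1" "U1 < 1"
    "\<And>(w :: int \<Rightarrow> real) x. ((\<lambda>i. (w i)\<^sup>2) has_sum 1) UNIV \<Longrightarrow> lyap w p \<le> U1 \<Longrightarrow> - L \<le> x \<Longrightarrow>
      x \<le> L \<or> x\<^sup>2 \<le> 2 * ln (inverse (lyap w p)) \<Longrightarrow>
      gauss_window w (e / 4) x"
    by (rule gauss_uniform[OF r(1,2) intr p2 e4 L0 zero_less_numeral]) blast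
  define qL where "qL = 1 - std_normal_cdf L"
  have qL: "0 < qL" "qL \<le> 1"
    using std_normal_tail_pos[of L] std_normal_cdf_nonneg[of L]
    by (auto simp: qL_def)
  have "0 < e / 12 * qL" using e qL by simp
  then obtain U2 where U2: "0 < U2" "U2 < 1" "\<And>U. 0 < U \<Longrightarrow> U \<le> U2 \<Longrightarrow> m * L powr p * U powr 1 \<le> e / 12 * qL"
    using powr_small[OF zero_less_one, of "e / 12 * qL" "m * L powr p"] by metis
  \<comment> \<open>On a bounded interval the Gaussian tail is at least the constant qL, so jump
    terms of order U are relatively negligible. Each of the three terms may use e / 12.\<close>
  have mid: "\<bar>prob {\<omega> \<in> space M. x \<le> Z \<omega>} - (1 - std_normal_cdf x)\<bar> \<le> e / 2 * (1 - std_normal_cdf x)"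
    if Z: "unit_sum w Z" and U: "lyap w p \<le> min U1 U2" and x: "- L \<le> x" "x \<le> L" for w Z x
  proof -
    have w: "((\<lambda>i. (w i)\<^sup>2) has_sum 1) UNIV" using Z by (simp add: unit_sum_def)
    define l where "l = max x 1"
    let ?Q = "1 - std_normal_cdf x" and ?P = "prob {\<omega> \<in> space M. x \<le> Z \<omega>}"
    have l: "1 \<le> l" "l \<le> L" "x \<le> l" using x L by (auto simp: l_def)
    have Q: "qL \<le> ?Q" using std_normal_cdf_mono[OF x(2)] by (simp add: qL_def)
    obtain v where v: "0 < v" "v * l \<le> 1 / 8"
      and up: "\<forall>\<^sub>F F in finite_subsets_at_top UNIV. prob {\<omega> \<in> space M. x - v \<le> tsum w (1 / l) F \<omega>} \<le> (1 + e / 4) * ?Q"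
      and lo: "\<forall>\<^sub>F F in finite_subsets_at_top UNIV. (1 - e / 4) * ?Q \<le> prob {\<omega> \<in> space M. x + v \<le> tsum w (1 / l) F \<omega>}"
      using U1(3)[OF w _ x(1)] x(2) U unfolding gauss_window_def l_def by auto
    have "v * 1 \<le> v * l" using v l by (intro mult_left_mono) auto
    then have v8: "v \<le> 1 / 8" using v(2) unfolding mult_1_right by (rule order_trans)
    have Upos: "0 < lyap w p" by (rule lyap_pos[OF w p2])
    define s where "s = e / 12 * ?Q"
    have J: "jumps w u \<le> s" if "1 / l \<le> u" for u
    proof -
      have "jumps w u \<le> mom p * l powr p * lyap w p"
        using l that by (intro jumps_markov_scaled[OF w p2 _ _ int]) auto
      also have "\<dots> \<le> m * L powr p * lyap w p"
        using l m p Upos by (intro mult_right_mono mult_mono powr_mono2) (auto simp: m_def)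
      also have "\<dots> \<le> e / 12 * qL" using U2(3)[OF Upos] U Upos by simp
      also have "\<dots> \<le> s" unfolding s_def using Q e by (intro mult_left_mono) auto
      finally show ?thesis .
    qed
    have "?Q \<le> 1"
      using std_normal_cdf_nonneg[of x] by simp
    then have s: "0 \<le> s" "s \<le> 1" using e Q qL mult_mono[of "e / 12" 1 ?Q 1] by (auto simp: s_def)
    have J2: "(jumps w u)\<^sup>2 \<le> s" if "1 / l \<le> u" for u
      using mult_mono[OF J[OF that] order_trans[OF J[OF that] s(2)]] jumps_nonneg[of w u] s
      by (simp add: power2_eq_square)
    have ll: "1 / l \<le> 1" using l by simp
    have lL: "1 / l < L + 3" using ll L by linarith
    have "?P \<le> (1 + e / 4) * ?Q + 1 * jumps w (1 / l) + jumps w 1 + (jumps w (1 / l))\<^sup>2"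
      using l v by (intro unit_tail_upper[OF Z _ _ _ _ _ up]) auto
    also have "\<dots> \<le> (1 + e / 4) * ?Q + s + s + s"
      using J[of "1 / l"] J[OF ll] J2[of "1 / l"] by simp
    also have "\<dots> = (1 + e / 2) * ?Q" by (simp add: s_def algebra_simps)
    finally have "?P \<le> (1 + e / 2) * ?Q" .
    moreover have "(1 - e / 2) * ?Q \<le> ?P"
    proof -
      have "(1 - e / 4) * ?Q - 1 * jumps w (1 / l) + (1 - 1 / (L + 3 - (x + v))\<^sup>2) * jumps w (L + 3) - (jumps w (L + 3))\<^sup>2 \<le> ?P"
        using l v v8 lL x by (intro unit_tail_lower[OF Z _ _ _ _ _ lo]) auto
      moreover have "0 \<le> (1 - 1 / (L + 3 - (x + v))\<^sup>2) * jumps w (L + 3)"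
      proof (intro mult_nonneg_nonneg jumps_nonneg)
        have "1 \<le> (L + 3 - (x + v))\<^sup>2" using x v8 by (intro one_le_power) auto
        then show "0 \<le> 1 - 1 / (L + 3 - (x + v))\<^sup>2" by (rule one_minus_inverse_nonneg)
      qed
      moreover have "jumps w (1 / l) \<le> s" by (rule J) simp
      moreover have "(jumps w (L + 3))\<^sup>2 \<le> s" using ll L by (intro J2) simp
      moreover have "(1 - e / 2) * ?Q \<le> (1 - e / 4) * ?Q - s - s"
      proof -
        have "(1 - e / 2) * q \<le> (1 - e / 4) * q - e / 12 * q - e / 12 * q" if "0 \<le> e * q" for q
          using that by (simp add: algebra_simps)
        moreover have "0 \<le> e * ?Q" using e Q qL by simp
        ultimately show ?thesis unfolding s_def by blast
      qed
      ultimately show ?thesis by linarith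
    qed
    ultimately show ?thesis unfolding rel_error_iff by blast
  qed
  show thesis
  proof (rule that[of "min U1 U2"])
    fix w :: "int \<Rightarrow> real" and Z :: "'a \<Rightarrow> real" and x :: real
    assume Z: "unit_sum w Z" and U: "lyap w p \<le> min U1 U2" and xU: "x\<^sup>2 \<le> 2 * ln (inverse (lyap w p))"
    let ?Q = "1 - std_normal_cdf x" and ?P = "prob {\<omega> \<in> space M. x \<le> Z \<omega>}"
    have w: "((\<lambda>i. (w i)\<^sup>2) has_sum 1) UNIV" using Z by (simp add: unit_sum_def)
    have Q0: "0 < ?Q" by (rule std_normal_tail_pos)
    have Upos: "0 < lyap w p" by (rule lyap_pos[OF w p2])
    consider "x < - L" | "- L \<le> x" "x \<le> L" | "L < x" by linarith
    then show "\<bar>?P - ?Q\<bar> \<le> e * ?Q"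
    proof cases
      case 1
      \<comment> \<open>To the left of -L monotonicity carries over the lower bound obtained at -L,
        and 1 is the upper bound for both probabilities.\<close>
      have Qx: "1 - e / 2 \<le> ?Q" using LQ std_normal_cdf_mono[of x "- L"] 1 by simp
      have "\<bar>prob {\<omega> \<in> space M. - L \<le> Z \<omega>} - (1 - std_normal_cdf (- L))\<bar> \<le> e / 2 * (1 - std_normal_cdf (- L))"
        using L by (intro mid[OF Z U]) auto
      then have "(1 - e / 2) * (1 - std_normal_cdf (- L)) \<le> prob {\<omega> \<in> space M. - L \<le> Z \<omega>}"
        unfolding rel_error_iff by blast
      also have "\<dots> \<le> ?P" using 1 by (intro tail_prob_antimono[OF Z]) auto
      finally have low: "(1 - e / 2) * (1 - std_normal_cdf (- L)) \<le> ?P" .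
      have Q1: "?Q \<le> 1"
        using std_normal_cdf_nonneg[of x] by simp
      have "(1 - e) * ?Q \<le> (1 - e) * 1" using Q1 e by (intro mult_left_mono) auto
      also have "\<dots> \<le> (1 - e / 2) * (1 - e / 2)" using e by (simp add: algebra_simps)
      also have "\<dots> \<le> (1 - e / 2) * (1 - std_normal_cdf (- L))" using LQ e by (intro mult_left_mono) auto
      also note low
      finally have lower: "(1 - e) * ?Q \<le> ?P" .
      have "e * (1 / 2) \<le> e * (1 - e / 2)" using e by (intro mult_left_mono) auto
      also have "\<dots> \<le> e * ?Q" using Qx e by (intro mult_left_mono) auto
      finally have "e / 2 \<le> e * ?Q" by simp
      moreover have "?P \<le> 1" by simp
      ultimately have "?P \<le> ?Q + e * ?Q" using Qx by linarith
      then show ?thesis using lower unfolding rel_error_iff distrib_right by simp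
    next
      case 2
      have "e / 2 * ?Q \<le> e * ?Q" using e Q0 by (intro mult_right_mono) auto
      then show ?thesis using mid[OF Z U 2] by linarith
    next
      case 3
      then have x: "1 \<le> x" "L1 \<le> x" "max x 1 = x" "- L \<le> x" using L by auto
      define E where "E = exp (- (x\<^sup>2 / 2))"
      have UE: "lyap w p \<le> E"
      proof -
        have "ln (lyap w p) \<le> - (x\<^sup>2 / 2)" using xU Upos by (simp add: ln_inverse)
        then show ?thesis using Upos unfolding E_def by (metis exp_le_cancel_iff exp_ln)
      qed
      obtain v where v: "0 < v" "v * x \<le> 1 / 8"
        and up: "\<forall>\<^sub>F F in finite_subsets_at_top UNIV. prob {\<omega> \<in> space M. x - v \<le> tsum w (1 / x) F \<omega>} \<le> (1 + e / 4) * ?Q"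
        and lo: "\<forall>\<^sub>F F in finite_subsets_at_top UNIV. (1 - e / 4) * ?Q \<le> prob {\<omega> \<in> space M. x + v \<le> tsum w (1 / x) F \<omega>}"
        using U1(3)[OF w _ x(4)] xU U unfolding gauss_window_def x(3) by auto
      have "v * 1 \<le> v * x" using v x by (intro mult_left_mono) auto
      then have v8: "v \<le> 1 / 8" using v(2) unfolding mult_1_right by (rule order_trans)
      define k where "k = exp (- (x\<^sup>2 / 96))"
      have k: "prob {\<omega> \<in> space M. x / 4 \<le> tsum w (1 / x) F \<omega>} \<le> k" if "finite F" for F
        using chernoff_crude[OF w that, of x "1 / x" "1 / 2"] x by (simp add: k_def power_divide)
      have k': "prob {\<omega> \<in> space M. x + v \<le> tsum w (1 / x) F \<omega>} \<le> k" if "finite F" for F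
      proof -
        interpret W: indep_centered M "\<lambda>i \<omega>. w i * \<xi> i \<omega>" by (rule centered)
        have "prob {\<omega> \<in> space M. x + v \<le> tsum w (1 / x) F \<omega>} \<le> prob {\<omega> \<in> space M. x / 4 \<le> tsum w (1 / x) F \<omega>}"
          using x v by (intro finite_measure_mono) auto
        then show ?thesis using k[OF that] by linarith
      qed
      have k0: "0 \<le> k" by (simp add: k_def)
      have J: "jumps w u \<le> m * x powr p * E" if "1 / x \<le> u" for u
      proof -
        have "jumps w u \<le> mom p * x powr p * lyap w p"
          using x that by (intro jumps_markov_scaled[OF w p2 _ _ int]) auto
        also have "\<dots> \<le> m * x powr p * E" using UE m by (simp add: m_def mult_left_mono)
        finally show ?thesis .
      qed
      have Jh: "jumps w (x / 2) \<le> m * (2 / x) powr p * E"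
      proof -
        have "jumps w (x / 2) \<le> mom p * (2 / x) powr p * lyap w p"
          using x by (intro jumps_markov_scaled[OF w p2 _ _ int]) auto
        also have "\<dots> \<le> m * (2 / x) powr p * E" using UE m by (simp add: m_def mult_left_mono)
        finally show ?thesis .
      qed
      have J2: "(jumps w u)\<^sup>2 \<le> (m * x powr p * E)\<^sup>2" if "1 / x \<le> u" for u
        using J[OF that] jumps_nonneg by (intro power_mono)
      have E0: "0 < E" by (simp add: E_def)
      have BE: "m * x powr p * E * k + m * (2 / x) powr p * E + (m * x powr p * E)\<^sup>2 = E / x * B x"
      proof -
        have "x powr (p + 1) = x powr p * x" using x by (simp add: powr_add)
        moreover have "x powr (2 * p + 1) = (x powr p * x powr p) * x"
          using x powr_add[of x p p] powr_add[of x "p + p" 1] by (simp only: mult_2) simp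
        moreover have "m * A * E * k + m * D * E + (m * A * E)\<^sup>2 =
            E / x * (m * (A * x * k) + m * (x * D) + m\<^sup>2 * (A * A * x * E))" for A D
          using x by (simp add: power2_eq_square field_simps)
        ultimately show ?thesis unfolding B_def k_def[symmetric] E_def[symmetric] by (simp only:)
      qed
      have "E / x * B x \<le> E / x * (e / 4 * mills_c)"
        using L1(2)[OF x(2)] E0 x by (intro mult_left_mono) auto
      also have "\<dots> = e / 4 * (mills_c * exp (- x\<^sup>2 / 2) / x)" by (simp add: E_def mult_ac)
      also have "\<dots> \<le> e / 4 * ?Q" using e x by (intro mult_left_mono std_normal_tail_ge) auto
      finally have small: "m * x powr p * E * k + m * (2 / x) powr p * E + (m * x powr p * E)\<^sup>2 \<le> e / 4 * ?Q"
        using BE by simp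
      have nn: "0 \<le> m * (2 / x) powr p * E" "0 \<le> m * x powr p * E * k" using m E0 k0 by auto
      have "?P \<le> (1 + e / 4) * ?Q + k * jumps w (1 / x) + jumps w (x / 2) + (jumps w (1 / x))\<^sup>2"
        using x v v8 k k0 by (intro unit_tail_upper[where d = "x / 4", OF Z _ _ _ _ _ up]) auto
      moreover have kJ: "k * jumps w (1 / x) \<le> m * x powr p * E * k"
        using mult_right_mono[OF J k0, of "1 / x"] by (simp add: mult.commute)
      moreover have "(jumps w (1 / x))\<^sup>2 \<le> (m * x powr p * E)\<^sup>2" by (rule J2) simp
      ultimately have "?P \<le> (1 + e / 4) * ?Q + e / 4 * ?Q" using small Jh by linarith
      moreover have "(1 - e / 4) * ?Q - e / 4 * ?Q \<le> ?P"
      proof -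
        have "1 / x \<le> 1" using x by simp
        then have xx: "1 / x < x + 2" using x by linarith
        have "(1 - e / 4) * ?Q - k * jumps w (1 / x) + (1 - 1 / (x + 2 - (x + v))\<^sup>2) * jumps w (x + 2) - (jumps w (x + 2))\<^sup>2 \<le> ?P"
          using x v v8 xx k' k0 by (intro unit_tail_lower[OF Z _ _ _ _ _ lo]) auto
        moreover have "0 \<le> (1 - 1 / (x + 2 - (x + v))\<^sup>2) * jumps w (x + 2)"
        proof (intro mult_nonneg_nonneg jumps_nonneg)
          have "1 \<le> (x + 2 - (x + v))\<^sup>2" using v8 by (intro one_le_power) auto
          then show "0 \<le> 1 - 1 / (x + 2 - (x + v))\<^sup>2" by (rule one_minus_inverse_nonneg)
        qed
        moreover have "(jumps w (x + 2))\<^sup>2 \<le> (m * x powr p * E)\<^sup>2" using xx by (intro J2) simp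
        ultimately show ?thesis using small kJ nn by linarith
      qed
      moreover have "0 \<le> e * ?Q" using e Q0 by auto
      moreover have "\<bar>P - q\<bar> \<le> e * q"
        if "P \<le> (1 + e / 4) * q + e / 4 * q" "(1 - e / 4) * q - e / 4 * q \<le> P" "0 \<le> e * q" for P q
        using that by (simp add: abs_le_iff algebra_simps)
      ultimately show ?thesis by blast
    qed
  qed (use U1 U2 in auto)
qed

end

section \<open>The jump regime and the transition between the regimes\<close>

context iid_unit
begin

lemma heavy_tail_tail:
  assumes "regvar t tail" "2 < t"
  shows "heavy_tail t tail"
proof
  interpret W: indep_centered M "\<lambda>i \<omega>. 1 * \<xi> i \<omega>" by (rule centered)
  show "tail u \<le> 1 / u\<^sup>2" if "0 < u" for u
    using W.prob_W_square[OF that, of 0] var_eq[of "\<lambda>_. 1" 0] by (simp add: tail_def)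
qed fact+

text \<open>A jump above (1 - d) * x or a remainder above d * x / 2 is necessary, and a jump above
  (1 + d) * x with a remainder not too negative suffices. Regular variation makes the two levels
  equivalent up to c, so the one-jump term is ?J in both directions, added to whatever bound the
  truncated sum satisfies.\<close>

lemma jump_sandwich:
  assumes w: "unit_weights w" and Z: "unit_sum w Z" and x: "1 \<le> x" and y: "0 < y" "y < (1 + d) * x"
    and d: "0 < d" "d \<le> 1 / 2" "2 \<le> d * x\<^sup>2" "4 / (d * x)\<^sup>2 \<le> c" and c: "0 < c" "c \<le> 1"
    and k0: "0 \<le> k" and k: "\<And>F. finite F \<Longrightarrow> prob {\<omega> \<in> space M. d * x / 2 \<le> tsum w y F \<omega>} \<le> k"
    and J: "k * jumps w y \<le> c * jumps w x" "(jumps w y)\<^sup>2 \<le> c * jumps w x"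
      "jumps w ((1 - d) * x) \<le> (1 + c) * jumps w x" "(1 - c) * jumps w x \<le> jumps w ((1 + d) * x)"
      "jumps w ((1 + d) * x) \<le> jumps w x" "jumps w x \<le> c"
    and v: "0 < v" "v \<le> 1 / x"
  shows "\<forall>\<^sub>F F in finite_subsets_at_top UNIV. prob {\<omega> \<in> space M. x - v \<le> tsum w y F \<omega>} \<le> g \<Longrightarrow>
      prob {\<omega> \<in> space M. x \<le> Z \<omega>} \<le> g + (1 + 3 * c) * jumps w x"
    and "\<forall>\<^sub>F F in finite_subsets_at_top UNIV. g' \<le> prob {\<omega> \<in> space M. x + v \<le> tsum w y F \<omega>} \<Longrightarrow>
      g' + (1 - 4 * c) * jumps w x \<le> prob {\<omega> \<in> space M. x \<le> Z \<omega>}"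
proof -
  interpret W: indep_centered M "\<lambda>i \<omega>. w i * \<xi> i \<omega>" by (rule centered)
  let ?J = "jumps w x"
  have "1 / x \<le> d * x / 2" using d(3) x by (simp add: field_simps power2_eq_square)
  then have vd: "v \<le> d * x / 2" using v by linarith
  have dx: "0 < d * x" "(1 - d) * x = x - d * x" "(1 + d) * x = x + d * x" using d x by (auto simp: algebra_simps)
  have dx2: "d * x \<le> x / 2" using mult_right_mono[OF d(2), of x] x by simp
  {
    assume up: "\<forall>\<^sub>F F in finite_subsets_at_top UNIV. prob {\<omega> \<in> space M. x - v \<le> tsum w y F \<omega>} \<le> g"
    have "prob {\<omega> \<in> space M. x \<le> Z \<omega>} \<le> g + k * jumps w y + jumps w ((1 - d) * x) + (jumps w y)\<^sup>2"
    proof (rule unit_tail_upper[OF Z y(1) _ _ _ k0 up k])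
      show "0 < (1 - d) * x" using d x by simp
      show "d * x / 2 \<le> x - v - (1 - d) * x" unfolding dx(2) using vd by linarith
    qed (use v in auto)
    also have "\<dots> \<le> g + c * ?J + (1 + c) * ?J + c * ?J" by (intro add_mono order_refl J)
    also have "\<dots> = g + (1 + 3 * c) * ?J" by (simp add: algebra_simps)
    finally show "prob {\<omega> \<in> space M. x \<le> Z \<omega>} \<le> g + (1 + 3 * c) * jumps w x" .
  }
  {
    assume lo: "\<forall>\<^sub>F F in finite_subsets_at_top UNIV. g' \<le> prob {\<omega> \<in> space M. x + v \<le> tsum w y F \<omega>}"
    let ?V = "jumps w ((1 + d) * x)" and ?D = "(1 + d) * x - (x + v)"
    have D: "d * x / 2 \<le> ?D" unfolding dx(3) using vd by linarith
    have k': "prob {\<omega> \<in> space M. x + v \<le> tsum w y F \<omega>} \<le> k" if "finite F" for F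
    proof -
      have "prob {\<omega> \<in> space M. x + v \<le> tsum w y F \<omega>} \<le> prob {\<omega> \<in> space M. d * x / 2 \<le> tsum w y F \<omega>}"
      proof (intro finite_measure_mono)
        have "d * x / 2 \<le> x + v" using dx2 x v by linarith
        then show "{\<omega> \<in> space M. x + v \<le> tsum w y F \<omega>} \<subseteq> {\<omega> \<in> space M. d * x / 2 \<le> tsum w y F \<omega>}"
          using order_trans by blast
      qed measurable
      then show ?thesis using k[OF that] by linarith
    qed
    have low: "g' - k * jumps w y + (1 - 1 / ?D\<^sup>2) * ?V - ?V\<^sup>2 \<le> prob {\<omega> \<in> space M. x \<le> Z \<omega>}"
    proof (rule unit_tail_lower[OF Z y _ _ k0 lo k'])
      show "x + v < (1 + d) * x" unfolding dx(3) using vd dx(1) by linarith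
    qed (use v in auto)
    have "1 / ?D\<^sup>2 \<le> 1 / (d * x / 2)\<^sup>2"
      using D dx by (intro divide_left_mono power_mono mult_pos_pos zero_less_power) auto
    also have "\<dots> = 4 / (d * x)\<^sup>2" by (simp add: power_divide)
    finally have "1 / ?D\<^sup>2 \<le> c" using d by linarith
    then have V: "(1 - c) * ?V \<le> (1 - 1 / ?D\<^sup>2) * ?V" by (intro mult_right_mono jumps_nonneg) auto
    \<comment> \<open>One factor 1 - c is lost by raising the level to (1 + d) * x, the other by
      Chebyshev's bound for the remaining summands.\<close>
    have "(1 - 2 * c) * ?J \<le> (1 - 2 * c) * ?J + c\<^sup>2 * ?J" using jumps_nonneg[of w x] by simp
    also have "\<dots> = (1 - c) * ((1 - c) * ?J)" by (simp add: power2_eq_square algebra_simps)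
    also have "\<dots> \<le> (1 - c) * ?V" using J c by (intro mult_left_mono) auto
    also note V
    finally have V1: "(1 - 2 * c) * ?J \<le> (1 - 1 / ?D\<^sup>2) * ?V" .
    have V2: "?V\<^sup>2 \<le> c * ?J"
      unfolding power2_eq_square using J c jumps_nonneg by (intro mult_mono) auto
    have "g' + (b' - a' - s') \<le> P" if "g' - a + b - s \<le> P" "a \<le> a'" "b' \<le> b" "s \<le> s'" for a b s a' b' s' P :: real
      using that by linarith
    from this[OF low J(1) V1 V2] show "g' + (1 - 4 * c) * jumps w x \<le> prob {\<omega> \<in> space M. x \<le> Z \<omega>}"
      by (simp add: algebra_simps)
  }
qed

lemma window_sizes:
  assumes "0 < d" "0 < (c::real)"
  obtains L where "1 \<le> L" "\<And>x. L \<le> x \<Longrightarrow> 2 \<le> d * x\<^sup>2 \<and> 4 / (d * x)\<^sup>2 \<le> c"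
proof -
  have "filterlim (\<lambda>x. d * x\<^sup>2) at_top at_top" using assms by real_asymp
  then have "\<forall>\<^sub>F x in at_top. 2 \<le> d * x\<^sup>2" by (simp add: filterlim_at_top)
  moreover have "((\<lambda>x. 4 / (d * x)\<^sup>2) \<longlongrightarrow> 0) at_top" using assms by real_asymp
  then have "\<forall>\<^sub>F x in at_top. 4 / (d * x)\<^sup>2 < c" using assms by (intro order_tendstoD(2))
  ultimately have "\<forall>\<^sub>F x in at_top. 2 \<le> d * x\<^sup>2 \<and> 4 / (d * x)\<^sup>2 \<le> c"
    by eventually_elim simp
  then show thesis using that by (rule eventually_at_top_pos) blast
qed

text \<open>Up to \<open>lyap w t powr (- \<kappa>)\<close> truncation at \<open>e1 / x\<close> gives a sub-Gaussian bound with constant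
  arbitrarily close to \<open>1 / 2\<close>, and two jumps are negligible. Beyond that, truncation at \<open>\<eta> * x\<close>
  gives a power of \<open>x\<close> as large as desired, which beats the polynomial jump term.\<close>

lemma jump_regime:
  assumes rv: "regvar t tail" and t: "2 < t" and A: "sqrt 2 < A" and e: "0 < e" "e \<le> 1"
  obtains U0 where "0 < U0" "U0 < 1"
    "\<And>(w :: int \<Rightarrow> real) Z x. unit_weights w \<Longrightarrow> unit_sum w Z \<Longrightarrow> lyap w t \<le> U0 \<Longrightarrow>
      A * sqrt (ln (inverse (lyap w t))) \<le> x \<Longrightarrow>
      \<bar>prob {\<omega> \<in> space M. x \<le> Z \<omega>} - jumps w x\<bar> \<le> e * jumps w x"
proof -
  interpret H: heavy_tail t tail by (rule heavy_tail_tail[OF rv t])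
  define c where "c = e / 8"
  have c: "0 < c" "c \<le> 1" "c < 1" using e by (auto simp: c_def)
  have "1 \<le> sqrt (2 :: real)" by simp
  then have A1: "1 \<le> A" using A by linarith
  obtain a L1 where a: "0 \<le> a" "a < 1 / 2" and L1: "1 \<le> L1"
    and G: "\<And>(w :: int \<Rightarrow> real) x. unit_weights w \<Longrightarrow> L1 \<le> x \<Longrightarrow> A\<^sup>2 * ln (inverse (lyap w t)) \<le> x\<^sup>2 \<Longrightarrow>
      exp (- (a * x\<^sup>2)) \<le> c * jsum tail w x"
    by (rule H.gauss_le_jsum[OF A c(1)]) blast
  \<comment> \<open>With exponent x and truncation at e1 / x, the Chernoff exponent x^2 * exp e1 / 2
    - x^2 equals - a * x^2, which the jump sum dominates. As a < 1/2, e1 is positive.\<close>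
  define e1 where "e1 = ln (2 - 2 * a)"
  have e1: "0 < e1" "e1 \<le> 1" "exp e1 = 2 - 2 * a"
    using a ln_le_minus_one[of "2 - 2 * a"] by (auto simp: e1_def)
  obtain d u0 where d: "0 < d" "d \<le> 1 / 2" and u0: "1 \<le> u0"
    and N1: "\<And>(w :: int \<Rightarrow> real) x. unit_weights w \<Longrightarrow> u0 \<le> x \<Longrightarrow> jsum tail w ((1 - d) * x) \<le> (1 + c) * jsum tail w x"
    and N2: "\<And>(w :: int \<Rightarrow> real) x. unit_weights w \<Longrightarrow> u0 \<le> x \<Longrightarrow> (1 - c) * jsum tail w x \<le> jsum tail w ((1 + d) * x)"
    by (rule H.jsum_near_one[OF c(1,3)]) blast
  obtain \<kappa> U1 L2 where k: "0 < \<kappa>" and U1: "0 < U1" "U1 < 1" and L2: "1 \<le> L2"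
    and Mo: "\<And>(w :: int \<Rightarrow> real) x. unit_weights w \<Longrightarrow> lyap w t \<le> U1 \<Longrightarrow> L2 \<le> x \<Longrightarrow> x \<le> lyap w t powr (- \<kappa>) \<Longrightarrow>
      exp (- (d\<^sup>2 * x\<^sup>2 / 24)) * jsum tail w (e1 / x) \<le> c * jsum tail w x \<and> (jsum tail w (e1 / x))\<^sup>2 \<le> c * jsum tail w x"
    by (rule H.jsum_moderate[OF c(1,2) d(1) e1(1,2)]) blast
  obtain \<eta> L3 where eta: "0 < \<eta>" "\<eta> \<le> 1 / 2" and L3: "1 \<le> L3"
    and Hu: "\<And>(w :: int \<Rightarrow> real) x. unit_weights w \<Longrightarrow> L3 \<le> x \<Longrightarrow> lyap w t powr (- \<kappa>) \<le> x \<Longrightarrow>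
      exp 1 * x powr (- d / (2 * \<eta>)) * jsum tail w (\<eta> * x) \<le> c * jsum tail w x \<and>
      (jsum tail w (\<eta> * x))\<^sup>2 \<le> c * jsum tail w x \<and> exp 1 * x powr (- 1 / (2 * \<eta>)) \<le> c * jsum tail w x"
    by (rule H.jsum_huge[OF k c(1,2) d(1)]) blast
  obtain U2 where U2: "0 < U2" "U2 < 1"
    and Sm: "\<And>(w :: int \<Rightarrow> real) x. unit_weights w \<Longrightarrow> lyap w t \<le> U2 \<Longrightarrow> 1 \<le> x \<Longrightarrow> jsum tail w x \<le> c"
    by (rule H.jsum_small[OF zero_less_one c(1)]) blast
  obtain L4 where L4: "1 \<le> L4" "\<And>x. L4 \<le> x \<Longrightarrow> 2 \<le> d * x\<^sup>2 \<and> 4 / (d * x)\<^sup>2 \<le> c"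
    by (rule window_sizes[OF d(1) c(1)]) blast
  \<comment> \<open>Prepares the Chernoff bound at level \<eta> * x with exponent ln x / (\<eta> *
    x): the truncation factor is then exactly x, and the quadratic term stays bounded.\<close>
  have "((\<lambda>x. (ln x / (\<eta> * x))\<^sup>2 * x) \<longlongrightarrow> 0) at_top" using eta by real_asymp
  then have "\<forall>\<^sub>F x in at_top. (ln x / (\<eta> * x))\<^sup>2 * x < 1" by (rule order_tendstoD(2)) simp
  then obtain L5 where L5: "1 \<le> L5" "\<And>x. L5 \<le> x \<Longrightarrow> (ln x / (\<eta> * x))\<^sup>2 * x < 1"
    by (rule eventually_at_top_pos) blast
  define L where "L = Max {L1, L2, L3, L4, L5, u0, 2}"
  show thesis
  \<comment> \<open>A quotient below exp(- L^2) forces sqrt (ln (1/U)) \<ge> L, so the assumption on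
    x yields every lower bound on x collected in L.\<close>
  proof (rule that[of "min (min U1 U2) (exp (- L\<^sup>2))"])
    show "0 < min (min U1 U2) (exp (- L\<^sup>2))" "min (min U1 U2) (exp (- L\<^sup>2)) < 1" using U1 U2 by auto
    fix w :: "int \<Rightarrow> real" and Z :: "'a \<Rightarrow> real" and x :: real
    assume w: "unit_weights w" and Z: "unit_sum w Z" and U: "lyap w t \<le> min (min U1 U2) (exp (- L\<^sup>2))"
      and xA: "A * sqrt (ln (inverse (lyap w t))) \<le> x"
    note W = unit_weightsD[OF w]
    have Upos: "0 < lyap w t" using lyap_pos[OF W(3)] t by simp
    have "2 \<le> L" unfolding L_def by (intro Max_ge) auto
    then have L0: "0 \<le> L" by simp
    have "ln (lyap w t) \<le> - L\<^sup>2" using U Upos ln_le_cancel_iff[OF Upos, of "exp (- L\<^sup>2)"] by simp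
    then have lnL: "L\<^sup>2 \<le> ln (inverse (lyap w t))" by (simp add: ln_inverse)
    then have "L \<le> sqrt (ln (inverse (lyap w t)))" using L0 by (simp add: real_le_rsqrt)
    also have "\<dots> \<le> A * sqrt (ln (inverse (lyap w t)))"
      using mult_right_mono[OF A1, of "sqrt (ln (inverse (lyap w t)))"] lnL order_trans[OF zero_le_power2 lnL] by simp
    also note xA
    finally have Lx: "L \<le> x" .
    have "u \<le> x" if "u \<in> {L1, L2, L3, L4, L5, u0, 2}" for u
    proof -
      have "u \<le> L" unfolding L_def using that by (intro Max_ge) auto
      then show ?thesis using Lx by linarith
    qed
    then have "\<forall>u\<in>{L1, L2, L3, L4, L5, u0, 2}. u \<le> x" by blast
    then have x: "L1 \<le> x" "L2 \<le> x" "L3 \<le> x" "L4 \<le> x" "L5 \<le> x" "u0 \<le> x" "2 \<le> x" "1 \<le> x"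
      by simp_all
    have "(A * sqrt (ln (inverse (lyap w t))))\<^sup>2 \<le> x\<^sup>2"
      using xA A1 order_trans[OF zero_le_power2 lnL] by (intro power_mono) auto
    then have xA2: "A\<^sup>2 * ln (inverse (lyap w t)) \<le> x\<^sup>2"
      using order_trans[OF zero_le_power2 lnL] by (simp add: power_mult_distrib)
    have Jeq: "jumps w = jsum tail w" by (simp add: fun_eq_iff jumps_eq_jsum[OF w])
    let ?J = "jumps w x" and ?P = "prob {\<omega> \<in> space M. x \<le> Z \<omega>}"
    have J: "jumps w ((1 - d) * x) \<le> (1 + c) * ?J" "(1 - c) * ?J \<le> jumps w ((1 + d) * x)"
      "jumps w ((1 + d) * x) \<le> ?J" "?J \<le> c" "0 \<le> ?J"
      using N1[OF w x(6)] N2[OF w x(6)] Sm[OF w _ x(8)] U d x H.jsum_antimono[OF w, of x "(1 + d) * x"] jumps_nonneg[of w x]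
        mult_right_mono[of 1 "1 + d" x]
      by (auto simp: Jeq)
    have v: "0 < 1 / x" "1 / x \<le> 1 / x" using x by auto
    have d': "2 \<le> d * x\<^sup>2" "4 / (d * x)\<^sup>2 \<le> c" using L4(2)[OF x(4)] by auto
    note sandwich = jump_sandwich[OF w Z x(8) _ _ d d' c(1,2) _ _ _ _ J(1-4) v]
    \<comment> \<open>In this regime the truncated sum contributes only to the upper bound; from
      below it enters as 0.\<close>
    have triv: "\<forall>\<^sub>F F in finite_subsets_at_top UNIV. 0 \<le> prob {\<omega> \<in> space M. x + 1 / x \<le> tsum w y F \<omega>}" for y
      by simp
    have "?P \<le> (1 + 6 * c) * ?J \<and> 0 + (1 - 4 * c) * ?J \<le> ?P"
    proof (cases "x \<le> lyap w t powr (- \<kappa>)")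
      case True
      let ?y = "e1 / x" and ?k = "exp (- (d\<^sup>2 * x\<^sup>2 / 24))"
      have y: "0 < ?y" "?y < (1 + d) * x" "?y \<le> 1 / x"
      proof -
        show "0 < ?y" "?y \<le> 1 / x" using e1 x by (auto simp: divide_right_mono)
        moreover have "1 / x \<le> 1" "1 * x \<le> (1 + d) * x" using x d by (auto intro!: mult_right_mono)
        ultimately show "?y < (1 + d) * x" using x by linarith
      qed
      have kk: "prob {\<omega> \<in> space M. d * x / 2 \<le> tsum w ?y F \<omega>} \<le> ?k" if "finite F" for F
        using x y d by (intro chernoff_crude[OF W(3) that]) auto
      have Jy: "?k * jumps w ?y \<le> c * ?J" "(jumps w ?y)\<^sup>2 \<le> c * ?J"
        using Mo[OF w _ x(2) True] U by (auto simp: Jeq)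
      have "prob {\<omega> \<in> space M. x - 1 / x \<le> tsum w ?y F \<omega>} \<le> 3 * (c * ?J)" if F: "finite F" for F
      proof -
        have "prob {\<omega> \<in> space M. x - 1 / x \<le> tsum w ?y F \<omega>} \<le> exp (1 + - (a * x\<^sup>2))"
        proof (rule chernoff_unit[OF W(3) F less_imp_le[OF y(1)], of x])
          have "x * ?y = e1" "x * (x - 1 / x) = x\<^sup>2 - 1" using x by (simp_all add: power2_eq_square algebra_simps)
          moreover have "x\<^sup>2 * exp e1 / 2 = x\<^sup>2 - a * x\<^sup>2"
            by (simp add: e1(3) right_diff_distrib diff_divide_distrib)
          ultimately show "x\<^sup>2 * exp (x * ?y) / 2 - x * (x - 1 / x) \<le> 1 + - (a * x\<^sup>2)" by (simp only:)
        qed (use x in auto)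
        also have "\<dots> \<le> 3 * (c * ?J)"
          unfolding exp_add using G[OF w x(1) xA2] exp_le by (intro mult_mono) (auto simp: Jeq)
        finally show ?thesis .
      qed
      then have up: "\<forall>\<^sub>F F in finite_subsets_at_top UNIV. prob {\<omega> \<in> space M. x - 1 / x \<le> tsum w ?y F \<omega>} \<le> 3 * (c * ?J)"
        by (intro eventually_finite_subsets_at_top_weakI) auto
      have "?P \<le> 3 * (c * ?J) + (1 + 3 * c) * ?J" "0 + (1 - 4 * c) * ?J \<le> ?P"
        using sandwich(1)[OF y(1,2) _ kk Jy up] sandwich(2)[OF y(1,2) _ kk Jy triv] by auto
      then show ?thesis by (simp add: algebra_simps)
    next
      case False
      let ?y = "\<eta> * x" and ?k = "exp 1 * x powr (- d / (2 * \<eta>))" and ?l = "ln x / (\<eta> * x)"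
      have y: "0 < ?y" "?y < (1 + d) * x" using eta d x by auto
      have l: "0 \<le> ?l" "?l * ?y = ln x" "?l\<^sup>2 * exp (?l * ?y) / 2 \<le> 1"
        using eta x L5(2)[OF x(5)] by auto
      have ch: "prob {\<omega> \<in> space M. z \<le> tsum w ?y F \<omega>} \<le> exp 1 * x powr (- b / (2 * \<eta>))"
        if F: "finite F" and z: "b * x / 2 \<le> z" for F z b
      proof -
        have "?l * (b * x / 2) \<le> ?l * z" by (intro mult_left_mono l(1) z)
        moreover have "?l * (b * x / 2) = b / (2 * \<eta>) * ln x" using x eta by (simp add: mult_ac)
        ultimately have "prob {\<omega> \<in> space M. z \<le> tsum w ?y F \<omega>} \<le> exp (1 + - b / (2 * \<eta>) * ln x)"
          using l by (intro chernoff_unit[OF W(3) F less_imp_le[OF y(1)] l(1)]) auto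
        moreover have "exp (1 + - b / (2 * \<eta>) * ln x) = exp 1 * x powr (- b / (2 * \<eta>))"
          unfolding exp_add powr_def using x by simp
        ultimately show ?thesis by (simp only:)
      qed
      have kk: "prob {\<omega> \<in> space M. d * x / 2 \<le> tsum w ?y F \<omega>} \<le> ?k" if "finite F" for F
        by (rule ch[OF that]) simp
      have Jy: "?k * jumps w ?y \<le> c * ?J" "(jumps w ?y)\<^sup>2 \<le> c * ?J" "exp 1 * x powr (- 1 / (2 * \<eta>)) \<le> c * ?J"
        using Hu[OF w x(3)] False by (auto simp: Jeq)
      have "1 / x \<le> x / 2" using x mult_mono[of 2 x 1 x] by (simp add: field_simps)
      then have "prob {\<omega> \<in> space M. x - 1 / x \<le> tsum w ?y F \<omega>} \<le> c * ?J" if F: "finite F" for F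
        using ch[OF F, of 1 "x - 1 / x"] Jy(3) by simp
      then have up: "\<forall>\<^sub>F F in finite_subsets_at_top UNIV. prob {\<omega> \<in> space M. x - 1 / x \<le> tsum w ?y F \<omega>} \<le> c * ?J"
        by (intro eventually_finite_subsets_at_top_weakI) auto
      have "?P \<le> c * ?J + (1 + 3 * c) * ?J" "0 + (1 - 4 * c) * ?J \<le> ?P"
        using sandwich(1)[OF y _ kk Jy(1,2) up] sandwich(2)[OF y _ kk Jy(1,2) triv] by auto
      moreover have "0 \<le> c * ?J" using c J(5) by simp
      ultimately show ?thesis by (simp add: algebra_simps)
    qed
    moreover have "0 \<le> c * ?J" using c J(5) by simp
    moreover have "e = 8 * c" by (simp add: c_def)
    ultimately show "\<bar>?P - ?J\<bar> \<le> e * ?J" by (simp add: abs_le_iff algebra_simps)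
  qed
qed

text \<open>For bounded x it does not matter which quotient is small: by \<open>lyap_le_powr\<close>
  smallness of the one of order t makes the one of order p at most exp(- L^2 / 2), which is the
  condition of the moment case.\<close>

lemma bounded_regime:
  assumes p: "2 < p" and int: "integrable M (\<lambda>\<omega>. \<bar>\<xi> 0 \<omega>\<bar> powr p)" and e: "0 < e" "e \<le> 1" and t: "2 < t"
  obtains U0 where "0 < U0" "U0 < 1"
    "\<And>(w :: int \<Rightarrow> real) Z x. unit_sum w Z \<Longrightarrow> lyap w t \<le> U0 \<Longrightarrow> 0 \<le> x \<Longrightarrow> x \<le> L \<Longrightarrow>
      \<bar>prob {\<omega> \<in> space M. x \<le> Z \<omega>} - (1 - std_normal_cdf x)\<bar> \<le> e * (1 - std_normal_cdf x)"
proof -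
  obtain U1 where U1: "0 < U1" "U1 < 1"
    and G: "\<And>(w :: int \<Rightarrow> real) Z x. unit_sum w Z \<Longrightarrow> lyap w p \<le> U1 \<Longrightarrow> x\<^sup>2 \<le> 2 * ln (inverse (lyap w p)) \<Longrightarrow>
      \<bar>prob {\<omega> \<in> space M. x \<le> Z \<omega>} - (1 - std_normal_cdf x)\<bar> \<le> e * (1 - std_normal_cdf x)"
    by (rule gauss_regime[OF p int e]) blast
  have pt: "0 < (p - 2) / t" and e': "0 < min U1 (exp (- L\<^sup>2 / 2))" using p t U1 by auto
  obtain U2 where U2: "0 < U2" "U2 < 1"
    and S: "\<And>U. 0 < U \<Longrightarrow> U \<le> U2 \<Longrightarrow> 1 * U powr ((p - 2) / t) \<le> min U1 (exp (- L\<^sup>2 / 2))"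
    by (rule powr_small[OF pt e']) blast
  show thesis
  proof (rule that[OF U2])
    fix w :: "int \<Rightarrow> real" and Z :: "'a \<Rightarrow> real" and x :: real
    assume Z: "unit_sum w Z" and U: "lyap w t \<le> U2" and x: "0 \<le> x" "x \<le> L"
    have w: "((\<lambda>i. (w i)\<^sup>2) has_sum 1) UNIV" using Z by (simp add: unit_sum_def)
    have pos: "0 < lyap w t" "0 < lyap w p" using lyap_pos[OF w] t p by auto
    have "lyap w p \<le> lyap w t powr ((p - 2) / t)" using p t by (intro lyap_le_powr[OF w]) auto
    also have "\<dots> \<le> min U1 (exp (- L\<^sup>2 / 2))" using S[OF pos(1) U] by simp
    finally have le: "lyap w p \<le> U1" "lyap w p \<le> exp (- L\<^sup>2 / 2)" by auto
    have "ln (lyap w p) \<le> - L\<^sup>2 / 2" using le(2) pos ln_le_cancel_iff[OF pos(2), of "exp (- L\<^sup>2 / 2)"] by simp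
    moreover have "x\<^sup>2 \<le> L\<^sup>2" using x by (intro power_mono)
    ultimately have "x\<^sup>2 \<le> 2 * ln (inverse (lyap w p))" by (simp add: ln_inverse)
    then show "\<bar>prob {\<omega> \<in> space M. x \<le> Z \<omega>} - (1 - std_normal_cdf x)\<bar> \<le> e * (1 - std_normal_cdf x)"
      by (rule G[OF Z le(1)])
  qed
qed

text \<open>Three ranges: for x \<le> L the jump sum is negligible against the Gaussian tail; up to
  x^2 = 4 ln (1/U) both terms are produced by the sandwich; beyond that the Gaussian tail is
  negligible against the jump sum.\<close>

lemma mixed_regime:
  assumes rv: "regvar t tail" and t: "2 < t" and p: "2 < p" and int: "integrable M (\<lambda>\<omega>. \<bar>\<xi> 0 \<omega>\<bar> powr p)"
    and e: "0 < e" "e \<le> 1" and c0: "0 < c0"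
  obtains U0 where "0 < U0" "U0 < 1"
    "\<And>(w :: int \<Rightarrow> real) Z x. unit_weights w \<Longrightarrow> unit_sum w Z \<Longrightarrow> lyap w t \<le> U0 \<Longrightarrow> c0 \<le> x \<Longrightarrow>
      \<bar>prob {\<omega> \<in> space M. x \<le> Z \<omega>} - (jumps w x + (1 - std_normal_cdf x))\<bar> \<le> e * (jumps w x + (1 - std_normal_cdf x))"
proof -
  interpret H: heavy_tail t tail by (rule heavy_tail_tail[OF rv t])
  define c where "c = e / 8"
  have c: "0 < c" "c \<le> 1" "c < 1" using e by (auto simp: c_def)
  have t2: "2 \<le> t" using t by simp
  \<comment> \<open>The switch at A = 2 is one of many choices above sqrt 2. The Gaussian
    replacement works up to any fixed multiple of ln (1/U), so the two methods overlap.\<close>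
  have A: "sqrt 2 < (2 :: real)" using real_sqrt_less_iff[of 2 4] by simp
  define r where "r = min p 3"
  have r: "2 < r" "r \<le> 3" "r \<le> p" using p by (auto simp: r_def)
  have intr: "integrable M (\<lambda>\<omega>. \<bar>\<xi> 0 \<omega>\<bar> powr r)" using r by (intro absm_integrable_mono[OF int]) auto
  obtain a L1 where a: "0 \<le> a" "a < 1 / 2" and L1: "1 \<le> L1"
    and G: "\<And>(w :: int \<Rightarrow> real) x. unit_weights w \<Longrightarrow> L1 \<le> x \<Longrightarrow> 2\<^sup>2 * ln (inverse (lyap w t)) \<le> x\<^sup>2 \<Longrightarrow>
      exp (- (a * x\<^sup>2)) \<le> c * jsum tail w x"
    by (rule H.gauss_le_jsum[OF A c(1)]) blast
  obtain d u0 where d: "0 < d" "d \<le> 1 / 2" and u0: "1 \<le> u0"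
    and N1: "\<And>(w :: int \<Rightarrow> real) x. unit_weights w \<Longrightarrow> u0 \<le> x \<Longrightarrow> jsum tail w ((1 - d) * x) \<le> (1 + c) * jsum tail w x"
    and N2: "\<And>(w :: int \<Rightarrow> real) x. unit_weights w \<Longrightarrow> u0 \<le> x \<Longrightarrow> (1 - c) * jsum tail w x \<le> jsum tail w ((1 + d) * x)"
    by (rule H.jsum_near_one[OF c(1,3)]) blast
  obtain \<kappa> U1 L2 where k: "0 < \<kappa>" and U1: "0 < U1" "U1 < 1" and L2: "1 \<le> L2"
    and Mo: "\<And>(w :: int \<Rightarrow> real) x. unit_weights w \<Longrightarrow> lyap w t \<le> U1 \<Longrightarrow> L2 \<le> x \<Longrightarrow> x \<le> lyap w t powr (- \<kappa>) \<Longrightarrow>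
      exp (- (d\<^sup>2 * x\<^sup>2 / 24)) * jsum tail w (1 / x) \<le> c * jsum tail w x \<and> (jsum tail w (1 / x))\<^sup>2 \<le> c * jsum tail w x"
    by (rule H.jsum_moderate[OF c(1,2) d(1) zero_less_one order_refl]) blast
  obtain L4 where L4: "1 \<le> L4" "\<And>x. L4 \<le> x \<Longrightarrow> 2 \<le> d * x\<^sup>2 \<and> 4 / (d * x)\<^sup>2 \<le> c"
    by (rule window_sizes[OF d(1) c(1)]) blast
  define L where "L = Max {L1, L2, L4, u0}"
  define qL where "qL = 1 - std_normal_cdf L"
  have cq: "0 < c * qL" using c std_normal_tail_pos[of L] by (simp add: qL_def)
  obtain U2 where U2: "0 < U2" "U2 < 1"
    and Sm: "\<And>(w :: int \<Rightarrow> real) x. unit_weights w \<Longrightarrow> lyap w t \<le> U2 \<Longrightarrow> 1 \<le> x \<Longrightarrow> jsum tail w x \<le> c"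
    by (rule H.jsum_small[OF zero_less_one c(1)]) blast
  obtain U3 where U3: "0 < U3" "U3 < 1"
    and Ga: "\<And>(w :: int \<Rightarrow> real) x. ((\<lambda>i. (w i)\<^sup>2) has_sum 1) UNIV \<Longrightarrow> lyap w t \<le> U3 \<Longrightarrow> - 0 \<le> x \<Longrightarrow>
      x \<le> 0 \<or> x\<^sup>2 \<le> 4 * ln (inverse (lyap w t)) \<Longrightarrow> gauss_window w c x"
    by (rule gauss_uniform[OF r(1,2) intr t2 c(1) order_refl, of 4]) (simp, blast)
  obtain U4 where U4: "0 < U4" "U4 < 1"
    and Ju: "\<And>(w :: int \<Rightarrow> real) Z x. unit_weights w \<Longrightarrow> unit_sum w Z \<Longrightarrow> lyap w t \<le> U4 \<Longrightarrow>
      2 * sqrt (ln (inverse (lyap w t))) \<le> x \<Longrightarrow> \<bar>prob {\<omega> \<in> space M. x \<le> Z \<omega>} - jumps w x\<bar> \<le> c * jumps w x"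
    by (rule jump_regime[OF rv t A c(1,2)]) blast
  obtain U5 where U5: "0 < U5" "U5 < 1"
    and Bd: "\<And>(w :: int \<Rightarrow> real) Z x. unit_sum w Z \<Longrightarrow> lyap w t \<le> U5 \<Longrightarrow> 0 \<le> x \<Longrightarrow> x \<le> L \<Longrightarrow>
      \<bar>prob {\<omega> \<in> space M. x \<le> Z \<omega>} - (1 - std_normal_cdf x)\<bar> \<le> c * (1 - std_normal_cdf x)"
    by (rule bounded_regime[OF p int c(1,2) t]) blast
  obtain U6 where U6: "0 < U6" "U6 < 1"
    and S6: "\<And>(w :: int \<Rightarrow> real) x. unit_weights w \<Longrightarrow> lyap w t \<le> U6 \<Longrightarrow> c0 \<le> x \<Longrightarrow> jsum tail w x \<le> c * qL"
    by (rule H.jsum_small[OF c0 cq]) blast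
  \<comment> \<open>In the middle range x grows at most like sqrt (ln (1/U)), which is below any
    negative power of U; thus the moderate estimates for the jump sum are available.\<close>
  have "((\<lambda>U. 4 * ln (inverse U) * U powr (2 * \<kappa>)) \<longlongrightarrow> 0) (at_right 0)" using k by real_asymp
  then have "\<forall>\<^sub>F U in at_right 0. 4 * ln (inverse U) * U powr (2 * \<kappa>) < 1"
    by (rule order_tendstoD(2)) simp
  then obtain b where b: "0 < b" "\<And>U. 0 < U \<Longrightarrow> U < b \<Longrightarrow> 4 * ln (inverse U) * U powr (2 * \<kappa>) < 1"
    unfolding eventually_at_right_field by auto
  define U0 where "U0 = Min {U1, U2, U3, U4, U5, U6, b / 2}"
  show thesis
  proof (rule that[of U0])
    show "0 < U0" "U0 < 1" using U1 U2 U3 U4 U5 U6 b by (auto simp: U0_def)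
    fix w :: "int \<Rightarrow> real" and Z :: "'a \<Rightarrow> real" and x :: real
    assume w: "unit_weights w" and Z: "unit_sum w Z" and U: "lyap w t \<le> U0" and xc: "c0 \<le> x"
    note W = unit_weightsD[OF w]
    let ?Q = "1 - std_normal_cdf x" and ?J = "jumps w x" and ?P = "prob {\<omega> \<in> space M. x \<le> Z \<omega>}"
    have U': "lyap w t \<le> U1" "lyap w t \<le> U2" "lyap w t \<le> U3" "lyap w t \<le> U4" "lyap w t \<le> U5" "lyap w t \<le> U6" "lyap w t < b"
      using U b by (auto simp: U0_def)
    have Upos: "0 < lyap w t" using lyap_pos[OF W(3)] t by simp
    have Jeq: "jumps w = jsum tail w" by (simp add: fun_eq_iff jumps_eq_jsum[OF w])
    have J0: "0 \<le> c * ?J" using jumps_nonneg[of w x] c by simp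
    have Q0: "0 \<le> c * ?Q" using std_normal_tail_pos[of x] c by simp
    have e8: "e = 8 * c" by (simp add: c_def)
    have "?P \<le> (1 + 4 * c) * ?Q + (1 + 4 * c) * ?J \<and> (1 - 4 * c) * ?Q + (1 - 4 * c) * ?J \<le> ?P"
    proof (cases "x \<le> L")
      case True
      have "qL \<le> ?Q" using std_normal_cdf_mono[OF True] by (simp add: qL_def)
      then have "c * qL \<le> c * ?Q" using c by (intro mult_left_mono) auto
      then have "?J \<le> c * ?Q" using S6[OF w U'(6) xc] unfolding Jeq by linarith
      moreover have "(1 - c) * ?Q \<le> ?P" "?P \<le> (1 + c) * ?Q"
        using Bd[OF Z U'(5) _ True] c0 xc unfolding rel_error_iff by auto
      ultimately show ?thesis using J0 Q0 jumps_nonneg[of w x] by (simp add: algebra_simps)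
    next
      case False
      then have x: "L1 \<le> x" "L2 \<le> x" "L4 \<le> x" "u0 \<le> x" "1 \<le> x" "max x 1 = x"
        using L1 by (auto simp: L_def)
      show ?thesis
      proof (cases "x\<^sup>2 \<le> 4 * ln (inverse (lyap w t))")
        case True
        have J: "jumps w ((1 - d) * x) \<le> (1 + c) * ?J" "(1 - c) * ?J \<le> jumps w ((1 + d) * x)"
          "jumps w ((1 + d) * x) \<le> ?J" "?J \<le> c"
          using N1[OF w x(4)] N2[OF w x(4)] Sm[OF w U'(2) x(5)] d x H.jsum_antimono[OF w, of x "(1 + d) * x"]
            mult_right_mono[of 1 "1 + d" x]
          by (auto simp: Jeq)
        have "x\<^sup>2 * lyap w t powr (2 * \<kappa>) \<le> 4 * ln (inverse (lyap w t)) * lyap w t powr (2 * \<kappa>)"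
          using True by (intro mult_right_mono) auto
        also have "\<dots> \<le> 1" using b(2)[OF Upos U'(7)] by simp
        finally have "x\<^sup>2 \<le> lyap w t powr (- (2 * \<kappa>))" using Upos by (simp add: powr_minus field_simps)
        also have "\<dots> = (lyap w t powr (- \<kappa>))\<^sup>2"
          by (simp add: power2_eq_square powr_add[symmetric])
        finally have xk: "x \<le> lyap w t powr (- \<kappa>)" by (rule power2_le_imp_le) simp
        obtain v where v: "0 < v" "v * x \<le> 1 / 8"
          and up: "\<forall>\<^sub>F F in finite_subsets_at_top UNIV. prob {\<omega> \<in> space M. x - v \<le> tsum w (1 / x) F \<omega>} \<le> (1 + c) * ?Q"
          and lo: "\<forall>\<^sub>F F in finite_subsets_at_top UNIV. (1 - c) * ?Q \<le> prob {\<omega> \<in> space M. x + v \<le> tsum w (1 / x) F \<omega>}"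
          using Ga[OF W(3) U'(3), of x] x(5) True unfolding gauss_window_def x(6) by auto
        have vx: "v \<le> 1 / x" using v x by (simp add: field_simps)
        have d': "2 \<le> d * x\<^sup>2" "4 / (d * x)\<^sup>2 \<le> c" using L4(2)[OF x(3)] by auto
        have y: "0 < 1 / x" "1 / x < (1 + d) * x"
        proof -
          have "1 / x \<le> 1" "1 * 1 \<le> 1 * x" "1 * x < (1 + d) * x" using x d by (auto intro!: mult_strict_right_mono)
          then show "1 / x < (1 + d) * x" by linarith
        qed (use x in auto)
        let ?k = "exp (- (d\<^sup>2 * x\<^sup>2 / 24))"
        have kk: "prob {\<omega> \<in> space M. d * x / 2 \<le> tsum w (1 / x) F \<omega>} \<le> ?k" if "finite F" for F
          using x y d by (intro chernoff_crude[OF W(3) that]) auto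
        have Jy: "?k * jumps w (1 / x) \<le> c * ?J" "(jumps w (1 / x))\<^sup>2 \<le> c * ?J"
          using Mo[OF w U'(1) x(2) xk] by (auto simp: Jeq)
        have "?P \<le> (1 + c) * ?Q + (1 + 3 * c) * ?J" "(1 - c) * ?Q + (1 - 4 * c) * ?J \<le> ?P"
          using jump_sandwich[OF w Z x(5) y d d' c(1,2) _ kk Jy J v(1) vx] up lo by auto
        then show ?thesis using J0 Q0 by (simp add: algebra_simps)
      next
        case False
        have "2 * sqrt (ln (inverse (lyap w t))) \<le> x"
        proof -
          have "sqrt (4 * ln (inverse (lyap w t))) \<le> sqrt (x\<^sup>2)" using False by (intro real_sqrt_le_mono) simp
          then show ?thesis using x by (simp add: real_sqrt_mult)
        qed
        then have PJ: "(1 - c) * ?J \<le> ?P" "?P \<le> (1 + c) * ?J" using Ju[OF w Z U'(4)] unfolding rel_error_iff by auto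
        have "?Q \<le> exp (- x\<^sup>2 / 2)" using x by (intro std_normal_tail_le) simp
        also have "\<dots> \<le> exp (- (a * x\<^sup>2))" using a mult_right_mono[of a "1 / 2" "x\<^sup>2"] by simp
        also have "\<dots> \<le> c * ?J" using G[OF w x(1)] False by (simp add: Jeq)
        finally show ?thesis using PJ J0 Q0 std_normal_tail_pos[of x] by (simp add: algebra_simps)
      qed
    qed
    moreover have "\<bar>P - (j + q)\<bar> \<le> 8 * c * (j + q)"
      if "P \<le> (1 + 4 * c) * q + (1 + 4 * c) * j \<and> (1 - 4 * c) * q + (1 - 4 * c) * j \<le> P" "0 \<le> c * j" "0 \<le> c * q" for P q j
      using that by (simp add: abs_le_iff algebra_simps)
    ultimately show "\<bar>?P - (?J + ?Q)\<bar> \<le> e * (?J + ?Q)"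
      using J0 Q0 unfolding e8 by blast
  qed
qed

text \<open>Beyond L the mixed expansion holds and its jump part is absorbed into the Gaussian tail.
  Smaller x, which may tend to 0, are covered by the bounded case, since the mixed expansion is used
  from x = 1 on.\<close>

lemma normal_regime:
  assumes rv: "regvar t tail" and t: "2 < t" and p: "2 < p" and int: "integrable M (\<lambda>\<omega>. \<bar>\<xi> 0 \<omega>\<bar> powr p)"
    and e: "0 < e" "e \<le> 1" and B: "B < sqrt 2"
  obtains U0 where "0 < U0" "U0 < 1"
    "\<And>(w :: int \<Rightarrow> real) Z x. unit_weights w \<Longrightarrow> unit_sum w Z \<Longrightarrow> lyap w t \<le> U0 \<Longrightarrow> 0 < x \<Longrightarrow>
      x \<le> B * sqrt (ln (inverse (lyap w t))) \<Longrightarrow>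
      \<bar>prob {\<omega> \<in> space M. x \<le> Z \<omega>} - (1 - std_normal_cdf x)\<bar> \<le> e * (1 - std_normal_cdf x)"
proof -
  interpret H: heavy_tail t tail by (rule heavy_tail_tail[OF rv t])
  \<comment> \<open>B is raised to a positive value still below sqrt 2, so that the inequality can
    be squared.\<close>
  define B1 where "B1 = max B 1"
  have B1: "0 < B1" "B1 < sqrt 2" "B \<le> B1" using B by (auto simp: B1_def)
  have e4: "0 < e / 4" "e / 4 \<le> 1" "0 < e / 4 * mills_c" using e mills_c_pos by auto
  obtain L where L: "1 \<le> L"
    and G: "\<And>(w :: int \<Rightarrow> real) x. unit_weights w \<Longrightarrow> L \<le> x \<Longrightarrow> x\<^sup>2 \<le> B1\<^sup>2 * ln (inverse (lyap w t)) \<Longrightarrow>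
      jsum tail w x \<le> e / 4 * mills_c * (exp (- x\<^sup>2 / 2) / x)"
    by (rule H.jsum_le_gauss[OF B1(1,2) e4(3)]) blast
  obtain U1 where U1: "0 < U1" "U1 < 1"
    and Mi: "\<And>(w :: int \<Rightarrow> real) Z x. unit_weights w \<Longrightarrow> unit_sum w Z \<Longrightarrow> lyap w t \<le> U1 \<Longrightarrow> 1 \<le> x \<Longrightarrow>
      \<bar>prob {\<omega> \<in> space M. x \<le> Z \<omega>} - (jumps w x + (1 - std_normal_cdf x))\<bar> \<le> e / 4 * (jumps w x + (1 - std_normal_cdf x))"
    by (rule mixed_regime[OF rv t p int e4(1,2) zero_less_one]) blast
  obtain U2 where U2: "0 < U2" "U2 < 1"
    and Bd: "\<And>(w :: int \<Rightarrow> real) Z x. unit_sum w Z \<Longrightarrow> lyap w t \<le> U2 \<Longrightarrow> 0 \<le> x \<Longrightarrow> x \<le> L \<Longrightarrow>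
      \<bar>prob {\<omega> \<in> space M. x \<le> Z \<omega>} - (1 - std_normal_cdf x)\<bar> \<le> e * (1 - std_normal_cdf x)"
    by (rule bounded_regime[OF p int e t]) blast
  show thesis
  proof (rule that[of "min U1 U2"])
    fix w :: "int \<Rightarrow> real" and Z :: "'a \<Rightarrow> real" and x :: real
    assume w: "unit_weights w" and Z: "unit_sum w Z" and U: "lyap w t \<le> min U1 U2" and x0: "0 < x"
      and xB: "x \<le> B * sqrt (ln (inverse (lyap w t)))"
    note W = unit_weightsD[OF w]
    let ?Q = "1 - std_normal_cdf x" and ?J = "jumps w x" and ?P = "prob {\<omega> \<in> space M. x \<le> Z \<omega>}"
    show "\<bar>?P - ?Q\<bar> \<le> e * ?Q"
    proof (cases "x \<le> L")
      case True
      then show ?thesis using Bd[OF Z] U x0 by simp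
    next
      case False
      then have x: "L \<le> x" "1 \<le> x" using L by auto
      have lnU: "0 \<le> ln (inverse (lyap w t))"
        using lyap_pos[OF W(3), of t] lyap_le_1[OF W(3), of t] t by (simp add: ln_inverse)
      have "x \<le> B1 * sqrt (ln (inverse (lyap w t)))"
        using xB mult_right_mono[OF B1(3), of "sqrt (ln (inverse (lyap w t)))"] lnU by simp
      then have "x\<^sup>2 \<le> (B1 * sqrt (ln (inverse (lyap w t))))\<^sup>2" using x0 by (intro power_mono) auto
      then have "x\<^sup>2 \<le> B1\<^sup>2 * ln (inverse (lyap w t))" using lnU by (simp add: power_mult_distrib)
      from G[OF w x(1) this] have "?J \<le> e / 4 * (mills_c * exp (- x\<^sup>2 / 2) / x)"
        by (simp add: jumps_eq_jsum[OF w])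
      also have "\<dots> \<le> e / 4 * ?Q" using e x by (intro mult_left_mono std_normal_tail_ge) auto
      finally have J: "?J \<le> e / 4 * ?Q" .
      have "e / 4 * ?J \<le> 1 * ?J" using e jumps_nonneg[of w x] by (intro mult_right_mono) auto
      moreover have "\<bar>?P - (?J + ?Q)\<bar> \<le> e / 4 * ?J + e / 4 * ?Q"
        using Mi[OF w Z _ x(2)] U by (simp add: distrib_left)
      moreover have "\<bar>P - q\<bar> \<le> e * q"
        if "j \<le> e / 4 * q" "f \<le> 1 * j" "\<bar>P - (j + q)\<bar> \<le> f + e / 4 * q" "0 \<le> j" "0 \<le> e * q" for P q j f
        using that by (simp add: abs_le_iff)
      moreover have "0 \<le> e * ?Q" using e std_normal_tail_pos[of x] by simp
      ultimately show ?thesis using J jumps_nonneg[of w x] by blast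
    qed
  qed (use U1 U2 in auto)
qed

end

section \<open>Partial sums of linear processes\<close>

lemma power2_sum_le: "(p + q)\<^sup>2 \<le> 2 * p\<^sup>2 + 2 * (q :: real)\<^sup>2"
  using zero_le_power2[of "p - q"] by (simp add: power2_sum power2_diff)

text \<open>The square of a sum is at most twice the sum of the squares, and both integrals tend to
  0. The estimate is made with nonnegative integrals, in which the mean-square notion is
  stated.\<close>

lemma (in prob_space) has_mean_square_sum_add:
  assumes A: "has_mean_square_sum M Y1 Z1" and B: "has_mean_square_sum M Y2 Z2"
    and [measurable]: "\<And>j. Y1 j \<in> borel_measurable M" "\<And>j. Y2 j \<in> borel_measurable M"
  shows "has_mean_square_sum M (\<lambda>j \<omega>. Y1 j \<omega> + Y2 j \<omega>) (\<lambda>\<omega>. Z1 \<omega> + Z2 \<omega>)"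
proof -
  have [measurable]: "Z1 \<in> borel_measurable M" "Z2 \<in> borel_measurable M"
    using A B by (auto simp: has_mean_square_sum_def)
  let ?I = "\<lambda>Y Z F. \<integral>\<^sup>+ \<omega>. ennreal (((\<Sum>j\<in>F. Y j \<omega>) - Z \<omega>)\<^sup>2) \<partial>M"
  have bound: "?I (\<lambda>j \<omega>. Y1 j \<omega> + Y2 j \<omega>) (\<lambda>\<omega>. Z1 \<omega> + Z2 \<omega>) F \<le> 2 * ?I Y1 Z1 F + 2 * ?I Y2 Z2 F" for F
  proof -
    have "?I (\<lambda>j \<omega>. Y1 j \<omega> + Y2 j \<omega>) (\<lambda>\<omega>. Z1 \<omega> + Z2 \<omega>) F \<le>
        (\<integral>\<^sup>+ \<omega>. 2 * ennreal (((\<Sum>j\<in>F. Y1 j \<omega>) - Z1 \<omega>)\<^sup>2) + 2 * ennreal (((\<Sum>j\<in>F. Y2 j \<omega>) - Z2 \<omega>)\<^sup>2) \<partial>M)"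
    proof (intro nn_integral_mono)
      fix \<omega>
      let ?p = "(\<Sum>j\<in>F. Y1 j \<omega>) - Z1 \<omega>" and ?q = "(\<Sum>j\<in>F. Y2 j \<omega>) - Z2 \<omega>"
      have eq: "(\<Sum>j\<in>F. Y1 j \<omega> + Y2 j \<omega>) - (Z1 \<omega> + Z2 \<omega>) = ?p + ?q" by (simp add: sum.distrib)
      have "((\<Sum>j\<in>F. Y1 j \<omega> + Y2 j \<omega>) - (Z1 \<omega> + Z2 \<omega>))\<^sup>2 \<le> 2 * ?p\<^sup>2 + 2 * ?q\<^sup>2"
        unfolding eq by (rule power2_sum_le)
      then have "ennreal (((\<Sum>j\<in>F. Y1 j \<omega> + Y2 j \<omega>) - (Z1 \<omega> + Z2 \<omega>))\<^sup>2) \<le> ennreal (2 * ?p\<^sup>2 + 2 * ?q\<^sup>2)"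
        by (rule ennreal_leI)
      then show "ennreal (((\<Sum>j\<in>F. Y1 j \<omega> + Y2 j \<omega>) - (Z1 \<omega> + Z2 \<omega>))\<^sup>2) \<le> 2 * ennreal (?p\<^sup>2) + 2 * ennreal (?q\<^sup>2)"
        by (simp add: ennreal_mult)
    qed
    also have "\<dots> = 2 * ?I Y1 Z1 F + 2 * ?I Y2 Z2 F"
      by (simp add: nn_integral_add nn_integral_cmult)
    finally show ?thesis .
  qed
  have lim: "((\<lambda>F. 2 * ?I Y1 Z1 F + 2 * ?I Y2 Z2 F) \<longlongrightarrow> 2 * 0 + 2 * 0) (finite_subsets_at_top UNIV)"
    using A B unfolding has_mean_square_sum_def by (intro tendsto_add ennreal_tendsto_cmult) auto
  have "((\<lambda>F. ?I (\<lambda>j \<omega>. Y1 j \<omega> + Y2 j \<omega>) (\<lambda>\<omega>. Z1 \<omega> + Z2 \<omega>) F) \<longlongrightarrow> 0) (finite_subsets_at_top UNIV)"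
  proof (rule tendsto_sandwich[OF _ _ tendsto_const])
    show "\<forall>\<^sub>F F in finite_subsets_at_top UNIV. ?I (\<lambda>j \<omega>. Y1 j \<omega> + Y2 j \<omega>) (\<lambda>\<omega>. Z1 \<omega> + Z2 \<omega>) F \<le> 2 * ?I Y1 Z1 F + 2 * ?I Y2 Z2 F"
      by (rule always_eventually, rule allI, rule bound)
    show "((\<lambda>F. 2 * ?I Y1 Z1 F + 2 * ?I Y2 Z2 F) \<longlongrightarrow> 0) (finite_subsets_at_top UNIV)" using lim by simp
  qed simp
  then show ?thesis by (simp add: has_mean_square_sum_def)
qed

lemma (in prob_space) has_mean_square_sum_cmult:
  assumes A: "has_mean_square_sum M Y Z" and [measurable]: "\<And>j. Y j \<in> borel_measurable M"
  shows "has_mean_square_sum M (\<lambda>j \<omega>. c * Y j \<omega>) (\<lambda>\<omega>. c * Z \<omega>)"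
proof -
  have [measurable]: "Z \<in> borel_measurable M" using A by (auto simp: has_mean_square_sum_def)
  have "(\<integral>\<^sup>+ \<omega>. ennreal (((\<Sum>j\<in>F. c * Y j \<omega>) - c * Z \<omega>)\<^sup>2) \<partial>M) =
      ennreal (c\<^sup>2) * (\<integral>\<^sup>+ \<omega>. ennreal (((\<Sum>j\<in>F. Y j \<omega>) - Z \<omega>)\<^sup>2) \<partial>M)" for F
  proof -
    have "((\<Sum>j\<in>F. c * Y j \<omega>) - c * Z \<omega>)\<^sup>2 = c\<^sup>2 * ((\<Sum>j\<in>F. Y j \<omega>) - Z \<omega>)\<^sup>2" for \<omega>
      unfolding sum_distrib_left[symmetric] right_diff_distrib[symmetric] power_mult_distrib ..
    then show ?thesis by (simp add: ennreal_mult nn_integral_cmult)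
  qed
  moreover have "((\<lambda>F. ennreal (c\<^sup>2) * (\<integral>\<^sup>+ \<omega>. ennreal (((\<Sum>j\<in>F. Y j \<omega>) - Z \<omega>)\<^sup>2) \<partial>M)) \<longlongrightarrow> ennreal (c\<^sup>2) * 0)
      (finite_subsets_at_top UNIV)"
    using A unfolding has_mean_square_sum_def by (intro ennreal_tendsto_cmult) auto
  ultimately show ?thesis by (simp add: has_mean_square_sum_def)
qed

lemma (in prob_space) has_mean_square_sum_sum:
  fixes K :: "'k set"
  assumes "finite K" and "\<And>k. k \<in> K \<Longrightarrow> has_mean_square_sum M (\<lambda>j \<omega>. c k j * \<xi> j \<omega>) (X k)"
    and [measurable]: "\<And>j. \<xi> j \<in> borel_measurable M"
  shows "has_mean_square_sum M (\<lambda>j \<omega>. (\<Sum>k\<in>K. c k j) * \<xi> j \<omega>) (\<lambda>\<omega>. \<Sum>k\<in>K. X k \<omega>)"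
  using assms(1,2)
proof (induction K rule: finite_induct)
  case empty
  then show ?case by (simp add: has_mean_square_sum_def)
next
  case (insert k K)
  then have "has_mean_square_sum M (\<lambda>j \<omega>. c k j * \<xi> j \<omega> + (\<Sum>k\<in>K. c k j) * \<xi> j \<omega>) (\<lambda>\<omega>. X k \<omega> + (\<Sum>k\<in>K. X k \<omega>))"
    by (intro has_mean_square_sum_add) auto
  with insert.hyps show ?case by (simp add: distrib_right)
qed

text \<open>The error sequence is the relative difference (f - g) / g. This form lets the regime
  estimates, whose thresholds depend on e, be applied one tolerance at a time.\<close>

lemma eq_up_to_o1I:
  assumes g: "\<forall>\<^sub>F n in sequentially. 0 < g n"
    and close: "\<And>e. 0 < e \<Longrightarrow> e \<le> 1 \<Longrightarrow> \<forall>\<^sub>F n in sequentially. \<bar>f n - g n\<bar> \<le> e * g n"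
  shows "eq_up_to_o1 f g"
  unfolding eq_up_to_o1_def
proof (intro exI conjI)
  let ?e = "\<lambda>n. (f n - g n) / g n"
  show "\<forall>\<^sub>F n in sequentially. f n = (1 + ?e n) * g n"
    using g by eventually_elim (simp add: field_simps)
  show "?e \<longlonglongrightarrow> 0"
  proof (rule tendstoI)
    fix r :: real assume "0 < r"
    then have r: "0 < min (r / 2) 1" "min (r / 2) 1 \<le> 1" "min (r / 2) 1 < r" by auto
    show "\<forall>\<^sub>F n in sequentially. dist (?e n) 0 < r"
      using close[OF r(1,2)] g
    proof eventually_elim
      case (elim n)
      then have "\<bar>f n - g n\<bar> / g n \<le> min (r / 2) 1" by (simp only: pos_divide_le_eq)
      then have "\<bar>f n - g n\<bar> / g n < r" using r(3) by (rule le_less_trans)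
      then show ?case using elim(2) by (simp add: abs_divide)
    qed
  qed
qed

lemma lyap_le_of_bound:
  assumes w: "((\<lambda>i. (w i)\<^sup>2) has_sum 1) UNIV" and s: "2 < s" and d: "\<And>i. \<bar>w i\<bar> \<le> d"
  shows "lyap w s \<le> d powr (s - 2)"
proof -
  have "\<bar>w i\<bar> powr s \<le> d powr (s - 2) * (w i)\<^sup>2" for i
  proof (cases "w i = 0")
    case False
    have "\<bar>w i\<bar> powr s = \<bar>w i\<bar> powr (s - 2) * \<bar>w i\<bar> powr 2"
      using powr_add[of "\<bar>w i\<bar>" "s - 2" 2] by (simp only: diff_add_cancel)
    also have "\<bar>w i\<bar> powr (s - 2) \<le> d powr (s - 2)" using s d by (intro powr_mono2) auto
    also have "\<bar>w i\<bar> powr 2 = (w i)\<^sup>2" using False by (simp add: powr_realpow)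
    finally show ?thesis by (simp add: mult_right_mono)
  qed simp
  then have "lyap w s \<le> (\<Sum>\<^sub>\<infinity>i. d powr (s - 2) * (w i)\<^sup>2)"
    unfolding lyap_def using s
    by (intro infsum_mono lyap_summable[OF w] summable_on_cmult_right has_sum_imp_summable[OF w]) auto
  also have "\<dots> = d powr (s - 2)" using has_sum_cmult_right[OF w] by (simp add: infsumI)
  finally show ?thesis .
qed

section \<open>Slow variation of the coefficients\<close>

lemma bcoef_Suc: "bcoef a (Suc n) i = bcoef a n i + a (1 + int n - i)"
proof -
  have "{1..int (Suc n)} = insert (1 + int n) {1..int n}" by auto
  then show ?thesis by (simp add: bcoef_def)
qed

text \<open>Shifting i moves the summation window by one place: one element of \<open>a\<close>
  enters and one leaves.\<close>

lemma bcoef_shift: "bcoef a n (i + 1) = bcoef a n i + a (- i) - a (int n - i)"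
proof (induction n)
  case 0
  then show ?case by (simp add: bcoef_def)
next
  case (Suc n)
  have "1 + int n - (i + 1) = int n - i" by simp
  with Suc show ?case by (simp add: bcoef_Suc)
qed

lemma bcoef_shift_le:
  assumes al: "\<And>i. \<bar>a i\<bar> \<le> \<alpha>"
  shows "\<bar>bcoef a n (i + int m) - bcoef a n i\<bar> \<le> 2 * \<alpha> * real m"
proof (induction m)
  case (Suc m)
  have "bcoef a n (i + int (Suc m)) = bcoef a n (i + int m) + a (- (i + int m)) - a (int n - (i + int m))"
    using bcoef_shift[of a n "i + int m"] by (simp add: add_ac)
  then have "\<bar>bcoef a n (i + int (Suc m)) - bcoef a n i\<bar> \<le> \<bar>bcoef a n (i + int m) - bcoef a n i\<bar> + \<alpha> + \<alpha>"
    using al[of "- (i + int m)"] al[of "int n - (i + int m)"] by linarith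
  with Suc show ?case by (simp add: algebra_simps)
qed simp

text \<open>Neighbouring coefficients differ by at most \<open>2 \<alpha>\<close>, so a large coefficient drags \<open>N\<close>
  neighbours along; hence no single one can dominate the sum of squares.\<close>

lemma bcoef_sq_le:
  assumes al: "\<And>i. \<bar>a i\<bar> \<le> \<alpha>" and sm: "(\<lambda>i. (bcoef a n i)\<^sup>2) summable_on UNIV" and N: "0 < N"
  shows "(bcoef a n i)\<^sup>2 \<le> 2 * (\<Sum>\<^sub>\<infinity>i. (bcoef a n i)\<^sup>2) / real N + 8 * \<alpha>\<^sup>2 * (real N)\<^sup>2"
proof -
  let ?b = "bcoef a n"
  have al0: "0 \<le> \<alpha>" using order_trans[OF abs_ge_zero al] .
  have one: "(?b i)\<^sup>2 \<le> 2 * (?b (i + int m))\<^sup>2 + 8 * \<alpha>\<^sup>2 * (real N)\<^sup>2" if m: "m < N" for m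
  proof -
    have "\<bar>?b (i + int m) - ?b i\<bar> \<le> 2 * \<alpha> * real m" by (rule bcoef_shift_le[OF al])
    also have "\<dots> \<le> 2 * \<alpha> * real N" using m al0 by (intro mult_left_mono) auto
    finally have "\<bar>?b (i + int m) - ?b i\<bar>\<^sup>2 \<le> (2 * \<alpha> * real N)\<^sup>2" by (intro power_mono) auto
    then have d: "(?b (i + int m) - ?b i)\<^sup>2 \<le> 4 * \<alpha>\<^sup>2 * (real N)\<^sup>2" by (simp add: power_mult_distrib)
    have "p\<^sup>2 \<le> 2 * q\<^sup>2 + 2 * (q - p)\<^sup>2" for p q :: real
      using zero_le_power2[of "2 * q - p"] by (simp add: power2_eq_square algebra_simps)
    from this[of "?b i" "?b (i + int m)"] d show ?thesis by linarith
  qed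
  have "real N * (?b i)\<^sup>2 = (\<Sum>m<N. (?b i)\<^sup>2)" by simp
  also have "\<dots> \<le> (\<Sum>m<N. 2 * (?b (i + int m))\<^sup>2 + 8 * \<alpha>\<^sup>2 * (real N)\<^sup>2)"
    by (intro sum_mono one) auto
  also have "\<dots> = 2 * (\<Sum>m<N. (?b (i + int m))\<^sup>2) + real N * (8 * \<alpha>\<^sup>2 * (real N)\<^sup>2)"
    by (simp add: sum.distrib sum_distrib_left)
  also have "(\<Sum>m<N. (?b (i + int m))\<^sup>2) = (\<Sum>j\<in>(\<lambda>m. i + int m) ` {..<N}. (?b j)\<^sup>2)"
    by (subst sum.reindex) (auto simp: inj_on_def)
  also have "\<dots> \<le> (\<Sum>\<^sub>\<infinity>i. (?b i)\<^sup>2)" by (intro finite_sum_le_infsum sm) auto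
  finally have "real N * (?b i)\<^sup>2 \<le> real N * (2 * (\<Sum>\<^sub>\<infinity>i. (?b i)\<^sup>2) / real N + 8 * \<alpha>\<^sup>2 * (real N)\<^sup>2)"
    using N by (simp add: distrib_left)
  then show ?thesis using N by (simp add: mult_le_cancel_left)
qed

section \<open>Normalisation and transfer to sequences\<close>

locale long_memory_sum = prob_space M for M :: "'a measure" +
  fixes \<xi> X :: "int \<Rightarrow> 'a \<Rightarrow> real" and a :: "int \<Rightarrow> real"
  assumes iid: "iid_family M \<xi>"
    and sq_xi: "integrable M (\<lambda>w. (\<xi> 0 w)\<^sup>2)"
    and mean_xi: "integral\<^sup>L M (\<xi> 0) = 0"
    and sq_a: "(\<lambda>i. (a i)\<^sup>2) summable_on UNIV"
    and lin: "linear_process M a \<xi> X"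
    and var_top: "filterlim (psum_var M a \<xi>) at_top sequentially"
begin

definition sg :: real where "sg = sqrt (expectation (\<lambda>w. (\<xi> 0 w)\<^sup>2))"

definition B2 :: "nat \<Rightarrow> real" where "B2 n = (\<Sum>\<^sub>\<infinity>i. (bcoef a n i)\<^sup>2)"

definition wt :: "nat \<Rightarrow> int \<Rightarrow> real" where "wt n i = bcoef a n i / sqrt (B2 n)"

definition Zn :: "nat \<Rightarrow> 'a \<Rightarrow> real" where "Zn n \<omega> = psum X n \<omega> / psum_sd M a \<xi> n"

lemma indep_xi: "indep_vars (\<lambda>_. borel) \<xi> UNIV"
  using iid by (simp add: iid_family_def)

lemma xi_meas [measurable]: "\<xi> i \<in> borel_measurable M"
  using indep_xi unfolding indep_vars_def2 by simp

lemma psum_var_eq: "psum_var M a \<xi> n = sg\<^sup>2 * B2 n"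
  by (simp add: psum_var_def sg_def B2_def)

lemma sg_pos: "0 < sg"
proof -
  have "\<forall>\<^sub>F n in sequentially. 1 \<le> psum_var M a \<xi> n" using var_top by (simp add: filterlim_at_top)
  then obtain n where "1 \<le> psum_var M a \<xi> n" using eventually_happens by force
  then have "sg \<noteq> 0" by (auto simp: psum_var_eq)
  then show ?thesis by (simp add: sg_def less_le)
qed

lemma psum_sd_eq: "psum_sd M a \<xi> n = sg * sqrt (B2 n)"
  using sg_pos by (simp add: psum_sd_def psum_var_eq real_sqrt_mult)

lemma B2_top: "filterlim B2 at_top sequentially"
proof -
  have "filterlim (\<lambda>n. (1 / sg\<^sup>2) * psum_var M a \<xi> n) at_top sequentially"
    using var_top sg_pos by (intro filterlim_tendsto_pos_mult_at_top[OF tendsto_const]) auto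
  moreover have "(\<lambda>n. (1 / sg\<^sup>2) * psum_var M a \<xi> n) = B2" using sg_pos by (auto simp: psum_var_eq)
  ultimately show ?thesis by simp
qed

lemma bcoef_summable: "(\<lambda>i. (bcoef a n i)\<^sup>2) summable_on UNIV"
proof (induction n)
  case 0
  then show ?case by (simp add: bcoef_def)
next
  case (Suc n)
  have "(\<lambda>i. (a (1 + int n - i))\<^sup>2) summable_on UNIV"
    using sq_a summable_on_reindex_bij_betw[of "\<lambda>i. 1 + int n - i" UNIV UNIV "\<lambda>i. (a i)\<^sup>2"]
    by (simp add: bij_betw_def inj_def surj_def)
  then have "(\<lambda>i. 2 * (bcoef a n i)\<^sup>2 + 2 * (a (1 + int n - i))\<^sup>2) summable_on UNIV"
    by (intro summable_on_add summable_on_cmult_right Suc)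
  then show ?case
  proof (rule summable_on_comparison_test)
    show "(bcoef a (Suc n) i)\<^sup>2 \<le> 2 * (bcoef a n i)\<^sup>2 + 2 * (a (1 + int n - i))\<^sup>2" for i
      unfolding bcoef_Suc by (rule power2_sum_le)
  qed simp
qed

lemma psum_mean_square: "has_mean_square_sum M (\<lambda>j \<omega>. bcoef a n j * \<xi> j \<omega>) (psum X n)"
proof -
  have "has_mean_square_sum M (\<lambda>j \<omega>. (\<Sum>k = 1..int n. a (k - j)) * \<xi> j \<omega>) (\<lambda>\<omega>. \<Sum>k = 1..int n. X k \<omega>)"
    using lin by (intro has_mean_square_sum_sum) (auto simp: linear_process_def)
  then show ?thesis by (simp add: bcoef_def psum_def[abs_def])
qed

text \<open>Dividing the innovations by their standard deviation and the coefficients by the root of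
  \<open>B2\<close> turns the normalised partial sum into a unit sum, to which all uniform estimates
  apply.\<close>

sublocale N: iid_unit M "\<lambda>i \<omega>. \<xi> i \<omega> / sg"
proof
  show "indep_vars (\<lambda>_. borel) (\<lambda>i \<omega>. \<xi> i \<omega> / sg) UNIV"
    by (rule indep_vars_compose2[OF indep_xi, of "\<lambda>_ x. x / sg" "\<lambda>_. borel"]) auto
  show "distr M borel (\<lambda>\<omega>. \<xi> i \<omega> / sg) = distr M borel (\<lambda>\<omega>. \<xi> 0 \<omega> / sg)" for i
  proof -
    have "distr M borel (\<lambda>\<omega>. \<xi> j \<omega> / sg) = distr (distr M borel (\<xi> j)) borel (\<lambda>x. x / sg)" for j
      by (subst distr_distr) (auto simp: comp_def)
    moreover have "distr M borel (\<xi> i) = distr M borel (\<xi> 0)" using iid unfolding iid_family_def by blast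
    ultimately show ?thesis by simp
  qed
  show "integrable M (\<lambda>\<omega>. (\<xi> 0 \<omega> / sg)\<^sup>2)" using sq_xi by (simp add: power_divide)
  have "expectation (\<lambda>\<omega>. (\<xi> 0 \<omega>)\<^sup>2) = sg\<^sup>2" by (simp add: sg_def)
  then show "expectation (\<lambda>\<omega>. (\<xi> 0 \<omega> / sg)\<^sup>2) = 1" using sg_pos by (simp add: power_divide)
  show "expectation (\<lambda>\<omega>. \<xi> 0 \<omega> / sg) = 0" using mean_xi by simp
qed

lemma wt_has_sum: "0 < B2 n \<Longrightarrow> ((\<lambda>i. (wt n i)\<^sup>2) has_sum 1) UNIV"
proof -
  assume B: "0 < B2 n"
  have "((\<lambda>i. (1 / B2 n) * (bcoef a n i)\<^sup>2) has_sum (1 / B2 n) * B2 n) UNIV"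
    unfolding B2_def by (intro has_sum_cmult_right has_sum_infsum bcoef_summable)
  moreover have "(1 / B2 n) * (bcoef a n i)\<^sup>2 = (wt n i)\<^sup>2" for i
    using B by (simp add: wt_def power_divide)
  ultimately show ?thesis using B by simp
qed

lemma unit_sum_wt:
  assumes B: "0 < B2 n"
  shows "N.unit_sum (wt n) (Zn n)"
proof -
  have "has_mean_square_sum M (\<lambda>j \<omega>. 1 / psum_sd M a \<xi> n * (bcoef a n j * \<xi> j \<omega>)) (\<lambda>\<omega>. 1 / psum_sd M a \<xi> n * psum X n \<omega>)"
    by (intro has_mean_square_sum_cmult psum_mean_square) measurable
  moreover have "(\<lambda>j \<omega>. 1 / psum_sd M a \<xi> n * (bcoef a n j * \<xi> j \<omega>)) = (\<lambda>i \<omega>. wt n i * (\<xi> i \<omega> / sg))"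
    by (simp add: fun_eq_iff psum_sd_eq wt_def)
  moreover have "(\<lambda>\<omega>. 1 / psum_sd M a \<xi> n * psum X n \<omega>) = Zn n" by (simp add: fun_eq_iff Zn_def)
  ultimately show ?thesis using wt_has_sum[OF B] by (simp add: N.unit_sum_def)
qed

lemma prob_psum:
  assumes B: "0 < B2 n"
  shows "prob {\<omega> \<in> space M. x * psum_sd M a \<xi> n \<le> psum X n \<omega>} = prob {\<omega> \<in> space M. x \<le> Zn n \<omega>}"
proof -
  have "0 < psum_sd M a \<xi> n" using B sg_pos by (simp add: psum_sd_eq)
  then show ?thesis by (simp add: Zn_def pos_le_divide_eq)
qed

lemma jump_tail_eq:
  assumes B: "0 < B2 n"
  shows "jump_tail M a \<xi> n (x * psum_sd M a \<xi> n) = N.jumps (wt n) x"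
proof -
  have "x * psum_sd M a \<xi> n \<le> bcoef a n i * \<xi> 0 \<omega> \<longleftrightarrow> x \<le> wt n i * (\<xi> 0 \<omega> / sg)" for i \<omega>
  proof -
    have sd: "0 < sg * sqrt (B2 n)" using B sg_pos by simp
    have "wt n i * (\<xi> 0 \<omega> / sg) = bcoef a n i * \<xi> 0 \<omega> / (sg * sqrt (B2 n))" by (simp add: wt_def mult.commute)
    then show ?thesis by (simp only: psum_sd_eq pos_le_divide_eq[OF sd])
  qed
  then show ?thesis by (simp only: jump_tail_def N.jumps_eq_infsum)
qed

lemma lyap_ratio_eq:
  assumes B: "0 < B2 n" and s: "2 \<le> s"
  shows "lyap_ratio a n s = lyap (wt n) s"
proof -
  have "\<bar>wt n i\<bar> powr s = B2 n powr (- s / 2) * \<bar>bcoef a n i\<bar> powr s" for i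
    using B by (simp add: wt_def abs_divide powr_divide powr_half_sqrt[symmetric] powr_powr powr_minus_divide)
  moreover have "(\<lambda>i. \<bar>bcoef a n i\<bar> powr s) summable_on UNIV"
  proof -
    have "\<bar>bcoef a n i\<bar> powr s = B2 n powr (s / 2) * \<bar>wt n i\<bar> powr s" for i
      using B by (simp add: wt_def abs_divide powr_divide powr_half_sqrt[symmetric] powr_powr)
    then show ?thesis
      using summable_on_cmult_right[OF lyap_summable[OF wt_has_sum[OF B] s], of "B2 n powr (s / 2)"] by simp
  qed
  ultimately show ?thesis
    by (simp add: lyap_ratio_def lyap_def B2_def[symmetric] infsum_cmult_right)
qed

lemma B2_eventually_pos: "\<forall>\<^sub>F n in sequentially. 0 < B2 n"
  using B2_top by (simp add: filterlim_at_top_dense)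

text \<open>Uniform smallness of the weights suffices, since the quotient is at most d powr (s - 2)
  if all weights are at most d. A fixed number N of neighbours bounds each weight once the sum of
  squares is large.\<close>

lemma lyap_eventually_le:
  assumes s: "2 < s" and U: "0 < U0"
  shows "\<forall>\<^sub>F n in sequentially. lyap (wt n) s \<le> U0"
proof -
  define d where "d = U0 powr (1 / (s - 2))"
  have d: "0 < d" "d powr (s - 2) = U0" using U s by (auto simp: d_def powr_powr)
  define \<alpha> where "\<alpha> = sqrt (\<Sum>\<^sub>\<infinity>i. (a i)\<^sup>2)"
  have al: "\<bar>a i\<bar> \<le> \<alpha>" for i
    unfolding \<alpha>_def using finite_sum_le_infsum[OF sq_a, of "{i}"] by (intro real_le_rsqrt) simp
  \<comment> \<open>N makes the first term of the coefficient bound at most half of d^2 * B2; growth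
    of B2 then does the same for the second term.\<close>
  obtain N where N: "4 / d\<^sup>2 < real N" using reals_Archimedean2 by blast
  have N0: "0 < N" using N d by (intro gr0I) (auto simp: divide_less_0_iff)
  have dN: "2 / real N \<le> d\<^sup>2 / 2" using N N0 d by (simp add: field_simps)
  have "\<forall>\<^sub>F n in sequentially. 16 * \<alpha>\<^sup>2 * (real N)\<^sup>2 / d\<^sup>2 \<le> B2 n"
    using B2_top by (simp add: filterlim_at_top)
  with B2_eventually_pos show ?thesis
  proof eventually_elim
    case (elim n)
    have "\<bar>wt n i\<bar> \<le> d" for i
    proof -
      have "(bcoef a n i)\<^sup>2 \<le> 2 / real N * B2 n + 8 * \<alpha>\<^sup>2 * (real N)\<^sup>2"
        using bcoef_sq_le[OF al bcoef_summable N0, of n i] by (simp add: B2_def)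
      also have "\<dots> \<le> d\<^sup>2 / 2 * B2 n + d\<^sup>2 / 2 * B2 n"
        using elim d dN by (intro add_mono mult_right_mono) (auto simp: field_simps)
      finally have "(bcoef a n i)\<^sup>2 \<le> d\<^sup>2 * B2 n" by (simp add: mult.commute)
      then have "(wt n i)\<^sup>2 \<le> d\<^sup>2" using elim by (simp add: wt_def power_divide field_simps)
      then show ?thesis using d by (simp add: abs_le_square_iff[symmetric])
    qed
    then show ?case using lyap_le_of_bound[OF wt_has_sum[OF elim(1)] s] d by metis
  qed
qed

lemma unit_weights_wt:
  assumes "0 < B2 n" "\<forall>i. 0 < bcoef a n i"
  shows "unit_weights (wt n)"
  using assms wt_has_sum[OF assms(1)] by (simp add: unit_weights_def wt_def)

text \<open>In the ratio of tails the quotient of the slowly varying factors tends to 1 and the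
  powers leave l powr (- t). Rescaling by \<open>sg\<close> does not affect the limit.\<close>

lemma regvar_tail:
  assumes "regular_right_tail M (\<xi> 0) t h" and t: "0 < t"
  shows "regvar t N.tail"
proof -
  define F where "F u = prob {\<omega> \<in> space M. u \<le> \<xi> 0 \<omega>}" for u
  have h: "\<forall>\<^sub>F x in at_top. 0 < h x" "\<And>l. 0 < l \<Longrightarrow> ((\<lambda>x. h (l * x) / h x) \<longlongrightarrow> 1) at_top"
    and Fh: "\<forall>\<^sub>F x in at_top. F x = h x / x powr t"
    using assms(1) by (auto simp: regular_right_tail_def slowly_varying_def F_def)
  have tail: "N.tail u = F (sg * u)" for u
    unfolding N.tail_def F_def using sg_pos by (simp add: pos_le_divide_eq mult.commute)
  have anti: "F v \<le> F u" if "u \<le> v" for u v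
    unfolding F_def using that by (intro finite_measure_mono) auto
  \<comment> \<open>The representation holds for large arguments only; monotonicity spreads
    positivity to all arguments.\<close>
  have pos: "0 < F u" for u
  proof -
    have "\<forall>\<^sub>F x in at_top. 0 < F x \<and> u \<le> x"
      using h(1) Fh eventually_ge_at_top[of u] eventually_gt_at_top[of 0] by eventually_elim simp
    then obtain x where "0 < F x" "u \<le> x" using eventually_happens[of _ at_top] by force
    then show ?thesis using anti[of u x] by linarith
  qed
  have lim: "((\<lambda>u. F (l * u) / F u) \<longlongrightarrow> l powr (- t)) at_top" if l: "0 < l" for l
  proof -
    have top: "filterlim (\<lambda>u. l * u) at_top at_top"
      using l by (intro filterlim_tendsto_pos_mult_at_top[OF tendsto_const]) (auto simp: filterlim_ident)
    have "\<forall>\<^sub>F u in at_top. F (l * u) = h (l * u) / (l * u) powr t"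
      using filterlim_iff[THEN iffD1, OF top, rule_format, OF Fh] .
    then have "\<forall>\<^sub>F u in at_top. h (l * u) / h u * l powr (- t) = F (l * u) / F u"
      using Fh h(1) eventually_gt_at_top[of 0]
    proof eventually_elim
      case (elim u)
      show ?case unfolding elim(1,2) using l elim(3,4) by (simp add: powr_mult powr_minus field_simps)
    qed
    moreover have "((\<lambda>u. h (l * u) / h u * l powr (- t)) \<longlongrightarrow> 1 * l powr (- t)) at_top"
      by (intro tendsto_mult h(2)[OF l] tendsto_const)
    ultimately show ?thesis by (simp add: tendsto_cong)
  qed
  have top: "filterlim (\<lambda>u. sg * u) at_top at_top"
    using sg_pos by (intro filterlim_tendsto_pos_mult_at_top[OF tendsto_const]) (auto simp: filterlim_ident)
  show ?thesis
    unfolding regvar_def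
  proof (intro conjI allI impI)
    show "antimono N.tail" using anti sg_pos by (auto simp: antimono_def tail)
    show "0 < N.tail u" for u by (simp add: tail pos)
    show "((\<lambda>u. N.tail (l * u) / N.tail u) \<longlongrightarrow> l powr (- t)) at_top" if "0 < l" for l
      using filterlim_compose[OF lim[OF that] top] by (simp add: tail mult.left_commute)
  qed
qed

lemma moment_scaled:
  "integrable M (\<lambda>w. \<bar>\<xi> 0 w\<bar> powr p) \<Longrightarrow> integrable M (\<lambda>\<omega>. \<bar>\<xi> 0 \<omega> / sg\<bar> powr p)"
  using sg_pos by (simp add: abs_divide powr_divide)

lemma mixed_sequence:
  assumes rt: "regular_right_tail M (\<xi> 0) t h" and t: "2 < t" and p: "2 < p"
    and int: "integrable M (\<lambda>w. \<bar>\<xi> 0 w\<bar> powr p)" and b: "\<forall>n\<ge>1. \<forall>i. 0 < bcoef a n i"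
    and c: "0 < c" "\<forall>n\<ge>1. c \<le> x n"
  shows "\<exists>e1 e2. e1 \<longlonglongrightarrow> (0::real) \<and> e2 \<longlonglongrightarrow> (0::real) \<and> (\<forall>\<^sub>F n in sequentially.
      prob {w \<in> space M. x n * psum_sd M a \<xi> n \<le> psum X n w}
      = (1 + e1 n) * jump_tail M a \<xi> n (x n * psum_sd M a \<xi> n) + (1 - std_normal_cdf (x n)) * (1 + e2 n))"
proof -
  have rv: "regvar t N.tail" using t by (intro regvar_tail[OF rt]) simp
  let ?f = "\<lambda>n. prob {w \<in> space M. x n * psum_sd M a \<xi> n \<le> psum X n w}"
  let ?g = "\<lambda>n. jump_tail M a \<xi> n (x n * psum_sd M a \<xi> n) + (1 - std_normal_cdf (x n))"
  have "eq_up_to_o1 ?f ?g"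
  proof (rule eq_up_to_o1I)
    show "\<forall>\<^sub>F n in sequentially. 0 < ?g n"
      using B2_eventually_pos
    proof eventually_elim
      case (elim n)
      show ?case unfolding jump_tail_eq[OF elim] by (intro add_nonneg_pos N.jumps_nonneg std_normal_tail_pos)
    qed
    fix e :: real assume e: "0 < e" "e \<le> 1"
    obtain U0 where U0: "0 < U0"
      and reg: "\<And>(w :: int \<Rightarrow> real) Z x. unit_weights w \<Longrightarrow> N.unit_sum w Z \<Longrightarrow> lyap w t \<le> U0 \<Longrightarrow> c \<le> x \<Longrightarrow>
        \<bar>prob {\<omega> \<in> space M. x \<le> Z \<omega>} - (N.jumps w x + (1 - std_normal_cdf x))\<bar> \<le> e * (N.jumps w x + (1 - std_normal_cdf x))"
      by (rule N.mixed_regime[OF rv t p moment_scaled[OF int] e c(1)]) blast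
    show "\<forall>\<^sub>F n in sequentially. \<bar>?f n - ?g n\<bar> \<le> e * ?g n"
      using B2_eventually_pos lyap_eventually_le[OF t U0] eventually_ge_at_top[of 1]
    proof eventually_elim
      case (elim n)
      show ?case
        unfolding prob_psum[OF elim(1)] jump_tail_eq[OF elim(1)]
        using elim b c by (intro reg unit_weights_wt unit_sum_wt) auto
    qed
  qed
  then obtain e where "e \<longlonglongrightarrow> 0" "\<forall>\<^sub>F n in sequentially. ?f n = (1 + e n) * ?g n"
    unfolding eq_up_to_o1_def by blast
  \<comment> \<open>The total has a relative error e n, so the same sequence serves for both
    terms.\<close>
  then show ?thesis
    by (intro exI[of _ e] conjI) (auto simp: distrib_left mult.commute elim: eventually_mono)
qed

lemma jump_sequence:
  assumes rt: "regular_right_tail M (\<xi> 0) t h" and t: "2 < t" and b: "\<forall>n\<ge>1. \<forall>i. 0 < bcoef a n i"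
    and A: "sqrt 2 < A" and x: "\<forall>n\<ge>1. A * sqrt (ln (inverse (lyap_ratio a n t))) \<le> x n"
  shows "eq_up_to_o1 (\<lambda>n. prob {w \<in> space M. x n * psum_sd M a \<xi> n \<le> psum X n w})
    (\<lambda>n. jump_tail M a \<xi> n (x n * psum_sd M a \<xi> n))" (is "eq_up_to_o1 ?f ?g")
proof (rule eq_up_to_o1I)
  have rv: "regvar t N.tail" using t by (intro regvar_tail[OF rt]) simp
  interpret H: heavy_tail t N.tail by (rule N.heavy_tail_tail[OF rv t])
  have A0: "0 < A" using A by (meson less_trans real_sqrt_gt_zero zero_less_numeral)
  \<comment> \<open>A quotient of at most 1/2 makes the logarithm, and hence x n, strictly positive,
    which gives a positive jump sum to divide by.\<close>
  have half: "0 < (1 / 2 :: real)" by simp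
  show "\<forall>\<^sub>F n in sequentially. 0 < ?g n"
    using B2_eventually_pos lyap_eventually_le[OF t half] eventually_ge_at_top[of 1]
  proof eventually_elim
    case (elim n)
    have w: "unit_weights (wt n)" using elim b by (intro unit_weights_wt) auto
    have U: "0 < lyap (wt n) t" using lyap_pos[OF wt_has_sum[OF elim(1)]] t by simp
    have "1 < inverse (lyap (wt n) t)" using elim U by (intro one_less_inverse) auto
    then have "0 < A * sqrt (ln (inverse (lyap (wt n) t)))"
      by (intro mult_pos_pos A0 real_sqrt_gt_zero ln_gt_zero)
    also have "\<dots> \<le> x n"
      unfolding lyap_ratio_eq[OF elim(1) less_imp_le[OF t], symmetric] using x elim(3) by blast
    finally show ?case
      unfolding jump_tail_eq[OF elim(1)] N.jumps_eq_jsum[OF w] by (intro H.jsum_pos w)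
  qed
  fix e :: real assume e: "0 < e" "e \<le> 1"
  obtain U0 where U0: "0 < U0"
    and reg: "\<And>(w :: int \<Rightarrow> real) Z x. unit_weights w \<Longrightarrow> N.unit_sum w Z \<Longrightarrow> lyap w t \<le> U0 \<Longrightarrow>
      A * sqrt (ln (inverse (lyap w t))) \<le> x \<Longrightarrow>
      \<bar>prob {\<omega> \<in> space M. x \<le> Z \<omega>} - N.jumps w x\<bar> \<le> e * N.jumps w x"
    by (rule N.jump_regime[OF rv t A e]) blast
  show "\<forall>\<^sub>F n in sequentially. \<bar>?f n - ?g n\<bar> \<le> e * ?g n"
    using B2_eventually_pos lyap_eventually_le[OF t U0] eventually_ge_at_top[of 1]
  proof eventually_elim
    case (elim n)
    have "A * sqrt (ln (inverse (lyap (wt n) t))) \<le> x n"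
      unfolding lyap_ratio_eq[OF elim(1) less_imp_le[OF t], symmetric] using x elim(3) by blast
    then show ?case
      unfolding prob_psum[OF elim(1)] jump_tail_eq[OF elim(1)]
      using elim b by (intro reg unit_weights_wt unit_sum_wt) auto
  qed
qed

lemma normal_sequence:
  assumes rt: "regular_right_tail M (\<xi> 0) t h" and t: "2 < t" and p: "2 < p"
    and int: "integrable M (\<lambda>w. \<bar>\<xi> 0 w\<bar> powr p)" and b: "\<forall>n\<ge>1. \<forall>i. 0 < bcoef a n i"
    and B: "B < sqrt 2" and x: "\<forall>n\<ge>1. 0 < x n \<and> x n \<le> B * sqrt (ln (inverse (lyap_ratio a n t)))"
  shows "eq_up_to_o1 (\<lambda>n. prob {w \<in> space M. x n * psum_sd M a \<xi> n \<le> psum X n w}) (\<lambda>n. 1 - std_normal_cdf (x n))"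
    (is "eq_up_to_o1 ?f ?g")
proof (rule eq_up_to_o1I)
  have rv: "regvar t N.tail" using t by (intro regvar_tail[OF rt]) simp
  show "\<forall>\<^sub>F n in sequentially. 0 < ?g n" by (intro always_eventually allI std_normal_tail_pos)
  fix e :: real assume e: "0 < e" "e \<le> 1"
  obtain U0 where U0: "0 < U0"
    and reg: "\<And>(w :: int \<Rightarrow> real) Z x. unit_weights w \<Longrightarrow> N.unit_sum w Z \<Longrightarrow> lyap w t \<le> U0 \<Longrightarrow> 0 < x \<Longrightarrow>
      x \<le> B * sqrt (ln (inverse (lyap w t))) \<Longrightarrow>
      \<bar>prob {\<omega> \<in> space M. x \<le> Z \<omega>} - (1 - std_normal_cdf x)\<bar> \<le> e * (1 - std_normal_cdf x)"
    by (rule N.normal_regime[OF rv t p moment_scaled[OF int] e B]) blast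
  show "\<forall>\<^sub>F n in sequentially. \<bar>?f n - ?g n\<bar> \<le> e * ?g n"
    using B2_eventually_pos lyap_eventually_le[OF t U0] eventually_ge_at_top[of 1]
  proof eventually_elim
    case (elim n)
    have L: "lyap_ratio a n t = lyap (wt n) t" using elim t by (intro lyap_ratio_eq) auto
    have "0 < x n" "x n \<le> B * sqrt (ln (inverse (lyap (wt n) t)))"
      unfolding L[symmetric] using x elim by blast+
    then show ?case
      unfolding prob_psum[OF elim(1)]
      using elim b by (intro reg[OF unit_weights_wt unit_sum_wt]) auto
  qed
qed

text \<open>The condition on x is imposed where the standard deviation is positive; as it tends to
  infinity, this holds for all large n, and there the quotient is the one of the normalised
  weights.\<close>

lemma gauss_sequence:
  assumes p: "2 < p" and int: "integrable M (\<lambda>w. \<bar>\<xi> 0 w\<bar> powr p)"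
    and x: "\<forall>n\<ge>1. 0 < psum_sd M a \<xi> n \<longrightarrow> (x n)\<^sup>2 \<le> 2 * ln (inverse (lyap_ratio a n p))"
  shows "eq_up_to_o1 (\<lambda>n. prob {w \<in> space M. x n * psum_sd M a \<xi> n \<le> psum X n w}) (\<lambda>n. 1 - std_normal_cdf (x n))"
    (is "eq_up_to_o1 ?f ?g")
proof (rule eq_up_to_o1I)
  show "\<forall>\<^sub>F n in sequentially. 0 < ?g n" by (intro always_eventually allI std_normal_tail_pos)
  fix e :: real assume e: "0 < e" "e \<le> 1"
  obtain U0 where U0: "0 < U0"
    and reg: "\<And>(w :: int \<Rightarrow> real) Z x. N.unit_sum w Z \<Longrightarrow> lyap w p \<le> U0 \<Longrightarrow>
      x\<^sup>2 \<le> 2 * ln (inverse (lyap w p)) \<Longrightarrow>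
      \<bar>prob {\<omega> \<in> space M. x \<le> Z \<omega>} - (1 - std_normal_cdf x)\<bar> \<le> e * (1 - std_normal_cdf x)"
    by (rule N.gauss_regime[OF p moment_scaled[OF int] e]) blast
  show "\<forall>\<^sub>F n in sequentially. \<bar>?f n - ?g n\<bar> \<le> e * ?g n"
    using B2_eventually_pos lyap_eventually_le[OF p U0] eventually_ge_at_top[of 1]
  proof eventually_elim
    case (elim n)
    have "0 < psum_sd M a \<xi> n" using elim sg_pos by (simp add: psum_sd_eq)
    moreover have L: "lyap_ratio a n p = lyap (wt n) p" using elim p by (intro lyap_ratio_eq) auto
    ultimately have "(x n)\<^sup>2 \<le> 2 * ln (inverse (lyap (wt n) p))"
      unfolding L[symmetric] using x elim by blast
    then show ?case
      unfolding prob_psum[OF elim(1)] using elim by (intro reg[OF unit_sum_wt]) auto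
  qed
qed

end

theorem corollary2p3:
  fixes M :: "'a measure"
    and \<xi> X :: "int \<Rightarrow> 'a \<Rightarrow> real"
    and a :: "int \<Rightarrow> real"
  assumes "prob_space M"
    and "iid_family M \<xi>"
    and "integrable M (\<lambda>w. (\<xi> 0 w)\<^sup>2)"
    and "integral\<^sup>L M (\<xi> 0) = 0"
    and "(\<lambda>i. (a i)\<^sup>2) summable_on UNIV"
    and "linear_process M a \<xi> X"
    and "filterlim (psum_var M a \<xi>) at_top sequentially"
  shows
    "(\<forall>t h p. t > 2 \<and> regular_right_tail M (\<xi> 0) t h
        \<and> p > 2 \<and> integrable M (\<lambda>w. \<bar>\<xi> 0 w\<bar> powr p)
        \<and> (\<forall>n\<ge>1. \<forall>i. bcoef a n i > 0) \<longrightarrow>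
        (\<forall>x::nat \<Rightarrow> real. (\<exists>c>0. \<forall>n\<ge>1. x n \<ge> c) \<longrightarrow>
           (\<exists>e1 e2. e1 \<longlonglongrightarrow> (0::real) \<and> e2 \<longlonglongrightarrow> (0::real) \<and>
              (\<forall>\<^sub>F n in sequentially.
                 \<P>(w in M. psum X n w \<ge> x n * psum_sd M a \<xi> n)
                 = (1 + e1 n) * jump_tail M a \<xi> n (x n * psum_sd M a \<xi> n)
                   + (1 - std_normal_cdf (x n)) * (1 + e2 n))))
      \<and> (\<forall>(x::nat \<Rightarrow> real) A. A > sqrt 2
           \<and> (\<forall>n\<ge>1. x n \<ge> A * sqrt (ln (inverse (lyap_ratio a n t)))) \<longrightarrow>
           eq_up_to_o1 (\<lambda>n. \<P>(w in M. psum X n w \<ge> x n * psum_sd M a \<xi> n))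
             (\<lambda>n. jump_tail M a \<xi> n (x n * psum_sd M a \<xi> n)))
      \<and> (\<forall>(x::nat \<Rightarrow> real) B. B < sqrt 2
           \<and> (\<forall>n\<ge>1. 0 < x n \<and> x n \<le> B * sqrt (ln (inverse (lyap_ratio a n t)))) \<longrightarrow>
           eq_up_to_o1 (\<lambda>n. \<P>(w in M. psum X n w \<ge> x n * psum_sd M a \<xi> n))
             (\<lambda>n. 1 - std_normal_cdf (x n))))
   \<and> (\<forall>t h. t > 2 \<and> regular_right_tail M (\<xi> 0) t h
        \<and> (\<forall>n\<ge>1. \<forall>i. bcoef a n i > 0) \<longrightarrow>
        (\<forall>(x::nat \<Rightarrow> real) C. C > exp (t / 2) * (t + 2) / sqrt 2
           \<and> (\<forall>n\<ge>1. x n \<ge> C * sqrt (ln (inverse (lyap_ratio a n t)))) \<longrightarrow>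
           eq_up_to_o1 (\<lambda>n. \<P>(w in M. psum X n w \<ge> x n * psum_sd M a \<xi> n))
             (\<lambda>n. jump_tail M a \<xi> n (x n * psum_sd M a \<xi> n))))
   \<and> (\<forall>p. p > 2 \<and> integrable M (\<lambda>w. \<bar>\<xi> 0 w\<bar> powr p) \<longrightarrow>
        (\<forall>x::nat \<Rightarrow> real.
           (\<forall>n\<ge>1. psum_sd M a \<xi> n > 0 \<longrightarrow> (x n)\<^sup>2 \<le> 2 * ln (inverse (lyap_ratio a n p))) \<longrightarrow>
           eq_up_to_o1 (\<lambda>n. \<P>(w in M. psum X n w \<ge> x n * psum_sd M a \<xi> n))
             (\<lambda>n. 1 - std_normal_cdf (x n))))"
proof -
  interpret prob_space M by fact
  interpret long_memory_sum M \<xi> X a by unfold_locales fact+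
  \<comment> \<open>Since t > 2, the bound assumed on C is at least 2 / sqrt 2 = sqrt 2, so the
    sequence lemma for the jump regime applies with A = C.\<close>
  have C: "sqrt 2 < C" if "2 < t" "exp (t / 2) * (t + 2) / sqrt 2 < C" for t C :: real
  proof -
    have "1 * 2 \<le> exp (t / 2) * (t + 2)" using that by (intro mult_mono) auto
    then have "2 / sqrt 2 \<le> exp (t / 2) * (t + 2) / sqrt 2" by (intro divide_right_mono) auto
    then show ?thesis using that by (simp add: real_div_sqrt)
  qed
  show ?thesis
  proof (intro conjI allI impI, goal_cases)
    case (1 t h p x)
    then show ?case by (elim conjE exE) (rule mixed_sequence; assumption)
  next
    case (2 t h p x A)
    then show ?case by (elim conjE) (rule jump_sequence; assumption)
  next
    case (3 t h p x B)
    then show ?case by (elim conjE) (rule normal_sequence; assumption)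
  next
    case (4 t h x C)
    then show ?case by (elim conjE) (rule jump_sequence[OF _ _ _ C]; assumption)
  next
    case (5 p x)
    then show ?case by (elim conjE) (rule gauss_sequence; assumption)
  qed
qed

end
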